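(* Let $t\ge2$ be an integer and let $\mathbf{c}=(c_i)_{i\ge1}$ be a sequence of nonnegative real numbers with $c_i\ge1$ for all $i\ge t$. Then for every $\rho>0$ there exists $n_0=n_0(\rho,c_t)$ such that for every $n>n_0$ and every $n$-vertex graph $G$ there exists an $n$-vertex graph $\tilde G$ with $\mathrm{cov}_t(G,\mathbf{c})\le\mathrm{cov}^*_t(\tilde G,\mathbf{c})+\rho n^t$ and $\mathrm{dec}_t(G,\mathbf{c})\le\mathrm{dec}^*_t(\tilde G,\mathbf{c})+\rho n^t$.
   Context: All graphs are finite and simple. A clique of $G$ is a nonempty set of pairwise adjacent vertices; $\mathcal{K}(G)$ is the set of cliques of $G$ and $\mathcal{K}_t(G)$ the set of cliques with exactly $t$ vertices. For $f:\mathcal{K}(G)\to\mathbb{R}$, its $\mathbf{c}$-cost is $\|f\|_{\mathbf{c}}=\sum_{K\in\mathcal{K}(G)}c_{|K|}f(K)$. A $t$-clique cover (resp. decomposition) of $G$ is $f:\mathcal{K}(G)\to\{0,1\}$ with $\sum_{K\in\mathcal{K}(G),\,T\subseteq K}f(K)\ge1$ (resp. $=1$) for every $T\in\mathcal{K}_t(G)$; fractional versions allow $f:\mathcal{K}(G)\to\mathbb{R}_{\ge0}$. $\mathrm{cov}_t(G,\mathbf{c})$, $\mathrm{dec}_t(G,\mathbf{c})$, $\mathrm{cov}^*_t(G,\mathbf{c})$, $\mathrm{dec}^*_t(G,\mathbf{c})$ denote the minimum $\mathbf{c}$-cost of a $t$-clique cover, $t$-clique decomposition, fractional $t$-clique cover,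 fractional $t$-clique decomposition of $G$, respectively. *)

theory Defs
  imports "HOL-Analysis.Analysis" "HOL-Library.Ramsey"
begin

definition fin_graph :: "'a set \<Rightarrow> 'a set set \<Rightarrow> bool" where
  "fin_graph V E \<longleftrightarrow> finite V \<and> E \<subseteq> nsets V 2"

definition cliques :: "'a set \<Rightarrow> 'a set set \<Rightarrow> 'a set set" where
  "cliques V E = {K. K \<noteq> {} \<and> K \<subseteq> V \<and> (\<forall>u\<in>K. \<forall>v\<in>K. u \<noteq> v \<longrightarrow> {u, v} \<in> E)}"

definition cliques_of_size :: "nat \<Rightarrow> 'a set \<Rightarrow> 'a set set \<Rightarrow> 'a set set" where
  "cliques_of_size t V E = {K \<in> cliques V E. card K = t}"

text \<open>Functions on cliques are represented by functions on all sets of vertices; their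
  values outside \<open>cliques V E\<close> are never used.\<close>

definition cost :: "'a set \<Rightarrow> 'a set set \<Rightarrow> (nat \<Rightarrow> real) \<Rightarrow> ('a set \<Rightarrow> real) \<Rightarrow> real" where
  "cost V E c f = (\<Sum>K\<in>cliques V E. c (card K) * f K)"

definition cover_weight :: "'a set \<Rightarrow> 'a set set \<Rightarrow> ('a set \<Rightarrow> real) \<Rightarrow> 'a set \<Rightarrow> real" where
  "cover_weight V E f T = (\<Sum>K \<in> {K \<in> cliques V E. T \<subseteq> K}. f K)"

definition clique_cover :: "nat \<Rightarrow> 'a set \<Rightarrow> 'a set set \<Rightarrow> ('a set \<Rightarrow> real) \<Rightarrow> bool" where
  "clique_cover t V E f \<longleftrightarrow> (\<forall>K \<in> cliques V E. f K \<in> {0, 1}) \<and>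
     (\<forall>T \<in> cliques_of_size t V E. cover_weight V E f T \<ge> 1)"

definition clique_decomposition :: "nat \<Rightarrow> 'a set \<Rightarrow> 'a set set \<Rightarrow> ('a set \<Rightarrow> real) \<Rightarrow> bool" where
  "clique_decomposition t V E f \<longleftrightarrow> (\<forall>K \<in> cliques V E. f K \<in> {0, 1}) \<and>
     (\<forall>T \<in> cliques_of_size t V E. cover_weight V E f T = 1)"

definition frac_clique_cover :: "nat \<Rightarrow> 'a set \<Rightarrow> 'a set set \<Rightarrow> ('a set \<Rightarrow> real) \<Rightarrow> bool" where
  "frac_clique_cover t V E f \<longleftrightarrow> (\<forall>K \<in> cliques V E. f K \<ge> 0) \<and>
     (\<forall>T \<in> cliques_of_size t V E. cover_weight V E f T \<ge> 1)"

definition frac_clique_decomposition :: "nat \<Rightarrow> 'a set \<Rightarrow> 'a set set \<Rightarrow> ('a set \<Rightarrow> real) \<Rightarrow> bool" where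
  "frac_clique_decomposition t V E f \<longleftrightarrow> (\<forall>K \<in> cliques V E. f K \<ge> 0) \<and>
     (\<forall>T \<in> cliques_of_size t V E. cover_weight V E f T = 1)"

text \<open>The minimum costs are written as infima; the lemmas \<open>cov_attained\<close>, \<open>dec_attained\<close>,
  \<open>frac_cov_attained\<close> and \<open>frac_dec_attained\<close> below show that, for \<open>t \<ge> 1\<close> and
  nonnegative costs, each is attained and hence a minimum.\<close>

definition cov :: "nat \<Rightarrow> 'a set \<Rightarrow> 'a set set \<Rightarrow> (nat \<Rightarrow> real) \<Rightarrow> real" where
  "cov t V E c = Inf {cost V E c f | f. clique_cover t V E f}"

definition dec :: "nat \<Rightarrow> 'a set \<Rightarrow> 'a set set \<Rightarrow> (nat \<Rightarrow> real) \<Rightarrow> real" where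
  "dec t V E c = Inf {cost V E c f | f. clique_decomposition t V E f}"

definition frac_cov :: "nat \<Rightarrow> 'a set \<Rightarrow> 'a set set \<Rightarrow> (nat \<Rightarrow> real) \<Rightarrow> real" where
  "frac_cov t V E c = Inf {cost V E c f | f. frac_clique_cover t V E f}"

definition frac_dec :: "nat \<Rightarrow> 'a set \<Rightarrow> 'a set set \<Rightarrow> (nat \<Rightarrow> real) \<Rightarrow> real" where
  "frac_dec t V E c = Inf {cost V E c f | f. frac_clique_decomposition t V E f}"


lemma finite_cliques: "fin_graph V E \<Longrightarrow> finite (cliques V E)"
  by (rule finite_subset[of _ "Pow V"]) (auto simp: cliques_def fin_graph_def)

lemma cliqueD:
  assumes "fin_graph V E" "K \<in> cliques V E"
  shows "finite K" "card K \<ge> 1"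
proof -
  show "finite K"
    using assms by (auto simp: cliques_def fin_graph_def intro: finite_subset)
  then show "card K \<ge> 1"
    using assms by (auto simp: cliques_def Suc_le_eq card_gt_0_iff)
qed

lemma all_t_cliques_decompose:
  fixes t :: nat
  assumes "fin_graph V E"
  defines "f \<equiv> \<lambda>K. if card K = t then 1 else (0::real)"
  shows "clique_decomposition t V E f"
proof -
  have "cover_weight V E f T = 1" if T: "T \<in> cliques_of_size t V E" for T
  proof -
    have "cover_weight V E f T = (\<Sum>K \<in> {K \<in> cliques V E. T \<subseteq> K}. if K = T then 1 else 0)"
      unfolding cover_weight_def f_def
      using T by (intro sum.cong refl)
        (auto simp: cliques_of_size_def dest: card_subset_eq[OF cliqueD(1)[OF assms(1)]])
    also have "\<dots> = 1"
      using T finite_cliques[OF assms(1)] by (subst sum.delta) (auto simp: cliques_of_size_def)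
    finally show ?thesis .
  qed
  then show ?thesis
    by (auto simp: clique_decomposition_def f_def)
qed

lemma binary_attained:
  assumes G: "fin_graph V E" and ex: "\<exists>f. P f"
    and bin: "\<And>f. P f \<Longrightarrow> \<forall>K \<in> cliques V E. f K \<in> {0, 1::real}"
  shows "\<exists>f. P f \<and> cost V E c f = Inf {cost V E c f | f. P f}"
proof -
  let ?A = "{cost V E c f | f. P f}"
  have "?A \<subseteq> (\<lambda>S. \<Sum>K\<in>S. c (card K)) ` Pow (cliques V E)"
  proof clarify
    fix f assume "P f"
    let ?S = "{K \<in> cliques V E. f K = 1}"
    have "cost V E c f = (\<Sum>K\<in>cliques V E. if f K = 1 then c (card K) else 0)"
      unfolding cost_def using bin[OF \<open>P f\<close>] by (intro sum.cong) auto
    also have "\<dots> = (\<Sum>K\<in>?S. c (card K))"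
      using finite_cliques[OF G] by (simp add: sum.inter_filter)
    finally show "cost V E c f \<in> (\<lambda>S. \<Sum>K\<in>S. c (card K)) ` Pow (cliques V E)"
      by blast
  qed
  then have "finite ?A"
    using finite_cliques[OF G] by (meson finite_Pow_iff finite_imageI finite_subset)
  moreover have "?A \<noteq> {}"
    using ex by blast
  ultimately have "Inf ?A \<in> ?A"
    by (simp only: cInf_eq_Min Min_in not_False_eq_True)
  then obtain f where "Inf ?A = cost V E c f" "P f"
    by blast
  then show ?thesis
    by (intro exI[of _ f]) simp
qed

lemma cov_attained:
  assumes "fin_graph V E"
  shows "\<exists>f. clique_cover t V E f \<and> cost V E c f = cov t V E c"
  unfolding cov_def
proof (rule binary_attained[OF assms])
  show "\<exists>f. clique_cover t V E f"
    using all_t_cliques_decompose[OF assms, of t]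
    by (auto simp: clique_cover_def clique_decomposition_def)
qed (simp add: clique_cover_def)

lemma dec_attained:
  assumes "fin_graph V E"
  shows "\<exists>f. clique_decomposition t V E f \<and> cost V E c f = dec t V E c"
  unfolding dec_def
proof (rule binary_attained[OF assms])
  show "\<exists>f. clique_decomposition t V E f"
    using all_t_cliques_decompose[OF assms, of t] by blast
qed (simp add: clique_decomposition_def)

lemma compact_unit_box: "compact {f :: 'a \<Rightarrow> real. \<forall>x. f x \<in> {0..1}}"
proof -
  have "compactin (product_topology (\<lambda>_. euclidean) UNIV) (PiE UNIV (\<lambda>_::'a. {0..1::real}))"
    by (subst compactin_PiE) auto
  moreover have "PiE UNIV (\<lambda>_::'a. {0..1::real}) = {f. \<forall>x. f x \<in> {0..1}}"
    by (auto simp: PiE_def Pi_def)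
  ultimately show ?thesis
    by (metis compactin_euclidean_iff euclidean_product_topology)
qed

lemma continuous_cost: "continuous_on UNIV (cost V E c)"
  unfolding cost_def
  by (intro continuous_on_sum continuous_on_mult continuous_on_const continuous_on_product_coordinates)

lemma frac_attained:
  assumes G: "fin_graph V E" and ex: "\<exists>f. P f" and cl: "closed {f. P f}"
    and trunc: "\<And>f. P f \<Longrightarrow> \<exists>g. P g \<and> (\<forall>K. g K \<in> {0..1}) \<and> cost V E c g \<le> cost V E c f"
  shows "\<exists>f. P f \<and> cost V E c f = Inf {cost V E c f | f. P f}"
proof -
  let ?S = "{f. \<forall>K. f K \<in> {0..1}} \<inter> {f. P f}"
  have "compact ?S"
    using compact_unit_box cl by (rule compact_Int_closed)
  moreover have "?S \<noteq> {}"
    using ex trunc by blast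
  moreover have "continuous_on ?S (cost V E c)"
    by (rule continuous_on_subset[OF continuous_cost]) simp
  ultimately have "\<exists>g\<in>?S. \<forall>f\<in>?S. cost V E c g \<le> cost V E c f"
    by (rule continuous_attains_inf)
  then obtain g where g: "g \<in> ?S" "\<And>f. f \<in> ?S \<Longrightarrow> cost V E c g \<le> cost V E c f"
    by blast
  have "cost V E c g \<le> cost V E c f" if f: "P f" for f
  proof -
    obtain h where "P h" "\<forall>K. h K \<in> {0..1}" "cost V E c h \<le> cost V E c f"
      using trunc[OF f] by blast
    then show ?thesis
      using g(2)[of h] by auto
  qed
  then have "Inf {cost V E c f | f. P f} = cost V E c g"
    using g(1) by (intro cInf_eq_minimum) auto
  then show ?thesis
    using g(1) by auto
qed

lemma continuous_cover_weight: "continuous_on UNIV (\<lambda>f. cover_weight V E f T)"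
  unfolding cover_weight_def
  by (intro continuous_on_sum continuous_on_product_coordinates)

lemma closed_nonneg: "closed {f. \<forall>K \<in> cliques V E. f K \<ge> (0::real)}"
proof -
  have "closed {f :: 'a set \<Rightarrow> real. f K \<ge> 0}" for K
    by (rule closed_Collect_le[OF continuous_on_const continuous_on_product_coordinates])
  then have "closed (\<Inter>K \<in> cliques V E. {f. f K \<ge> (0::real)})"
    by blast
  then show ?thesis
    by (simp add: INTER_eq)
qed

lemma closed_frac_cover: "closed {f. frac_clique_cover t V E f}"
proof -
  have "closed {f. cover_weight V E f T \<ge> 1}" for T
    by (rule closed_Collect_le[OF continuous_on_const continuous_cover_weight])
  then have "closed ({f. \<forall>K \<in> cliques V E. f K \<ge> 0} \<inter>
      (\<Inter>T \<in> cliques_of_size t V E. {f. cover_weight V E f T \<ge> 1}))"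
    using closed_nonneg by blast
  then show ?thesis
    by (simp add: frac_clique_cover_def INTER_eq Collect_conj_eq)
qed

lemma closed_frac_decomposition: "closed {f. frac_clique_decomposition t V E f}"
proof -
  have "closed {f. cover_weight V E f T = 1}" for T
    by (rule closed_Collect_eq[OF continuous_cover_weight continuous_on_const])
  then have "closed ({f. \<forall>K \<in> cliques V E. f K \<ge> 0} \<inter>
      (\<Inter>T \<in> cliques_of_size t V E. {f. cover_weight V E f T = 1}))"
    using closed_nonneg by blast
  then show ?thesis
    by (simp add: frac_clique_decomposition_def INTER_eq Collect_conj_eq)
qed

lemma decomposition_imp_frac:
  assumes "clique_decomposition t V E f"
  shows "frac_clique_cover t V E f" "frac_clique_decomposition t V E f"
proof -
  have "f K \<ge> 0" if "K \<in> cliques V E" for K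
  proof -
    have "f K \<in> {0, 1}"
      using assms that by (simp add: clique_decomposition_def)
    then show ?thesis
      by auto
  qed
  then show "frac_clique_cover t V E f" "frac_clique_decomposition t V E f"
    using assms
    by (simp_all add: frac_clique_cover_def frac_clique_decomposition_def clique_decomposition_def)
qed

lemma frac_cov_attained:
  assumes G: "fin_graph V E" and c: "\<forall>i\<ge>1. 0 \<le> c i"
  shows "\<exists>f. frac_clique_cover t V E f \<and> cost V E c f = frac_cov t V E c"
  unfolding frac_cov_def
proof (rule frac_attained[OF G])
  show "\<exists>f. frac_clique_cover t V E f"
    using all_t_cliques_decompose[OF G, of t] decomposition_imp_frac by blast
  show "closed {f. frac_clique_cover t V E f}"
    by (rule closed_frac_cover)
next
  fix f assume f: "frac_clique_cover t V E f"
  let ?g = "\<lambda>K. max 0 (min 1 (f K))"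
  have fin: "finite {K \<in> cliques V E. T \<subseteq> K}" for T
    using finite_cliques[OF G] by simp
  have f0: "f K \<ge> 0" if "K \<in> cliques V E" for K
    using f that by (auto simp: frac_clique_cover_def)
  have "cover_weight V E ?g T \<ge> 1" if T: "T \<in> cliques_of_size t V E" for T
  proof (cases "\<exists>K \<in> cliques V E. T \<subseteq> K \<and> f K \<ge> 1")
    case True
    then obtain K where K: "K \<in> {K \<in> cliques V E. T \<subseteq> K}" "f K \<ge> 1"
      by blast
    then have "1 \<le> ?g K"
      by simp
    also have "\<dots> \<le> cover_weight V E ?g T"
      unfolding cover_weight_def by (rule member_le_sum[OF K(1) _ fin]) simp
    finally show ?thesis .
  next
    case False
    then have "cover_weight V E ?g T = cover_weight V E f T"
      unfolding cover_weight_def using f0 by (intro sum.cong) (auto simp: max_def min_def)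
    then show ?thesis
      using f T by (simp add: frac_clique_cover_def)
  qed
  moreover have "cost V E c ?g \<le> cost V E c f"
    unfolding cost_def using c f0 cliqueD(2)[OF G] by (intro sum_mono mult_left_mono) auto
  ultimately show "\<exists>g. frac_clique_cover t V E g \<and> (\<forall>K. g K \<in> {0..1}) \<and> cost V E c g \<le> cost V E c f"
    by (intro exI[of _ ?g]) (auto simp: frac_clique_cover_def)
qed

lemma frac_dec_attained:
  assumes G: "fin_graph V E" and c: "\<forall>i\<ge>1. 0 \<le> c i" and t: "t \<ge> 1"
  shows "\<exists>f. frac_clique_decomposition t V E f \<and> cost V E c f = frac_dec t V E c"
  unfolding frac_dec_def
proof (rule frac_attained[OF G])
  show "\<exists>f. frac_clique_decomposition t V E f"
    using all_t_cliques_decompose[OF G, of t] decomposition_imp_frac by blast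
  show "closed {f. frac_clique_decomposition t V E f}"
    by (rule closed_frac_decomposition)
next
  fix f assume f: "frac_clique_decomposition t V E f"
  let ?g = "\<lambda>K. if K \<in> cliques V E \<and> t \<le> card K then f K else 0"
  have fin: "finite {K \<in> cliques V E. T \<subseteq> K}" for T
    using finite_cliques[OF G] by simp
  have f0: "f K \<ge> 0" if "K \<in> cliques V E" for K
    using f that by (auto simp: frac_clique_decomposition_def)
  have f1: "f K \<le> 1" if K: "K \<in> cliques V E" "t \<le> card K" for K
  proof -
    obtain T where T: "T \<subseteq> K" "card T = t"
      using obtain_subset_with_card_n[OF K(2)] by metis
    with K t have "T \<in> cliques_of_size t V E"
      by (auto simp: cliques_of_size_def cliques_def)
    then have "cover_weight V E f T = 1"
      using f by (simp add: frac_clique_decomposition_def)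
    moreover have "f K \<le> cover_weight V E f T"
      unfolding cover_weight_def using K T f0 by (intro member_le_sum[OF _ _ fin]) auto
    ultimately show ?thesis
      by simp
  qed
  have "cover_weight V E ?g T = 1" if T: "T \<in> cliques_of_size t V E" for T
  proof -
    have "cover_weight V E ?g T = cover_weight V E f T"
      unfolding cover_weight_def
      using T cliqueD(1)[OF G] by (intro sum.cong refl) (auto simp: cliques_of_size_def card_mono)
    then show ?thesis
      using f T by (simp add: frac_clique_decomposition_def)
  qed
  moreover have "cost V E c ?g \<le> cost V E c f"
    unfolding cost_def using c f0 cliqueD(2)[OF G] by (intro sum_mono mult_left_mono) auto
  ultimately show "\<exists>g. frac_clique_decomposition t V E g \<and> (\<forall>K. g K \<in> {0..1}) \<and>
      cost V E c g \<le> cost V E c f"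
    using f0 f1 by (intro exI[of _ ?g]) (auto simp: frac_clique_decomposition_def)
qed

end

theory Submission
  imports Defs
begin

text \<open>
  Both parameters of \<open>G\<close> are compared with averages over its \<open>m\<close>-vertex induced subgraphs, for
  a large constant \<open>m\<close>. Giving each of these subgraphs an optimal fractional cover or
  decomposition and averaging yields a fractional one of \<open>G\<close> which uses cliques of at most \<open>m\<close>
  vertices only, and in which two \<open>t\<close>-cliques are rarely covered together. Such a system is the
  same as a fractional matching with small codegrees in the hypergraph whose vertices are the
  \<open>t\<close>-cliques of \<open>G\<close>, and the Roedl nibble rounds it to an integral one at a cost of \<open>o(n^t)\<close>.
  Conversely, blowing up an \<open>M\<close>-vertex graph multiplies its fractional parameters by at least the
  expected factor, so the required graph can be a blow-up of an induced subgraph \<open>S\<close> of \<open>G\<close> on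
  \<open>M\<close> vertices, provided that the densities of \<open>S\<close> are about as large as the averages at
  scale \<open>m\<close>, for covers and decompositions simultaneously. The averages decrease with \<open>m\<close>, so
  there are consecutive scales \<open>m\<close> and \<open>M\<close> between which they hardly change, and a second moment
  computation then shows that most \<open>S\<close> qualify.
\<close>

section \<open>The nibble\<close>

text \<open>The threshold \<open>n0\<close> may depend on \<open>\<rho>\<close> and
  \<open>c t\<close> alone, so no estimate may involve the other costs, which can be arbitrarily
  large. Two facts make this possible. Since \<open>c i \<ge> 1\<close> for
  \<open>i \<ge> t\<close>, the weight on cliques with at least \<open>t\<close> vertices is at most
  the cost, and an optimal cost is at most \<open>c t\<close> per \<open>t\<close>-set; this yields
  the small codegrees. In the rounding an edge is valued by what it saves against covering its
  \<open>t\<close>-cliques one by one at price \<open>c t\<close>, with savings truncated at 0, so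
  that the values are bounded.

  The fractional optimum of \<open>G\<close> itself cannot be the benchmark: it may rely on huge
  cliques and lie far below the averages at bounded scales. A blow-up of \<open>S\<close> has no
  clique on more than \<open>M\<close> vertices, and its systems project back to \<open>S\<close>
  with clique sizes preserved.

  The nibble is not followed through many rounds. The loss per vertex is treated as an unknown
  achievable number; one bite turns an achievable loss into a strictly smaller one, which forces the
  infimum of the achievable losses to be 0.\<close>

lemma sum_UN_le:
  fixes f :: "'b \<Rightarrow> real"
  assumes "finite A" "\<And>a. a \<in> A \<Longrightarrow> finite (S a)" "\<And>a b. a \<in> A \<Longrightarrow> b \<in> S a \<Longrightarrow> f b \<ge> 0"
  shows "sum f (\<Union>a\<in>A. S a) \<le> (\<Sum>a\<in>A. sum f (S a))"
  using assms
proof (induction rule: finite_induct)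
  case (insert a A)
  then have "sum f (\<Union>a\<in>insert a A. S a) \<le> sum f (S a) + sum f (\<Union>a\<in>A. S a)"
    by (subst UN_insert, subst sum_Un) (auto intro!: sum_nonneg)
  also have "\<dots> \<le> sum f (S a) + (\<Sum>a\<in>A. sum f (S a))"
    using insert by (intro add_left_mono insert.IH) auto
  finally show ?case using insert by simp
qed simp

section \<open>Expectation over a random subset that contains each \<open>j\<close> independently
  with probability \<open>p j\<close>\<close>

definition subset_expectation :: "('j \<Rightarrow> real) \<Rightarrow> 'j set \<Rightarrow> ('j set \<Rightarrow> real) \<Rightarrow> real" where
  "subset_expectation p J F = (\<Sum>R\<in>Pow J. (\<Prod>j\<in>R. p j) * (\<Prod>j\<in>J - R. 1 - p j) * F R)"

text \<open>Factoring out the constraint on \<open>A\<close> leaves the total mass of a random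
  subset of \<open>J - A\<close>, which is 1 by expanding the product of the factors
  \<open>p j + (1 - p j)\<close>.\<close>

lemma subset_expectation_avoid:
  assumes "finite J" "A \<subseteq> J"
  shows "subset_expectation p J (\<lambda>R. of_bool (R \<inter> A = {})) = (\<Prod>j\<in>A. 1 - p j)"
proof -
  have fin: "finite A" "finite (J - A)"
    using assms by (auto intro: finite_subset)
  have "subset_expectation p J (\<lambda>R. of_bool (R \<inter> A = {})) =
      (\<Sum>R\<in>Pow (J - A). (\<Prod>j\<in>R. p j) * (\<Prod>j\<in>J - R. 1 - p j))"
    unfolding subset_expectation_def using assms
    by (intro sum.mono_neutral_cong_right) auto
  also have "\<dots> = (\<Sum>R\<in>Pow (J - A). (\<Prod>j\<in>A. 1 - p j) * ((\<Prod>j\<in>R. p j) * (\<Prod>j\<in>J - A - R. 1 - p j)))"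
  proof (rule sum.cong[OF refl])
    fix R assume "R \<in> Pow (J - A)"
    then have "J - R = A \<union> (J - A - R)" using assms(2) by auto
    then have "(\<Prod>j\<in>J - R. 1 - p j) = (\<Prod>j\<in>A \<union> (J - A - R). 1 - p j)" by simp
    also have "\<dots> = (\<Prod>j\<in>A. 1 - p j) * (\<Prod>j\<in>J - A - R. 1 - p j)"
      using fin by (intro prod.union_disjoint) auto
    finally show "(\<Prod>j\<in>R. p j) * (\<Prod>j\<in>J - R. 1 - p j) =
       (\<Prod>j\<in>A. 1 - p j) * ((\<Prod>j\<in>R. p j) * (\<Prod>j\<in>J - A - R. 1 - p j))" by simp
  qed
  also have "\<dots> = (\<Prod>j\<in>A. 1 - p j) * (\<Prod>j\<in>J - A. p j + (1 - p j))"
    by (simp only: prod_add[OF fin(2)] sum_distrib_left)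
  finally show ?thesis by simp
qed

lemma subset_expectation_sum:
  "subset_expectation p J (\<lambda>R. \<Sum>a\<in>S. F a R) = (\<Sum>a\<in>S. subset_expectation p J (F a))"
  unfolding subset_expectation_def sum_distrib_left by (rule sum.swap)

lemma subset_expectation_cmult:
  "subset_expectation p J (\<lambda>R. a * F R) = a * subset_expectation p J F"
  unfolding subset_expectation_def sum_distrib_left by (simp add: mult_ac)

lemma subset_expectation_add:
  "subset_expectation p J (\<lambda>R. F R + G R) = subset_expectation p J F + subset_expectation p J G"
  unfolding subset_expectation_def by (simp add: distrib_left sum.distrib)

lemma subset_expectation_diff:
  "subset_expectation p J (\<lambda>R. F R - G R) = subset_expectation p J F - subset_expectation p J G"
  unfolding subset_expectation_def by (simp add: right_diff_distrib sum_subtractf)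

text \<open>The event is the difference of two avoidance events, missing \<open>A\<close> and
  missing \<open>insert i A\<close>.\<close>

lemma subset_expectation_pick:
  assumes "finite J" "A \<subseteq> J" "i \<in> J" "i \<notin> A"
  shows "subset_expectation p J (\<lambda>R. of_bool (i \<in> R \<and> R \<inter> A = {})) = p i * (\<Prod>j\<in>A. 1 - p j)"
proof -
  have "(\<lambda>R. of_bool (i \<in> R \<and> R \<inter> A = {}) :: real) =
      (\<lambda>R. of_bool (R \<inter> A = {}) - of_bool (R \<inter> insert i A = {}))"
    by auto
  moreover have "insert i A \<subseteq> J" using assms by simp
  ultimately have "subset_expectation p J (\<lambda>R. of_bool (i \<in> R \<and> R \<inter> A = {})) =
      (\<Prod>j\<in>A. 1 - p j) - (\<Prod>j\<in>insert i A. 1 - p j)"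
    using assms by (simp only: subset_expectation_diff subset_expectation_avoid)
  also have "(\<Prod>j\<in>insert i A. 1 - p j) = (1 - p i) * (\<Prod>j\<in>A. 1 - p j)"
    using assms by (meson finite_subset prod.insert)
  finally show ?thesis by (simp add: algebra_simps)
qed

text \<open>The first-moment method: the masses are nonnegative and add up to 1, so the values
  cannot all lie below their weighted average.\<close>

lemma subset_expectation_le_ex:
  assumes fin: "finite J" and p: "\<And>j. j \<in> J \<Longrightarrow> 0 \<le> p j \<and> p j \<le> 1"
  shows "\<exists>R\<subseteq>J. F R \<ge> subset_expectation p J F"
proof (rule ccontr)
  let ?E = "subset_expectation p J F" and ?m = "\<lambda>R. (\<Prod>j\<in>R. p j) * (\<Prod>j\<in>J - R. 1 - p j)"
  assume "\<not> ?thesis"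
  then have less: "\<And>R. R \<in> Pow J \<Longrightarrow> F R < ?E" by (metis PowD not_le)
  have m0: "?m R \<ge> 0" if "R \<in> Pow J" for R
    using that p by (intro mult_nonneg_nonneg prod_nonneg) auto
  have tot: "(\<Sum>R\<in>Pow J. ?m R) = 1"
    using prod_add[OF fin, of p "\<lambda>j. 1 - p j"] by simp
  have "\<exists>R\<in>Pow J. ?m R > 0"
  proof (rule ccontr)
    assume "\<not> ?thesis"
    then have "?m R \<le> 0" if "R \<in> Pow J" for R
      using that by (meson not_le)
    then have "(\<Sum>R\<in>Pow J. ?m R) \<le> 0" by (rule sum_nonpos)
    with tot show False by simp
  qed
  then obtain R0 where R0: "R0 \<in> Pow J" "?m R0 > 0" by blast
  have "?E = (\<Sum>R\<in>Pow J. ?m R * F R)" by (simp add: subset_expectation_def)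
  also have "\<dots> < (\<Sum>R\<in>Pow J. ?m R * ?E)"
  proof (rule sum_strict_mono_ex1)
    show "finite (Pow J)" using fin by simp
    show "\<forall>R\<in>Pow J. ?m R * F R \<le> ?m R * ?E"
      by (intro ballI mult_left_mono[OF less_imp_le[OF less] m0])
    show "\<exists>R\<in>Pow J. ?m R * F R < ?m R * ?E"
      using R0 less by (intro bexI[of _ R0] mult_strict_left_mono)
  qed
  also have "\<dots> = ?E" using tot by (simp flip: sum_distrib_right)
  finally show False by simp
qed

text \<open>Edges carry indices, so that equal vertex sets may occur with separate weights, as
  happens when one clique is obtained from several samples. With all degrees equal to 1 and small
  codegrees, vertices survive almost independently when edges are selected at random.\<close>

locale regular_hypergraph =
  fixes X :: "'x set" and J :: "'j set" and e :: "'j \<Rightarrow> 'x set" and w :: "'j \<Rightarrow> real"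
    and r :: nat and \<delta> :: real
  assumes finite_vertices: "finite X" and finite_indices: "finite J"
    and edge_subset: "j \<in> J \<Longrightarrow> e j \<subseteq> X"
    and edge_nonempty: "j \<in> J \<Longrightarrow> e j \<noteq> {}"
    and edge_card: "j \<in> J \<Longrightarrow> card (e j) \<le> r"
    and weight_nonneg: "j \<in> J \<Longrightarrow> w j \<ge> 0"
    and degree: "x \<in> X \<Longrightarrow> (\<Sum>j | j \<in> J \<and> x \<in> e j. w j) = 1"
    and codegree: "x \<in> X \<Longrightarrow> y \<in> X \<Longrightarrow> x \<noteq> y \<Longrightarrow> (\<Sum>j | j \<in> J \<and> x \<in> e j \<and> y \<in> e j. w j) \<le> \<delta>"
    and codegree_nonneg: "\<delta> \<ge> 0"
begin

definition hit :: "'x set \<Rightarrow> 'j set" where "hit A = {j \<in> J. e j \<inter> A \<noteq> {}}"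

lemma finite_hit [simp]: "finite (hit A)" and hit_subset: "hit A \<subseteq> J"
  using finite_indices by (auto simp: hit_def)

lemma finite_edge: "j \<in> J \<Longrightarrow> finite (e j)"
  using edge_subset finite_vertices by (auto intro: finite_subset)

lemma hit_weight_upper:
  assumes "A \<subseteq> X" shows "(\<Sum>j\<in>hit A. w j) \<le> card A"
proof -
  have "finite A" using assms finite_vertices by (rule finite_subset)
  then show ?thesis using assms
  proof (induction rule: finite_induct)
    case empty then show ?case by (simp add: hit_def)
  next
    case (insert x A)
    have "(\<Sum>j\<in>hit (insert x A). w j) \<le> (\<Sum>j\<in>hit A \<union> {j. j \<in> J \<and> x \<in> e j}. w j)"
      using finite_indices weight_nonneg by (intro sum_mono2) (auto simp: hit_def)
    also have "\<dots> \<le> (\<Sum>j\<in>hit A. w j) + (\<Sum>j | j \<in> J \<and> x \<in> e j. w j)"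
      using finite_indices weight_nonneg by (subst sum_Un) (auto intro!: sum_nonneg simp: hit_def)
    also have "\<dots> \<le> card A + 1" using insert degree[of x] by auto
    finally show ?case using insert by simp
  qed
qed

lemma codegree_sum:
  assumes "A \<subseteq> X" "x \<in> X" "x \<notin> A"
  shows "(\<Sum>j | j \<in> J \<and> x \<in> e j \<and> e j \<inter> A \<noteq> {}. w j) \<le> card A * \<delta>"
proof -
  have "(\<Sum>j | j \<in> J \<and> x \<in> e j \<and> e j \<inter> A \<noteq> {}. w j) \<le>
     (\<Sum>j\<in>(\<Union>y\<in>A. {j. j \<in> J \<and> x \<in> e j \<and> y \<in> e j}). w j)"
    using finite_indices weight_nonneg assms finite_subset[OF _ finite_vertices]
    by (intro sum_mono2) auto
  also have "\<dots> \<le> (\<Sum>y\<in>A. \<Sum>j | j \<in> J \<and> x \<in> e j \<and> y \<in> e j. w j)"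
    using finite_indices weight_nonneg assms finite_subset[OF _ finite_vertices]
    by (intro sum_UN_le) auto
  also have "\<dots> \<le> (\<Sum>y\<in>A. \<delta>)" using assms by (intro sum_mono codegree) auto
  finally show ?thesis by simp
qed

text \<open>Truncated inclusion-exclusion: a vertex added to \<open>A\<close> lies in edges of total
  weight 1, of which at most \<open>card A * \<delta>\<close> has been counted already.\<close>

lemma hit_weight_lower:
  assumes "A \<subseteq> X" shows "(\<Sum>j\<in>hit A. w j) \<ge> card A - (card A)\<^sup>2 * \<delta>"
proof -
  have "finite A" using assms finite_vertices by (rule finite_subset)
  then show ?thesis using assms
  proof (induction rule: finite_induct)
    case empty then show ?case by (simp add: hit_def)
  next
    case (insert x A)
    let ?B = "{j. j \<in> J \<and> x \<in> e j}" and ?C = "{j. j \<in> J \<and> x \<in> e j \<and> e j \<inter> A \<noteq> {}}"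
    have "hit (insert x A) = hit A \<union> (?B - ?C)" by (auto simp: hit_def)
    then have "(\<Sum>j\<in>hit (insert x A). w j) = (\<Sum>j\<in>hit A. w j) + (\<Sum>j\<in>?B - ?C. w j)"
      using finite_indices by (simp only:) (intro sum.union_disjoint, auto simp: hit_def)
    moreover have "(\<Sum>j\<in>?B - ?C. w j) = (\<Sum>j\<in>?B. w j) - (\<Sum>j\<in>?C. w j)"
      using finite_indices by (intro sum_diff) auto
    moreover have "(\<Sum>j\<in>?B. w j) = 1" "(\<Sum>j\<in>?C. w j) \<le> card A * \<delta>"
      using degree[of x] codegree_sum[of A x] insert by auto
    moreover have "(\<Sum>j\<in>hit A. w j) \<ge> card A - (card A)\<^sup>2 * \<delta>"
      using insert by auto
    moreover have "(card A)\<^sup>2 * \<delta> + card A * \<delta> \<le> real ((card A + 1)\<^sup>2) * \<delta>"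
      using codegree_nonneg by (simp add: power2_eq_square algebra_simps)
    moreover have card: "card (insert x A) = card A + 1" using insert by simp
    ultimately show ?case unfolding card by (simp add: algebra_simps)
  qed
qed

end

section \<open>Selection and survival probabilities in one bite\<close>

lemma one_minus_exp_ge:
  fixes u :: real assumes "0 \<le> u" shows "u * (1 - u) \<le> 1 - exp (- u)"
proof -
  have "exp (- u) * (1 + u) \<le> exp (- u) * exp u"
    by (intro mult_left_mono) auto
  then have "exp (- u) * (1 + u) \<le> 1" by (simp flip: exp_add)
  moreover have "(1 - u * (1 - u)) * (1 + u) = 1 + u^3"
    by (simp add: algebra_simps power3_eq_cube)
  ultimately have "exp (- u) * (1 + u) \<le> (1 - u * (1 - u)) * (1 + u)"
    using assms zero_le_power[of u 3] by linarith
  then show ?thesis using assms by (simp add: mult_le_cancel_right)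
qed

lemma exp_le_one_plus_double:
  fixes u :: real assumes "0 \<le> u" "u \<le> 1" shows "exp u \<le> 1 + 2 * u"
proof -
  have "exp u \<le> 1 + u + u\<^sup>2" using assms by (rule exp_bound)
  also have "u\<^sup>2 \<le> u" using assms by (simp add: power2_eq_square mult_left_le)
  finally show ?thesis by simp
qed

context regular_hypergraph
begin

lemma weight_le_one: "j \<in> J \<Longrightarrow> w j \<le> 1"
proof -
  assume j: "j \<in> J"
  then obtain x where x: "x \<in> e j" "x \<in> X" using edge_nonempty edge_subset by blast
  have "w j \<le> (\<Sum>j | j \<in> J \<and> x \<in> e j. w j)"
    using finite_indices weight_nonneg j x by (intro member_le_sum) auto
  then show "w j \<le> 1" using degree[OF x(2)] by simp
qed

text \<open>The selection probability \<open>1 - exp (- (\<theta> * w j))\<close> is chosen for this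
  identity: independent avoidances multiply, so only the total weight of \<open>hit A\<close>
  matters and there is no error term.\<close>

lemma avoid_probability:
  fixes \<theta> :: real
  shows
  "subset_expectation (\<lambda>j. 1 - exp (- (\<theta> * w j))) J (\<lambda>R. of_bool (R \<inter> hit A = {})) =
     exp (- (\<theta> * (\<Sum>j\<in>hit A. w j)))"
  using finite_indices hit_subset
  by (subst subset_expectation_avoid) (auto simp: sum_distrib_left simp flip: exp_sum sum_negf)

lemma avoid_probability_ge:
  fixes \<theta> :: real
  assumes "A \<subseteq> X" "\<theta> \<ge> 0"
  shows "subset_expectation (\<lambda>j. 1 - exp (- (\<theta> * w j))) J (\<lambda>R. of_bool (R \<inter> hit A = {})) \<ge>
     exp (- (\<theta> * card A))"
  using hit_weight_upper[OF assms(1)] assms(2) by (simp add: avoid_probability mult_left_mono)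

lemma avoid_probability_le:
  fixes \<theta> :: real
  assumes "A \<subseteq> X" "\<theta> \<ge> 0"
  shows "subset_expectation (\<lambda>j. 1 - exp (- (\<theta> * w j))) J (\<lambda>R. of_bool (R \<inter> hit A = {})) \<le>
     exp (- (\<theta> * card A) + \<theta> * ((card A)\<^sup>2 * \<delta>))"
proof -
  have "\<theta> * (card A - (card A)\<^sup>2 * \<delta>) \<le> \<theta> * (\<Sum>j\<in>hit A. w j)"
    using hit_weight_lower[OF assms(1)] assms(2) by (intro mult_left_mono)
  then show ?thesis by (simp add: avoid_probability algebra_simps)
qed

text \<open>All degrees are exactly 1, hence all vertices survive with the same probability. This
  exactness lets the leading terms cancel in the variance estimate.\<close>

lemma avoid_vertex_probability:
  assumes "x \<in> X"
  shows "subset_expectation (\<lambda>j. 1 - exp (- (\<theta> * w j))) J (\<lambda>R. of_bool (R \<inter> hit {x} = {})) =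
      exp (- \<theta>)"
proof -
  have "hit {x} = {j. j \<in> J \<and> x \<in> e j}" by (auto simp: hit_def)
  then show ?thesis unfolding avoid_probability using degree[OF assms] by simp
qed

text \<open>The other edges that meet \<open>e j\<close> have total weight at most \<open>r\<close>,
  so none of them is selected with probability at least \<open>1 - \<theta> * r\<close>.
  Independently of this, \<open>j\<close> is selected with probability at least
  \<open>\<theta> * w j * (1 - \<theta>)\<close>.\<close>

lemma isolated_probability:
  fixes \<theta> :: real
  assumes j: "j \<in> J" and \<theta>: "0 \<le> \<theta>" "\<theta> \<le> 1"
  shows "subset_expectation (\<lambda>j. 1 - exp (- (\<theta> * w j))) J
     (\<lambda>R. of_bool (j \<in> R \<and> R \<inter> (hit (e j) - {j}) = {})) \<ge> \<theta> * w j * (1 - (r + 1) * \<theta>)"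
proof -
  let ?s = "\<Sum>i\<in>hit (e j) - {j}. w i"
  have w: "0 \<le> w j" "w j \<le> 1" using weight_nonneg weight_le_one j by auto
  have "?s \<le> (\<Sum>i\<in>hit (e j). w i)"
    using hit_subset weight_nonneg by (intro sum_mono2) auto
  also have "\<dots> \<le> r" using hit_weight_upper[OF edge_subset[OF j]] edge_card[OF j] by simp
  finally have "\<theta> * ?s \<le> \<theta> * r" using \<theta> by (intro mult_left_mono)
  then have s: "1 - \<theta> * r \<le> exp (- (\<theta> * ?s))"
    using exp_ge_add_one_self[of "- (\<theta> * ?s)"] by linarith
  have "\<theta> * w j \<le> \<theta>" using w \<theta> by (simp add: mult_left_le)
  then have "(\<theta> * w j) * (1 - \<theta>) \<le> \<theta> * w j * (1 - \<theta> * w j)"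
    using w \<theta> by (intro mult_left_mono) auto
  also have "\<dots> \<le> 1 - exp (- (\<theta> * w j))" using w \<theta> by (intro one_minus_exp_ge) auto
  finally have u: "(\<theta> * w j) * (1 - \<theta>) \<le> 1 - exp (- (\<theta> * w j))" .
  have "\<theta> * w j * (1 - (r + 1) * \<theta>) \<le> \<theta> * w j * ((1 - \<theta>) * (1 - \<theta> * r))"
    using w \<theta> by (intro mult_left_mono) (auto simp: algebra_simps)
  also have "\<dots> = ((\<theta> * w j) * (1 - \<theta>)) * (1 - \<theta> * r)" by simp
  also have "\<dots> \<le> ((\<theta> * w j) * (1 - \<theta>)) * exp (- (\<theta> * ?s))"
    using s w \<theta> by (intro mult_left_mono) auto
  also have "\<dots> \<le> (1 - exp (- (\<theta> * w j))) * exp (- (\<theta> * ?s))"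
    using u by (intro mult_right_mono) auto
  also have "\<dots> = subset_expectation (\<lambda>j. 1 - exp (- (\<theta> * w j))) J
     (\<lambda>R. of_bool (j \<in> R \<and> R \<inter> (hit (e j) - {j}) = {}))"
    using finite_indices hit_subset j
    by (subst subset_expectation_pick) (auto simp: sum_distrib_left simp flip: exp_sum sum_negf)
  finally show ?thesis .
qed

text \<open>The factor \<open>exp (\<theta> * (card (e j) - 1))\<close> undoes the loss of weight at a surviving
  vertex of \<open>e j\<close>, where the other \<open>card (e j) - 1\<close> vertices survive with
  probability close to \<open>exp (- \<theta>)\<close> each.\<close>

definition residual_weight :: "real \<Rightarrow> 'j \<Rightarrow> real" where
  "residual_weight \<theta> j = w j * exp (\<theta> * (card (e j) - 1))"

lemma residual_weight_nonneg: "j \<in> J \<Longrightarrow> residual_weight \<theta> j \<ge> 0"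
  by (simp add: residual_weight_def weight_nonneg)

lemma card_edge_ge_one: "j \<in> J \<Longrightarrow> card (e j) \<ge> 1"
  using edge_nonempty finite_edge by (simp add: Suc_le_eq card_gt_0_iff)

lemma residual_weight_le:
  assumes "j \<in> J" "0 \<le> \<theta>" "\<theta> \<le> 1"
  shows "residual_weight \<theta> j \<le> w j * exp r"
proof -
  have "\<theta> * (real (card (e j)) - 1) \<le> 1 * real r"
    using assms edge_card[OF assms(1)] card_edge_ge_one[OF assms(1)] by (intro mult_mono) auto
  then show ?thesis unfolding residual_weight_def
    using assms card_edge_ge_one[OF assms(1)] weight_nonneg
    by (intro mult_left_mono) (auto simp: of_nat_diff)
qed

lemma survival_weight:
  assumes "j \<in> J" "0 \<le> \<theta>"
  shows "residual_weight \<theta> j * subset_expectation (\<lambda>j. 1 - exp (- (\<theta> * w j))) J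
     (\<lambda>R. of_bool (R \<inter> hit (e j) = {})) \<ge> w j * exp (- \<theta>)"
proof -
  have "w j * exp (- \<theta>) = residual_weight \<theta> j * exp (- (\<theta> * card (e j)))"
    unfolding residual_weight_def using card_edge_ge_one[OF assms(1)]
    by (simp add: of_nat_diff algebra_simps flip: exp_add)
  also have "\<dots> \<le> residual_weight \<theta> j * subset_expectation (\<lambda>j. 1 - exp (- (\<theta> * w j))) J
     (\<lambda>R. of_bool (R \<inter> hit (e j) = {}))"
    using assms edge_subset residual_weight_nonneg
    by (intro mult_left_mono avoid_probability_ge) auto
  finally show ?thesis .
qed

section \<open>Concentration of the degrees after a bite\<close>

definition residual_degree :: "real \<Rightarrow> 'x \<Rightarrow> 'j set \<Rightarrow> real" where
  "residual_degree \<theta> x R =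
     (\<Sum>j | j \<in> J \<and> x \<in> e j. residual_weight \<theta> j * of_bool (R \<inter> hit (e j) = {}))"

text \<open>If the edges share only \<open>x\<close>, their union has
  \<open>card (e i) + card (e j) - 1\<close> vertices, and the two correction factors cancel all but
  one factor \<open>exp (- \<theta>)\<close>, up to a codegree error. Pairs with a further common
  vertex get the crude bound \<open>exp (2 * r)\<close>; small codegrees make their total weight
  small.\<close>

lemma pair_survival:
  assumes x: "x \<in> X" and ij: "i \<in> J" "j \<in> J" "x \<in> e i" "x \<in> e j"
    and \<theta>: "0 \<le> \<theta>" "\<theta> \<le> 1"
  shows "residual_weight \<theta> i * residual_weight \<theta> j *
     subset_expectation (\<lambda>j. 1 - exp (- (\<theta> * w j))) J (\<lambda>R. of_bool (R \<inter> hit (e i \<union> e j) = {}))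
     \<le> w i * w j * (exp (- \<theta>) * exp (4 * r\<^sup>2 * \<delta>)) +
       w i * w j * (exp (2 * r) * of_bool (e j \<inter> (e i - {x}) \<noteq> {}))"
    (is "_ * ?P \<le> _")
proof -
  have ww: "0 \<le> w i * w j" using weight_nonneg ij by simp
  have rw0: "0 \<le> residual_weight \<theta> i * residual_weight \<theta> j" using residual_weight_nonneg ij by simp
  have sub: "e i \<union> e j \<subseteq> X" using ij edge_subset by auto
  show ?thesis
  proof (cases "e j \<inter> (e i - {x}) = {}")
    case True
    then have "e i \<inter> e j = {x}" using ij by auto
    then have card: "card (e i \<union> e j) + 1 = card (e i) + card (e j)"
      using card_Un_Int[of "e i" "e j"] finite_edge ij by simp
    then have "card (e i \<union> e j) \<le> 2 * r" using edge_card[OF ij(1)] edge_card[OF ij(2)] by simp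
    then have "(card (e i \<union> e j))\<^sup>2 \<le> (2 * r)\<^sup>2" by (rule power_mono) simp
    then have "real ((card (e i \<union> e j))\<^sup>2) \<le> 4 * r\<^sup>2"
      by (simp add: power_mult_distrib flip: of_nat_power of_nat_le_iff[where ?'a = real])
    then have "real ((card (e i \<union> e j))\<^sup>2) * \<delta> \<le> 4 * r\<^sup>2 * \<delta>"
      using codegree_nonneg by (rule mult_right_mono)
    moreover have "\<theta> * (real ((card (e i \<union> e j))\<^sup>2) * \<delta>) \<le> real ((card (e i \<union> e j))\<^sup>2) * \<delta>"
      using \<theta> codegree_nonneg by (intro mult_left_le_one_le) auto
    ultimately have "\<theta> * (real ((card (e i \<union> e j))\<^sup>2) * \<delta>) \<le> 4 * r\<^sup>2 * \<delta>"
      by linarith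
    moreover have "?P \<le> exp (- (\<theta> * card (e i \<union> e j)) + \<theta> * ((card (e i \<union> e j))\<^sup>2 * \<delta>))"
      using sub \<theta> by (intro avoid_probability_le)
    ultimately have "?P \<le> exp (- (\<theta> * card (e i \<union> e j)) + 4 * r\<^sup>2 * \<delta>)"
      by (smt (verit) exp_le_cancel_iff)
    then have "residual_weight \<theta> i * residual_weight \<theta> j * ?P \<le>
       residual_weight \<theta> i * residual_weight \<theta> j * exp (- (\<theta> * card (e i \<union> e j)) + 4 * r\<^sup>2 * \<delta>)"
      using rw0 by (intro mult_left_mono)
    also have "\<dots> = w i * w j * exp (\<theta> * (card (e i) - 1) + \<theta> * (card (e j) - 1) - \<theta> *
        card (e i \<union> e j) + 4 * r\<^sup>2 * \<delta>)"
      by (simp add: residual_weight_def exp_add exp_diff exp_minus field_simps)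
    also have "real (card (e i \<union> e j)) = real (card (e i)) + real (card (e j)) - 1"
      using card by linarith
    also have "\<theta> * real (card (e i) - 1) + \<theta> * real (card (e j) - 1) - \<theta> * (real (card (e i)) +
        real (card (e j)) - 1) + 4 * r\<^sup>2 * \<delta> =
       - \<theta> + 4 * r\<^sup>2 * \<delta>"
      using card_edge_ge_one ij by (simp add: of_nat_diff algebra_simps)
    finally show ?thesis using True by (simp flip: exp_add)
  next
    case False
    have "?P \<le> 1"
      using weight_nonneg \<theta> hit_subset
      by (auto simp: avoid_probability intro!: sum_nonneg mult_nonneg_nonneg)
    then have "residual_weight \<theta> i * residual_weight \<theta> j * ?P \<le> residual_weight \<theta> i *
        residual_weight \<theta> j"
      using rw0 by (simp add: mult_left_le)
    also have "\<dots> \<le> (w i * exp r) * (w j * exp r)"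
      using ij \<theta> residual_weight_le residual_weight_nonneg weight_nonneg by (intro mult_mono) auto
    also have "\<dots> = w i * w j * exp (2 * r)" by (simp flip: exp_add)
    also have "\<dots> \<le> w i * w j * exp (2 * r) + w i * w j * (exp (- \<theta>) * exp (4 * r\<^sup>2 * \<delta>))"
      using ww by simp
    finally show ?thesis using False by simp
  qed
qed

end

context regular_hypergraph
begin

text \<open>The first term pays for the codegree error of pairs of edges that share only the given
  vertex, the second one for the crude bound on all other pairs.\<close>

definition defect_constant :: real where
  "defect_constant = 8 * real r ^ 2 + r * exp (2 * r)"

lemma defect_constant_nonneg: "defect_constant \<ge> 0"
  by (simp add: defect_constant_def)

text \<open>The polynomial is \<open>(residual_degree \<theta> x R - 1)\<^sup>2\<close> if
  \<open>x\<close> survives and 0 otherwise, because a touched vertex has residual degree 0. So this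
  is the second moment about 1 of the residual degree, restricted to survival of \<open>x\<close>.
  Second moment, mean and survival probability enter with coefficients 1, -2 and 1 and have the
  common main term \<open>exp (- \<theta>)\<close>, so that only codegree errors remain.\<close>

lemma residual_degree_variance:
  fixes \<theta> :: real
  assumes x: "x \<in> X" and \<theta>: "0 \<le> \<theta>" "\<theta> \<le> 1" and small: "4 * r\<^sup>2 * \<delta> \<le> 1"
  shows "subset_expectation (\<lambda>j. 1 - exp (- (\<theta> * w j))) J
     (\<lambda>R. (residual_degree \<theta> x R)\<^sup>2 - 2 * residual_degree \<theta> x R + of_bool (R \<inter> hit {x} = {}))
     \<le> defect_constant * \<delta>"
proof -
  let ?E = "subset_expectation (\<lambda>j. 1 - exp (- (\<theta> * w j))) J"
  let ?J = "{j. j \<in> J \<and> x \<in> e j}" and ?w = "residual_weight \<theta>"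
  have deg: "(\<Sum>j\<in>?J. w j) = 1" using degree[OF x] .
  have hit_Un: "hit (A \<union> B) = hit A \<union> hit B" for A B by (auto simp: hit_def)
  have sq: "(\<lambda>R. (residual_degree \<theta> x R)\<^sup>2) =
      (\<lambda>R. \<Sum>i\<in>?J. \<Sum>j\<in>?J. ?w i * ?w j * of_bool (R \<inter> hit (e i \<union> e j) = {}))"
    unfolding residual_degree_def power2_eq_square sum_product
    by (auto simp: fun_eq_iff hit_Un Int_Un_distrib intro!: sum.cong)
  have "?E (\<lambda>R. (residual_degree \<theta> x R)\<^sup>2) =
      (\<Sum>i\<in>?J. \<Sum>j\<in>?J. ?w i * ?w j * ?E (\<lambda>R. of_bool (R \<inter> hit (e i \<union> e j) = {})))"
    unfolding sq subset_expectation_sum subset_expectation_cmult ..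
  also have "\<dots> \<le> (\<Sum>i\<in>?J. \<Sum>j\<in>?J. w i * w j * (exp (- \<theta>) * exp (4 * r\<^sup>2 * \<delta>)) +
      w i * w j * (exp (2 * r) * of_bool (e j \<inter> (e i - {x}) \<noteq> {})))"
    using x \<theta> by (intro sum_mono pair_survival) auto
  also have "\<dots> = (\<Sum>i\<in>?J. \<Sum>j\<in>?J. w i * w j) * (exp (- \<theta>) * exp (4 * r\<^sup>2 * \<delta>)) +
      exp (2 * r) * (\<Sum>i\<in>?J. w i * (\<Sum>j\<in>?J. w j * of_bool (e j \<inter> (e i - {x}) \<noteq> {})))"
    by (simp add: sum.distrib sum_distrib_left sum_distrib_right mult_ac)
  also have "(\<Sum>i\<in>?J. \<Sum>j\<in>?J. w i * w j) = 1"
    using deg by (simp flip: sum_product)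
  also have "(\<Sum>i\<in>?J. w i * (\<Sum>j\<in>?J. w j * of_bool (e j \<inter> (e i - {x}) \<noteq> {}))) \<le>
      (\<Sum>i\<in>?J. w i * (r * \<delta>))"
  proof (intro sum_mono mult_left_mono)
    fix i assume i: "i \<in> ?J"
    have "(\<Sum>j\<in>?J. w j * of_bool (e j \<inter> (e i - {x}) \<noteq> {})) =
        (\<Sum>j | j \<in> J \<and> x \<in> e j \<and> e j \<inter> (e i - {x}) \<noteq> {}. w j)"
      using finite_indices by (intro sum.mono_neutral_cong_right) auto
    also have "\<dots> \<le> card (e i - {x}) * \<delta>"
      using i edge_subset x by (intro codegree_sum) auto
    also have "\<dots> \<le> r * \<delta>"
      using i edge_card[of i] finite_edge[of i] codegree_nonneg
      by (intro mult_right_mono) auto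
    finally show "(\<Sum>j\<in>?J. w j * of_bool (e j \<inter> (e i - {x}) \<noteq> {})) \<le> r * \<delta>" .
  qed (use weight_nonneg in auto)
  also have "(\<Sum>i\<in>?J. w i * (r * \<delta>)) = r * \<delta>"
    using deg by (simp flip: sum_distrib_right)
  finally have second: "?E (\<lambda>R. (residual_degree \<theta> x R)\<^sup>2) \<le>
      exp (- \<theta>) * exp (4 * r\<^sup>2 * \<delta>) + exp (2 * r) * (r * \<delta>)"
    by simp
  have "exp (- \<theta>) = (\<Sum>j\<in>?J. w j * exp (- \<theta>))"
    using deg by (simp flip: sum_distrib_right)
  also have "\<dots> \<le> (\<Sum>j\<in>?J. ?w j * ?E (\<lambda>R. of_bool (R \<inter> hit (e j) = {})))"
    using \<theta> by (intro sum_mono survival_weight) auto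
  also have "\<dots> = ?E (residual_degree \<theta> x)"
    unfolding residual_degree_def subset_expectation_sum subset_expectation_cmult ..
  finally have first: "?E (residual_degree \<theta> x) \<ge> exp (- \<theta>)" .
  have "exp (4 * r\<^sup>2 * \<delta>) \<le> 1 + 2 * (4 * r\<^sup>2 * \<delta>)"
    using small codegree_nonneg by (intro exp_le_one_plus_double) auto
  then have "exp (- \<theta>) * exp (4 * r\<^sup>2 * \<delta>) \<le> exp (- \<theta>) * (1 + 8 * r\<^sup>2 * \<delta>)"
    by (intro mult_left_mono) auto
  also have "\<dots> \<le> exp (- \<theta>) + 8 * r\<^sup>2 * \<delta>"
    using \<theta> codegree_nonneg by (simp add: distrib_left mult_left_le_one_le)
  finally have "exp (- \<theta>) * exp (4 * r\<^sup>2 * \<delta>) \<le> exp (- \<theta>) + 8 * r\<^sup>2 * \<delta>" .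
  then show ?thesis
    using first second avoid_vertex_probability[OF x, of \<theta>]
    by (simp add: subset_expectation_add subset_expectation_diff subset_expectation_cmult
        defect_constant_def algebra_simps)
qed

text \<open>One bite of the nibble. In terms of the random set \<open>R\<close>, the first sum is the gain
  collected by the isolated selected edges, the second one the gain still available to the
  surviving edges that avoid vertices whose residual degree became too large.\<close>

lemma nibble_step:
  fixes \<theta> \<kappa> \<beta> :: real and g :: "'j \<Rightarrow> real"
  assumes \<theta>: "0 \<le> \<theta>" "\<theta> \<le> 1" and small: "4 * r\<^sup>2 * \<delta> \<le> 1"
    and g: "\<And>j. j \<in> J \<Longrightarrow> 0 \<le> g j \<and> g j \<le> 1" and \<kappa>: "\<kappa> > 0" and \<beta>: "\<beta> \<ge> 0"
  obtains R where "R \<subseteq> J"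
    "(\<Sum>j | j \<in> R \<and> R \<inter> (hit (e j) - {j}) = {}. g j) +
     (\<Sum>j | j \<in> J \<and> R \<inter> hit (e j) = {} \<and> (\<forall>x\<in>e j. residual_degree \<theta> x R \<le> 1 +
         \<kappa>). residual_weight \<theta> j * g j) / (1 + \<kappa>)
      - \<beta> * card {x \<in> X. R \<inter> hit {x} = {}}
     \<ge> (\<Sum>j\<in>J. w j * g j) - ((r + 1) * \<theta>\<^sup>2 + \<kappa> + exp r * defect_constant * \<delta> / \<kappa>\<^sup>2 + \<beta> * (1 - \<theta> /
         2)) * card X"
proof -
  let ?E = "subset_expectation (\<lambda>j. 1 - exp (- (\<theta> * w j))) J"
  let ?w = "residual_weight \<theta>"
  define var where "var = (\<lambda>x R. (residual_degree \<theta> x R)\<^sup>2 - 2 * residual_degree \<theta> x R +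
    of_bool (R \<inter> hit {x} = {}))"
  let ?W = "\<Sum>j\<in>J. w j * g j"
  \<comment> \<open>\<open>L\<close> bounds the claimed quantity from below and consists of terms
    whose expectations have been estimated. Edges at overloaded vertices are not treated one by one:
    such a vertex has \<open>var x R \<ge> \<kappa>\<^sup>2\<close> and carries residual gain at
    most \<open>exp r\<close>, so, as in Chebyshev's inequality, it is charged
    \<open>exp r / \<kappa>\<^sup>2 * var x R\<close>.\<close>
  define L where "L R = (\<Sum>j\<in>J. g j * of_bool (j \<in> R \<and> R \<inter> (hit (e j) - {j}) = {})) +
     (1 / (1 + \<kappa>)) * ((\<Sum>j\<in>J. (?w j * g j) * of_bool (R \<inter> hit (e j) = {})) -
        (\<Sum>x\<in>X. (exp r / \<kappa>\<^sup>2) * var x R)) -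
     \<beta> * (\<Sum>x\<in>X. of_bool (R \<inter> hit {x} = {}))" for R
  have finJ: "finite J" and finX: "finite X" using finite_indices finite_vertices by auto
  have W0: "0 \<le> ?W" using g weight_nonneg by (intro sum_nonneg mult_nonneg_nonneg) auto
  have WX: "?W \<le> card X"
  proof -
    have "hit X = J" using edge_nonempty edge_subset by (auto simp: hit_def)
    moreover have "?W \<le> (\<Sum>j\<in>J. w j)"
      using g weight_nonneg by (intro sum_mono) (simp add: mult_left_le)
    ultimately have "?W \<le> (\<Sum>j\<in>hit X. w j)" by simp
    then show ?thesis using hit_weight_upper[of X] by simp
  qed
  have "?E L = (\<Sum>j\<in>J. g j * ?E (\<lambda>R. of_bool (j \<in> R \<and> R \<inter> (hit (e j) - {j}) = {}))) +
     (1 / (1 + \<kappa>)) * ((\<Sum>j\<in>J. (?w j * g j) * ?E (\<lambda>R. of_bool (R \<inter> hit (e j) = {}))) -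
        (\<Sum>x\<in>X. (exp r / \<kappa>\<^sup>2) * ?E (var x))) -
     \<beta> * (\<Sum>x\<in>X. ?E (\<lambda>R. of_bool (R \<inter> hit {x} = {})))"
    unfolding L_def
    by (simp only: subset_expectation_sum subset_expectation_cmult subset_expectation_add
        subset_expectation_diff)
  moreover have "(\<Sum>j\<in>J. g j * ?E (\<lambda>R. of_bool (j \<in> R \<and> R \<inter> (hit (e j) - {j}) = {}))) \<ge>
      (\<theta> * (1 - (r + 1) * \<theta>)) * ?W"
    unfolding sum_distrib_left
  proof (rule sum_mono)
    fix j assume j: "j \<in> J"
    have "g j * (\<theta> * w j * (1 - (r + 1) * \<theta>)) \<le>
       g j * ?E (\<lambda>R. of_bool (j \<in> R \<and> R \<inter> (hit (e j) - {j}) = {}))"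
      using j g \<theta> by (intro mult_left_mono isolated_probability) auto
    then show "(\<theta> * (1 - (r + 1) * \<theta>)) * (w j * g j) \<le>
       g j * ?E (\<lambda>R. of_bool (j \<in> R \<and> R \<inter> (hit (e j) - {j}) = {}))"
      by (simp add: mult_ac)
  qed
  moreover have "(1 / (1 + \<kappa>)) * ((\<Sum>j\<in>J. (?w j * g j) * ?E (\<lambda>R. of_bool (R \<inter> hit (e j) = {}))) -
        (\<Sum>x\<in>X. (exp r / \<kappa>\<^sup>2) * ?E (var x))) \<ge> (1 - \<theta>) * ?W - \<kappa> * ?W - exp r * defect_constant * \<delta> /
            \<kappa>\<^sup>2 * card X"
  proof -
    have "(\<Sum>j\<in>J. (?w j * g j) * ?E (\<lambda>R. of_bool (R \<inter> hit (e j) = {}))) \<ge> (1 - \<theta>) * ?W"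
      unfolding sum_distrib_left
    proof (rule sum_mono)
      fix j assume j: "j \<in> J"
      have "(1 - \<theta>) * (w j * g j) \<le> exp (- \<theta>) * (w j * g j)"
        using j g weight_nonneg exp_ge_add_one_self[of "- \<theta>"] by (intro mult_right_mono) auto
      also have "\<dots> \<le> g j * (?w j * ?E (\<lambda>R. of_bool (R \<inter> hit (e j) = {})))"
        using mult_left_mono[OF survival_weight[OF j \<theta>(1)], of "g j"] g[OF j] by (simp add: mult_ac)
      finally show "(1 - \<theta>) * (w j * g j) \<le> (?w j * g j) * ?E (\<lambda>R. of_bool (R \<inter> hit (e j) = {}))"
        by (simp add: mult_ac)
    qed
    moreover have "(\<Sum>x\<in>X. (exp r / \<kappa>\<^sup>2) * ?E (var x)) \<le> (\<Sum>x\<in>X. (exp r / \<kappa>\<^sup>2) * (defect_constant *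
        \<delta>))"
      unfolding var_def using \<theta> small
      by (intro sum_mono mult_left_mono residual_degree_variance) auto
    moreover have "(1 / (1 + \<kappa>)) * ((1 - \<theta>) * ?W - exp r * defect_constant * \<delta> / \<kappa>\<^sup>2 * card X) \<ge>
       (1 - \<theta>) * ?W - \<kappa> * ?W - exp r * defect_constant * \<delta> / \<kappa>\<^sup>2 * card X"
    proof -
      let ?A = "(1 - \<theta>) * ?W" and ?B = "exp r * defect_constant * \<delta> / \<kappa>\<^sup>2 * card X"
      have A: "0 \<le> ?A" "?A \<le> ?W" using \<theta> W0 by (auto simp: mult_left_le_one_le)
      have B: "0 \<le> ?B" using codegree_nonneg defect_constant_nonneg by simp
      have "(1 + \<kappa>) * (?A - \<kappa> * ?W - ?B) = ?A - ?B - \<kappa> * (?W - ?A) - \<kappa> * \<kappa> * ?W - \<kappa> * ?B"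
        by (simp add: algebra_simps add_divide_distrib)
      also have "\<dots> \<le> ?A - ?B"
      proof -
        have "0 \<le> \<kappa> * (?W - ?A)" "0 \<le> \<kappa> * \<kappa> * ?W"
          using A W0 \<kappa> by (intro mult_nonneg_nonneg; simp)+
        moreover have "0 \<le> \<kappa> * ?B"
          using mult_nonneg_nonneg[OF less_imp_le[OF \<kappa>] B] .
        ultimately show ?thesis by linarith
      qed
      finally have le: "(1 + \<kappa>) * (?A - \<kappa> * ?W - ?B) \<le> ?A - ?B" .
      have "C \<le> (1 / (1 + \<kappa>)) * D" if "(1 + \<kappa>) * C \<le> D" for C D :: real
        using that \<kappa> by (simp add: pos_le_divide_eq mult.commute)
      from this[OF le] show ?thesis .
    qed
    moreover have "(1 / (1 + \<kappa>)) * ((1 - \<theta>) * ?W - exp r * defect_constant * \<delta> / \<kappa>\<^sup>2 * card X) \<le>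
       (1 / (1 + \<kappa>)) * ((\<Sum>j\<in>J. (?w j * g j) * ?E (\<lambda>R. of_bool (R \<inter> hit (e j) = {}))) -
        (\<Sum>x\<in>X. (exp r / \<kappa>\<^sup>2) * ?E (var x)))"
      using calculation(1,2) \<kappa> by (intro mult_left_mono) (auto simp: mult_ac)
    ultimately show ?thesis by linarith
  qed
  moreover have "\<beta> * (\<Sum>x\<in>X. ?E (\<lambda>R. of_bool (R \<inter> hit {x} = {}))) \<le> \<beta> * (1 - \<theta> / 2) * card X"
  proof -
    have "exp (- \<theta>) \<le> 1 - \<theta> / 2"
    proof -
      have "exp (- \<theta>) * (1 + \<theta>) \<le> 1"
        using mult_left_mono[OF exp_ge_add_one_self[of \<theta>], of "exp (- \<theta>)"] by (simp flip: exp_add)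
      also have "1 \<le> (1 - \<theta> / 2) * (1 + \<theta>)"
        using \<theta> mult_left_le_one_le[of \<theta> \<theta>] by (simp add: algebra_simps)
      finally show ?thesis using \<theta> by (simp add: mult_le_cancel_right)
    qed
    then have "(\<Sum>x\<in>X. ?E (\<lambda>R. of_bool (R \<inter> hit {x} = {}))) \<le> (\<Sum>x\<in>X. 1 - \<theta> / 2)"
      by (intro sum_mono) (simp add: avoid_vertex_probability)
    then show ?thesis using \<beta> by (simp add: mult_left_mono mult_ac)
  qed
  \<comment> \<open>The gain \<open>\<theta> * ?W\<close> collected now and the gain
    \<open>(1 - \<theta>) * ?W\<close> left for later add up to all of \<open>?W\<close>. Only the
    second-order term and \<open>\<kappa>\<close> are lost, and both are charged to
    \<open>card X\<close>.\<close>
  moreover have "(\<theta> * (1 - (r + 1) * \<theta>)) * ?W + ((1 - \<theta>) * ?W - \<kappa> * ?W) \<ge> ?W - ((r + 1) * \<theta>\<^sup>2 +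
      \<kappa>) * card X"
  proof -
    have "((r + 1) * \<theta>\<^sup>2 + \<kappa>) * ?W \<le> ((r + 1) * \<theta>\<^sup>2 + \<kappa>) * card X"
      using WX \<kappa> by (intro mult_left_mono) auto
    then show ?thesis by (simp add: algebra_simps power2_eq_square)
  qed
  ultimately have EL: "?E L \<ge> ?W - ((r + 1) * \<theta>\<^sup>2 + \<kappa> + exp r * defect_constant * \<delta> / \<kappa>\<^sup>2 + \<beta> *
      (1 - \<theta> / 2)) * card X"
    by (simp only: distrib_right)
  have "\<exists>R\<subseteq>J. L R \<ge> ?E L"
    using finJ weight_nonneg \<theta> by (intro subset_expectation_le_ex) auto
  then obtain R where R: "R \<subseteq> J" "L R \<ge> ?E L" by blast
  let ?bad = "\<lambda>x. residual_degree \<theta> x R > 1 + \<kappa>"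
  have "(\<Sum>j\<in>J. g j * of_bool (j \<in> R \<and> R \<inter> (hit (e j) - {j}) = {})) =
      (\<Sum>j | j \<in> R \<and> R \<inter> (hit (e j) - {j}) = {}. g j)"
    using finJ R(1) by (intro sum.mono_neutral_cong_right) auto
  moreover have "(\<Sum>x\<in>X. of_bool (R \<inter> hit {x} = {})) = real (card {x \<in> X. R \<inter> hit {x} = {}})"
    using finX by (simp add: of_bool_def sum.If_cases Int_def)
  moreover have "(\<Sum>j\<in>J. (?w j * g j) * of_bool (R \<inter> hit (e j) = {})) - (\<Sum>x\<in>X. (exp r / \<kappa>\<^sup>2) *
      var x R) \<le>
     (\<Sum>j | j \<in> J \<and> R \<inter> hit (e j) = {} \<and> (\<forall>x\<in>e j. residual_degree \<theta> x R \<le> 1 + \<kappa>). ?w j * g j)"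
  proof -
    let ?S = "{j. j \<in> J \<and> R \<inter> hit (e j) = {}}"
    let ?G = "{j. j \<in> J \<and> R \<inter> hit (e j) = {} \<and> (\<forall>x\<in>e j. residual_degree \<theta> x R \<le> 1 + \<kappa>)}"
    let ?B = "{x \<in> X. ?bad x}"
    have dead: "residual_degree \<theta> x R = 0" if "R \<inter> hit {x} \<noteq> {}" for x
      unfolding residual_degree_def using that by (intro sum.neutral) (auto simp: hit_def)
    have var0: "var x R \<ge> 0" for x
    proof (cases "R \<inter> hit {x} = {}")
      case True
      then have "var x R = (residual_degree \<theta> x R - 1)\<^sup>2"
        by (simp add: var_def power2_eq_square algebra_simps)
      then show ?thesis by simp
    next
      case False
      then show ?thesis using dead by (simp add: var_def)
    qed
    have var_bad: "var x R \<ge> \<kappa>\<^sup>2" if "?bad x" for x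
    proof -
      have "R \<inter> hit {x} = {}" using that dead \<kappa> by fastforce
      then have "var x R = (residual_degree \<theta> x R - 1)\<^sup>2"
        by (simp add: var_def power2_eq_square algebra_simps)
      moreover have "\<kappa>\<^sup>2 \<le> (residual_degree \<theta> x R - 1)\<^sup>2" using that \<kappa> by (intro power_mono) auto
      ultimately show ?thesis by simp
    qed
    have "(\<Sum>j\<in>J. (?w j * g j) * of_bool (R \<inter> hit (e j) = {})) = (\<Sum>j\<in>?S. ?w j * g j)"
      using finJ by (intro sum.mono_neutral_cong_right) auto
    also have "\<dots> = (\<Sum>j\<in>?G. ?w j * g j) + (\<Sum>j\<in>?S - ?G. ?w j * g j)"
      using finJ by (subst add.commute, intro sum.subset_diff) auto
    finally have split: "(\<Sum>j\<in>J. (?w j * g j) * of_bool (R \<inter> hit (e j) = {})) =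
      (\<Sum>j\<in>?G. ?w j * g j) + (\<Sum>j\<in>?S - ?G. ?w j * g j)" .
    have "(\<Sum>j\<in>?S - ?G. ?w j * g j) \<le> (\<Sum>j\<in>(\<Union>x\<in>?B. {j. j \<in> J \<and> x \<in> e j}). ?w j * g j)"
    proof (rule sum_mono2)
      show "finite (\<Union>x\<in>?B. {j. j \<in> J \<and> x \<in> e j})" using finJ finX by simp
      show "?S - ?G \<subseteq> (\<Union>x\<in>?B. {j. j \<in> J \<and> x \<in> e j})"
      proof
        fix j assume "j \<in> ?S - ?G"
        then obtain x where "j \<in> J" "x \<in> e j" "\<not> residual_degree \<theta> x R \<le> 1 + \<kappa>" by blast
        moreover from this have "x \<in> X" using edge_subset by blast
        ultimately show "j \<in> (\<Union>x\<in>?B. {j. j \<in> J \<and> x \<in> e j})"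
          by (auto simp: not_le intro!: exI[of _ x])
      qed
    qed (use g residual_weight_nonneg in auto)
    also have "\<dots> \<le> (\<Sum>x\<in>?B. \<Sum>j | j \<in> J \<and> x \<in> e j. ?w j * g j)"
    proof (rule sum_UN_le)
      show "0 \<le> ?w j * g j" if "j \<in> {j. j \<in> J \<and> x \<in> e j}" for j x
        using that g residual_weight_nonneg by simp
    qed (use finX finJ in auto)
    also have "\<dots> \<le> (\<Sum>x\<in>?B. exp r)"
    proof (rule sum_mono)
      fix x assume x: "x \<in> ?B"
      have "(\<Sum>j | j \<in> J \<and> x \<in> e j. ?w j * g j) \<le> (\<Sum>j | j \<in> J \<and> x \<in> e j. w j * exp r)"
      proof (rule sum_mono)
        fix j assume "j \<in> {j. j \<in> J \<and> x \<in> e j}"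
        then have j: "j \<in> J" by simp
        have "?w j * g j \<le> ?w j" using j g residual_weight_nonneg by (simp add: mult_left_le)
        also have "\<dots> \<le> w j * exp r" using j \<theta> by (rule residual_weight_le)
        finally show "?w j * g j \<le> w j * exp r" .
      qed
      also have "\<dots> = exp r" using degree[of x] x by (simp flip: sum_distrib_right)
      finally show "(\<Sum>j | j \<in> J \<and> x \<in> e j. ?w j * g j) \<le> exp r" .
    qed
    also have "\<dots> \<le> (\<Sum>x\<in>?B. (exp r / \<kappa>\<^sup>2) * var x R)"
    proof (rule sum_mono)
      fix x assume "x \<in> ?B"
      then have "(exp r / \<kappa>\<^sup>2) * \<kappa>\<^sup>2 \<le> (exp r / \<kappa>\<^sup>2) * var x R"
        by (intro mult_left_mono var_bad) auto
      then show "exp r \<le> (exp r / \<kappa>\<^sup>2) * var x R" using \<kappa> by simp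
    qed
    also have "\<dots> \<le> (\<Sum>x\<in>X. (exp r / \<kappa>\<^sup>2) * var x R)"
      using finX var0 by (intro sum_mono2 mult_nonneg_nonneg) auto
    finally show ?thesis unfolding split by linarith
  qed
  ultimately have "L R \<le> (\<Sum>j | j \<in> R \<and> R \<inter> (hit (e j) - {j}) = {}. g j) +
     (\<Sum>j | j \<in> J \<and> R \<inter> hit (e j) = {} \<and> (\<forall>x\<in>e j. residual_degree \<theta> x R \<le> 1 + \<kappa>). ?w j * g j) / (1 +
         \<kappa>)
      - \<beta> * card {x \<in> X. R \<inter> hit {x} = {}}"
    unfolding L_def using \<kappa> by (simp add: divide_right_mono)
  with R EL that show ?thesis by force
qed

end

section \<open>Iterating the bite\<close>

locale hypergraph_fractional_matching =
  fixes X :: "'x set" and I :: "'i set" and e :: "'i \<Rightarrow> 'x set" and w :: "'i \<Rightarrow> real"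
    and r :: nat and \<delta> :: real
  assumes finite_vertices: "finite X" and finite_indices: "finite I"
    and edge_subset: "i \<in> I \<Longrightarrow> e i \<subseteq> X"
    and edge_nonempty: "i \<in> I \<Longrightarrow> e i \<noteq> {}"
    and edge_card: "i \<in> I \<Longrightarrow> card (e i) \<le> r"
    and weight_nonneg: "i \<in> I \<Longrightarrow> w i \<ge> 0"
    and degree: "x \<in> X \<Longrightarrow> (\<Sum>i | i \<in> I \<and> x \<in> e i. w i) \<le> 1"
    and codegree: "x \<in> X \<Longrightarrow> y \<in> X \<Longrightarrow> x \<noteq> y \<Longrightarrow> (\<Sum>i | i \<in> I \<and> x \<in> e i \<and> y \<in> e i. w i) \<le> \<delta>"

text \<open>Hiding \<open>\<delta>\<close> behind an existential quantifier spares the bookkeeping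
  over rounds: a bite only needs some threshold that works for what it leaves over. Bounding the
  gains by 1 fixes the unit in which the loss \<open>\<beta>\<close> per vertex is measured. The
  \<open>itself\<close> arguments record the types over which the hypergraphs range.\<close>

definition matching_defect :: "'x itself \<Rightarrow> 'i itself \<Rightarrow> nat \<Rightarrow> real \<Rightarrow> bool" where
  "matching_defect _ _ r \<beta> \<longleftrightarrow> (\<exists>\<delta>>0. \<forall>(X :: 'x set) (I :: 'i set) e w (g :: 'i \<Rightarrow> real).
     hypergraph_fractional_matching X I e w r \<delta> \<longrightarrow> (\<forall>i\<in>I. 0 \<le> g i \<and> g i \<le> 1) \<longrightarrow>
     (\<exists>M\<subseteq>I. disjoint_family_on e M \<and> (\<Sum>i\<in>M. g i) \<ge> (\<Sum>i\<in>I. w i * g i) - \<beta> * card X))"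

text \<open>Degrees are padded to 1 by singleton edges without gain, so that every vertex survives
  a bite of the nibble with the same probability.\<close>

lemma regular_hypergraph_pad:
  assumes "hypergraph_fractional_matching X I e w r \<delta>" "r \<ge> 1" "\<delta> \<ge> 0"
  shows "regular_hypergraph X (I <+> X) (case_sum e (\<lambda>x. {x}))
     (case_sum w (\<lambda>x. 1 - (\<Sum>i | i \<in> I \<and> x \<in> e i. w i))) r \<delta>"
proof -
  interpret hypergraph_fractional_matching X I e w r \<delta> by fact
  let ?e = "case_sum e (\<lambda>x. {x})" and ?w = "case_sum w (\<lambda>x. 1 - (\<Sum>i | i \<in> I \<and> x \<in> e i. w i))"
  show ?thesis
  proof
    fix x assume x: "x \<in> X"
    have "j \<in> I <+> X \<and> x \<in> ?e j \<longleftrightarrow> j \<in> insert (Inr x) (Inl ` {i. i \<in> I \<and> x \<in> e i})" for j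
      using x by (cases j) auto
    then have "{j. j \<in> I <+> X \<and> x \<in> ?e j} = insert (Inr x) (Inl ` {i. i \<in> I \<and> x \<in> e i})"
      by blast
    then have "(\<Sum>j | j \<in> I <+> X \<and> x \<in> ?e j. ?w j) =
        ?w (Inr x) + (\<Sum>j\<in>Inl ` {i. i \<in> I \<and> x \<in> e i}. ?w j)"
      using finite_indices by (simp only:) (subst sum.insert, auto)
    then show "(\<Sum>j | j \<in> I <+> X \<and> x \<in> ?e j. ?w j) = 1"
      by (simp add: sum.reindex)
  next
    fix x y assume xy: "x \<in> X" "y \<in> X" "x \<noteq> y"
    have "j \<in> I <+> X \<and> x \<in> ?e j \<and> y \<in> ?e j \<longleftrightarrow> j \<in> Inl ` {i. i \<in> I \<and> x \<in> e i \<and> y \<in> e i}" for j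
      using xy by (cases j) auto
    then have "{j. j \<in> I <+> X \<and> x \<in> ?e j \<and> y \<in> ?e j} = Inl ` {i. i \<in> I \<and> x \<in> e i \<and> y \<in> e i}"
      by blast
    then show "(\<Sum>j | j \<in> I <+> X \<and> x \<in> ?e j \<and> y \<in> ?e j. ?w j) \<le> \<delta>"
      using codegree[OF xy] by (simp add: sum.reindex)
  qed (use assms(2,3) finite_vertices finite_indices subsetD[OF edge_subset] edge_nonempty edge_card
      weight_nonneg degree in \<open>auto simp: Plus_def\<close>)
qed

text \<open>After one bite the assumed guarantee is applied to the surviving hypergraph. The bite
  wastes gain of second order in \<open>\<theta>\<close> per vertex, but the loss
  \<open>\<beta>\<close> is then charged only to the surviving vertices, an expected fraction of at
  most \<open>1 - \<theta> / 2\<close>. With \<open>\<theta>\<close> a small multiple of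
  \<open>\<beta>\<close> the saving prevails.\<close>

lemma matching_defect_decrease:
  assumes P: "matching_defect TYPE('x) TYPE('i) r \<beta>" and r: "r \<ge> 1" and \<beta>: "0 < \<beta>" "\<beta> \<le> 1"
  shows "matching_defect TYPE('x) TYPE('i) r (\<beta> - \<beta>\<^sup>2 / (32 * (r + 1)))"
proof -
  obtain \<delta>0 where \<delta>0: "\<delta>0 > 0" and step: "\<forall>(X :: 'x set) (I :: 'i set) e w g.
     hypergraph_fractional_matching X I e w r \<delta>0 \<longrightarrow> (\<forall>i\<in>I. 0 \<le> g i \<and> g i \<le> 1) \<longrightarrow>
     (\<exists>M\<subseteq>I. disjoint_family_on e M \<and> (\<Sum>i\<in>M. g i) \<ge> (\<Sum>i\<in>I. w i * g i) - \<beta> * card X)"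
    using P unfolding matching_defect_def by (elim exE conjE)
  \<comment> \<open>The saving is \<open>\<beta> * \<theta> / 2\<close> per vertex. These choices
    spend at most half of it: \<open>\<beta> * \<theta> / 8\<close> on
    \<open>(r + 1) * \<theta>\<^sup>2\<close>, and \<open>\<beta> * \<theta> / 16\<close> each on
    \<open>\<kappa>\<close> and on the variance term \<open>K * \<delta>\<close>.\<close>
  define \<theta> where "\<theta> = \<beta> / (8 * (r + 1))"
  define \<kappa> where "\<kappa> = \<beta> * \<theta> / 16"
  define K where "K = exp r * (8 * real r ^ 2 + r * exp (2 * r)) / \<kappa>\<^sup>2"
  have \<theta>: "0 < \<theta>" "\<theta> \<le> 1" using \<beta> by (auto simp: \<theta>_def field_simps)
  have \<kappa>: "\<kappa> > 0" using \<theta> \<beta> by (simp add: \<kappa>_def)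
  have K: "K \<ge> 0" by (simp add: K_def)
  \<comment> \<open>The three bounds serve the codegrees after the bite, which may grow by a factor
    \<open>exp r\<close>, the smallness condition \<open>4 * r\<^sup>2 * \<delta> \<le> 1\<close> of
    the bite, and the variance term.\<close>
  define \<delta> where "\<delta> = Min {\<delta>0 / exp r, 1 / (4 * r\<^sup>2), \<beta> * \<theta> / (16 * (K + 1))}"
  have \<delta>: "\<delta> > 0" using \<delta>0 r \<beta> \<theta> K by (simp add: \<delta>_def)
  have "\<delta> \<le> \<delta>0 / exp r" "\<delta> \<le> 1 / (4 * r\<^sup>2)" "\<delta> \<le> \<beta> * \<theta> / (16 * (K + 1))"
    by (auto simp: \<delta>_def)
  then have \<delta>_le: "\<delta> * exp r \<le> \<delta>0" "4 * r\<^sup>2 * \<delta> \<le> 1" "(K + 1) * \<delta> \<le> \<beta> * \<theta> / 16"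
    using r K by (auto simp: field_simps)
  have "(K + 1) * \<delta> = K * \<delta> + \<delta>" by (simp add: algebra_simps)
  then have K\<delta>: "K * \<delta> \<le> \<beta> * \<theta> / 16" using \<delta>_le(3) \<delta> by linarith
  have r\<theta>: "(r + 1) * \<theta> = \<beta> / 8" by (simp add: \<theta>_def field_simps)
  have "(r + 1) * \<theta>\<^sup>2 = ((r + 1) * \<theta>) * \<theta>" by (simp add: power2_eq_square)
  then have "(r + 1) * \<theta>\<^sup>2 = \<beta> * \<theta> / 8" unfolding r\<theta> by simp
  then have loss: "(r + 1) * \<theta>\<^sup>2 + \<kappa> + K * \<delta> + \<beta> * (1 - \<theta> / 2) \<le> \<beta> - \<beta> * \<theta> / 4"
    using K\<delta> by (simp add: \<kappa>_def algebra_simps)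
  have \<beta>': "\<beta> - \<beta> * \<theta> / 4 = \<beta> - \<beta>\<^sup>2 / (32 * (r + 1))"
    by (simp add: \<theta>_def power2_eq_square field_simps)
  show ?thesis unfolding matching_defect_def
  proof (intro exI[of _ \<delta>] conjI allI impI \<delta>)
    fix X :: "'x set" and I :: "'i set" and e :: "'i \<Rightarrow> 'x set" and w g :: "'i \<Rightarrow> real"
    assume H: "hypergraph_fractional_matching X I e w r \<delta>" and g: "\<forall>i\<in>I. 0 \<le> g i \<and> g i \<le> 1"
    interpret hypergraph_fractional_matching X I e w r \<delta> by fact
    let ?J = "I <+> X" and ?e = "case_sum e (\<lambda>x. {x})" and ?g = "case_sum g (\<lambda>x::'x. 0)"
      and ?w = "case_sum w (\<lambda>x. 1 - (\<Sum>i | i \<in> I \<and> x \<in> e i. w i))"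
    interpret reg: regular_hypergraph X ?J ?e ?w r \<delta>
      using H r \<delta> by (intro regular_hypergraph_pad) auto
    obtain R where R: "R \<subseteq> ?J" and Rge:
      "(\<Sum>j | j \<in> R \<and> R \<inter> (reg.hit (?e j) - {j}) = {}. ?g j) +
       (\<Sum>j | j \<in> ?J \<and> R \<inter> reg.hit (?e j) = {} \<and> (\<forall>x\<in>?e j. reg.residual_degree \<theta> x R \<le> 1 + \<kappa>).
          reg.residual_weight \<theta> j * ?g j) / (1 + \<kappa>)
        - \<beta> * card {x \<in> X. R \<inter> reg.hit {x} = {}}
       \<ge> (\<Sum>j\<in>?J. ?w j * ?g j) - ((r + 1) * \<theta>\<^sup>2 + \<kappa> + exp r * reg.defect_constant * \<delta> / \<kappa>\<^sup>2 + \<beta> *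
           (1 - \<theta> / 2)) * card X"
    proof (rule reg.nibble_step[of \<theta> ?g \<kappa> \<beta>])
      show "0 \<le> ?g j \<and> ?g j \<le> 1" if "j \<in> ?J" for j
        using that g by (cases j) auto
      show "0 \<le> \<theta>" "\<theta> \<le> 1" "\<kappa> > 0" "\<beta> \<ge> 0" using \<theta> \<kappa> \<beta> by simp_all
      show "4 * r\<^sup>2 * \<delta> \<le> 1" by (rule \<delta>_le)
    qed
    let ?good = "\<lambda>x. reg.residual_degree \<theta> x R \<le> 1 + \<kappa>"
    \<comment> \<open>\<open>M1\<close> is collected at once. The rest of the matching lives on the
      vertices \<open>Y\<close> that no selected edge touches and uses the surviving edges
      \<open>I'\<close> without overloaded vertices; dividing by \<open>1 + \<kappa>\<close> brings
      their degrees back to at most 1. Padding edges have gain 0 and are dropped from both.\<close>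
    define M1 where "M1 = {i. Inl i \<in> R \<and> R \<inter> (reg.hit (e i) - {Inl i}) = {}}"
    define Y where "Y = {x \<in> X. R \<inter> reg.hit {x} = {}}"
    define I' where "I' = {i \<in> I. R \<inter> reg.hit (e i) = {} \<and> (\<forall>x\<in>e i. ?good x)}"
    define w' where "w' = (\<lambda>i. reg.residual_weight \<theta> (Inl i) / (1 + \<kappa>))"
    have Inl_mem: "Inl i \<in> ?J \<longleftrightarrow> i \<in> I" for i by auto
    have M1I: "M1 \<subseteq> I" using R Inl_mem unfolding M1_def by blast
    have finI: "finite I" by (rule finite_indices)
    have s1: "(\<Sum>j | j \<in> R \<and> R \<inter> (reg.hit (?e j) - {j}) = {}. ?g j) = (\<Sum>i\<in>M1. g i)"
    proof -
      have "(\<Sum>i\<in>M1. g i) = (\<Sum>j\<in>Inl ` M1. ?g j)" by (simp add: sum.reindex)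
      also have "\<dots> = (\<Sum>j | j \<in> R \<and> R \<inter> (reg.hit (?e j) - {j}) = {}. ?g j)"
      proof (rule sum.mono_neutral_left)
        show "finite {j. j \<in> R \<and> R \<inter> (reg.hit (?e j) - {j}) = {}}"
          using finite_subset[OF R reg.finite_indices] by simp
        show "Inl ` M1 \<subseteq> {j. j \<in> R \<and> R \<inter> (reg.hit (?e j) - {j}) = {}}"
          by (auto simp: M1_def)
        show "\<forall>j\<in>{j. j \<in> R \<and> R \<inter> (reg.hit (?e j) - {j}) = {}} - Inl ` M1. ?g j = 0"
        proof
          fix j assume "j \<in> {j. j \<in> R \<and> R \<inter> (reg.hit (?e j) - {j}) = {}} - Inl ` M1"
          then show "?g j = 0" by (cases j) (auto simp: M1_def)
        qed
      qed
      finally show ?thesis by simp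
    qed
    have s2: "(\<Sum>j | j \<in> ?J \<and> R \<inter> reg.hit (?e j) = {} \<and> (\<forall>x\<in>?e j. ?good x).
          reg.residual_weight \<theta> j * ?g j) / (1 + \<kappa>) = (\<Sum>i\<in>I'. w' i * g i)"
    proof -
      have "(\<Sum>i\<in>I'. reg.residual_weight \<theta> (Inl i) * g i) = (\<Sum>j\<in>Inl ` I'. reg.residual_weight \<theta> j *
          ?g j)"
        by (simp add: sum.reindex)
      also have "\<dots> = (\<Sum>j | j \<in> ?J \<and> R \<inter> reg.hit (?e j) = {} \<and> (\<forall>x\<in>?e j. ?good x).
          reg.residual_weight \<theta> j * ?g j)"
      proof (rule sum.mono_neutral_left)
        show "finite {j. j \<in> ?J \<and> R \<inter> reg.hit (?e j) = {} \<and> (\<forall>x\<in>?e j. ?good x)}"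
          using reg.finite_indices by simp
        show "Inl ` I' \<subseteq> {j. j \<in> ?J \<and> R \<inter> reg.hit (?e j) = {} \<and> (\<forall>x\<in>?e j. ?good x)}"
          by (simp add: I'_def Inl_mem image_subset_iff)
        show "\<forall>j\<in>{j. j \<in> ?J \<and> R \<inter> reg.hit (?e j) = {} \<and> (\<forall>x\<in>?e j. ?good x)} - Inl ` I'.
            reg.residual_weight \<theta> j * ?g j = 0"
        proof
          fix j assume "j \<in> {j. j \<in> ?J \<and> R \<inter> reg.hit (?e j) = {} \<and> (\<forall>x\<in>?e j. ?good x)} - Inl ` I'"
          then show "reg.residual_weight \<theta> j * ?g j = 0" by (cases j) (auto simp: I'_def image_iff)
        qed
      qed
      finally have eq: "(\<Sum>i\<in>I'. reg.residual_weight \<theta> (Inl i) * g i) = \<dots>" .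
      show ?thesis unfolding eq[symmetric] by (simp add: w'_def sum_divide_distrib)
    qed
    have s3: "(\<Sum>j\<in>?J. ?w j * ?g j) = (\<Sum>i\<in>I. w i * g i)"
      using finI finite_vertices by (simp add: sum.Plus)
    have "hypergraph_fractional_matching Y I' e w' r \<delta>0"
    proof
      show "finite Y" "finite I'" using finite_vertices finI by (auto simp: Y_def I'_def)
      fix i assume i: "i \<in> I'"
      show "e i \<subseteq> Y"
        using i edge_subset by (fastforce simp: I'_def Y_def reg.hit_def)
      show "e i \<noteq> {}" "card (e i) \<le> r" using i edge_nonempty edge_card by (auto simp: I'_def)
      have "Inl i \<in> ?J" using i by (simp add: I'_def Inl_mem)
      from reg.residual_weight_nonneg[OF this, of \<theta>] show "w' i \<ge> 0"
        using \<kappa> by (simp add: w'_def)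
    next
      fix x assume x: "x \<in> Y"
      let ?A = "{i. i \<in> I' \<and> x \<in> e i}"
      have "(\<Sum>i\<in>?A. reg.residual_weight \<theta> (Inl i)) \<le> 1 + \<kappa>"
      proof (cases "?good x")
        case True
        have "(\<Sum>i\<in>?A. reg.residual_weight \<theta> (Inl i)) =
           (\<Sum>j\<in>Inl ` ?A. reg.residual_weight \<theta> j * of_bool (R \<inter> reg.hit (?e j) = {}))"
          by (simp add: sum.reindex I'_def)
        also have "\<dots> \<le> reg.residual_degree \<theta> x R"
          unfolding reg.residual_degree_def
        proof (rule sum_mono2)
          show "finite {j. j \<in> ?J \<and> x \<in> ?e j}" using reg.finite_indices by simp
          show "Inl ` ?A \<subseteq> {j. j \<in> ?J \<and> x \<in> ?e j}" by (auto simp: I'_def)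
        qed (use reg.residual_weight_nonneg in simp)
        finally show ?thesis using True by simp
      next
        case False
        then have "?A = {}" by (auto simp: I'_def)
        then show ?thesis using \<kappa> by (simp only: sum.empty)
      qed
      then show "(\<Sum>i\<in>?A. w' i) \<le> 1"
        using \<kappa> by (simp add: w'_def flip: sum_divide_distrib)
    next
      fix x y assume xy: "x \<in> Y" "y \<in> Y" "x \<noteq> y"
      let ?A = "{i. i \<in> I' \<and> x \<in> e i \<and> y \<in> e i}"
      have "(\<Sum>i\<in>?A. w' i) \<le> (\<Sum>i\<in>?A. w i * exp r)"
      proof (rule sum_mono)
        fix i assume "i \<in> ?A"
        then have i: "Inl i \<in> ?J" by (auto simp: I'_def)
        have "w' i \<le> reg.residual_weight \<theta> (Inl i)"
          using \<kappa> reg.residual_weight_nonneg[OF i, of \<theta>]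
            by (simp add: w'_def divide_le_eq mult_left_mono algebra_simps)
        also have "\<dots> \<le> w i * exp r" using reg.residual_weight_le[OF i] \<theta> by simp
        finally show "w' i \<le> w i * exp r" .
      qed
      also have "\<dots> \<le> (\<Sum>i | i \<in> I \<and> x \<in> e i \<and> y \<in> e i. w i * exp r)"
        using finI weight_nonneg by (intro sum_mono2) (auto simp: I'_def)
      also have "\<dots> = (\<Sum>i | i \<in> I \<and> x \<in> e i \<and> y \<in> e i. w i) * exp r"
        by (simp add: sum_distrib_right)
      also have "\<dots> \<le> \<delta> * exp r"
        using xy by (intro mult_right_mono codegree) (auto simp: Y_def)
      finally show "(\<Sum>i\<in>?A. w' i) \<le> \<delta>0" using \<delta>_le(1) by simp
    qed
    moreover have "\<forall>i\<in>I'. 0 \<le> g i \<and> g i \<le> 1" using g by (auto simp: I'_def)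
    ultimately have "\<exists>M\<subseteq>I'. disjoint_family_on e M \<and> (\<Sum>i\<in>M. g i) \<ge> (\<Sum>i\<in>I'. w' i * g i) - \<beta> * card Y"
      by (intro step[rule_format]) auto
    then obtain M2 where M2: "M2 \<subseteq> I'" "disjoint_family_on e M2"
      "(\<Sum>i\<in>M2. g i) \<ge> (\<Sum>i\<in>I'. w' i * g i) - \<beta> * card Y"
      by blast
    have disj1: "e i \<inter> e j = {}" if "i \<in> M1" "j \<in> M1" "i \<noteq> j" for i j
      using that M1I by (auto simp: M1_def reg.hit_def disjoint_iff)
    have disj2: "e i \<inter> e j = {}" if "i \<in> M1" "j \<in> I'" for i j
      using that M1I by (auto simp: M1_def I'_def reg.hit_def disjoint_iff)
    have "M1 \<inter> M2 = {}"
      using disj2 M2(1) edge_nonempty M1I by fastforce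
    then have "(\<Sum>i\<in>M1 \<union> M2. g i) = (\<Sum>i\<in>M1. g i) + (\<Sum>i\<in>M2. g i)"
      using M1I M2(1) finI by (intro sum.union_disjoint) (auto simp: I'_def intro: finite_subset)
    also have "\<dots> \<ge> (\<Sum>i\<in>M1. g i) + (\<Sum>i\<in>I'. w' i * g i) - \<beta> * card Y" using M2(3) by simp
    finally have "(\<Sum>i\<in>M1 \<union> M2. g i) \<ge> (\<Sum>i\<in>I. w i * g i) -
        ((r + 1) * \<theta>\<^sup>2 + \<kappa> + exp r * reg.defect_constant * \<delta> / \<kappa>\<^sup>2 + \<beta> * (1 - \<theta> / 2)) * card X"
      using Rge unfolding s1 s2 s3 Y_def[symmetric] by simp
    also have "exp r * reg.defect_constant * \<delta> / \<kappa>\<^sup>2 = K * \<delta>"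
      by (simp add: K_def reg.defect_constant_def)
    finally have "(\<Sum>i\<in>M1 \<union> M2. g i) \<ge> (\<Sum>i\<in>I. w i * g i) - (\<beta> - \<beta> * \<theta> / 4) * card X"
      using mult_right_mono[OF loss, of "real (card X)"] by simp
    moreover have "disjoint_family_on e (M1 \<union> M2)"
      using disj1 disj2 M2 unfolding disjoint_family_on_def by blast
    moreover have "M1 \<union> M2 \<subseteq> I" using M1I M2(1) by (auto simp: I'_def)
    ultimately show "\<exists>M\<subseteq>I. disjoint_family_on e M \<and>
       (\<Sum>i\<in>M. g i) \<ge> (\<Sum>i\<in>I. w i * g i) - (\<beta> - \<beta>\<^sup>2 / (32 * (r + 1))) * card X"
      unfolding \<beta>' by blast
  qed
qed

lemma matching_defect_mono:
  assumes "matching_defect TYPE('x) TYPE('i) r \<beta>" "\<beta> \<le> \<beta>'"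
  shows "matching_defect TYPE('x) TYPE('i) r \<beta>'"
proof -
  have "a \<ge> b - \<beta>' * real n" if "a \<ge> b - \<beta> * real n" for a b :: real and n
    using that mult_right_mono[OF assms(2), of "real n"] by simp
  with assms(1) show ?thesis
    unfolding matching_defect_def by (elim ex_forward all_forward imp_forward conj_forward) blast+
qed

text \<open>The start of the iteration: the total weight is at most \<open>card X\<close>, so even
  the empty matching will do.\<close>

lemma matching_defect_one: "matching_defect TYPE('x) TYPE('i) r 1"
  unfolding matching_defect_def
proof (intro exI[of _ "1::real"] conjI allI impI)
  fix X :: "'x set" and I :: "'i set" and e :: "'i \<Rightarrow> 'x set" and w g :: "'i \<Rightarrow> real"
  assume "hypergraph_fractional_matching X I e w r 1" and g: "\<forall>i\<in>I. 0 \<le> g i \<and> g i \<le> 1"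
  then interpret hypergraph_fractional_matching X I e w r 1 by simp
  have "(\<Sum>i\<in>I. w i * g i) \<le> (\<Sum>i\<in>I. w i)"
    using g weight_nonneg by (intro sum_mono) (simp add: mult_left_le)
  also have "\<dots> = (\<Sum>i\<in>(\<Union>x\<in>X. {i. i \<in> I \<and> x \<in> e i}). w i)"
    using edge_subset edge_nonempty by (intro sum.cong) (auto, blast)
  also have "\<dots> \<le> (\<Sum>x\<in>X. \<Sum>i | i \<in> I \<and> x \<in> e i. w i)"
    using finite_vertices finite_indices weight_nonneg by (intro sum_UN_le) auto
  also have "\<dots> \<le> (\<Sum>x\<in>X. 1)" by (intro sum_mono degree)
  finally show "\<exists>M\<subseteq>I. disjoint_family_on e M \<and> (\<Sum>i\<in>M. g i) \<ge> (\<Sum>i\<in>I. w i * g i) - 1 * real (card X)"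
    by (intro exI[of _ "{}"]) (simp add: disjoint_family_on_def)
qed simp

text \<open>If the infimum of the achievable losses were positive, an achievable
  \<open>\<beta>\<close> close enough to it would be carried below it by the quadratic improvement
  of \<open>matching_defect_decrease\<close>.\<close>

theorem matching_defect_pos:
  assumes r: "r \<ge> 1" and \<epsilon>: "\<epsilon> > 0"
  shows "matching_defect TYPE('x) TYPE('i) r \<epsilon>"
proof -
  let ?P = "matching_defect TYPE('x) TYPE('i) r"
  define S where "S = {\<beta>. 0 \<le> \<beta> \<and> \<beta> \<le> 1 \<and> ?P \<beta>}"
  have one: "1 \<in> S" using matching_defect_one by (simp add: S_def)
  have bdd: "bdd_below S" by (auto simp: S_def)
  have "Inf S = 0"
  proof (rule ccontr)
    assume "Inf S \<noteq> 0"
    moreover have "Inf S \<ge> 0" using one by (intro cInf_greatest) (auto simp: S_def)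
    ultimately have pos: "Inf S > 0" by simp
    let ?k = "32 * (real r + 1)"
    have "Inf S < Inf S + (Inf S)\<^sup>2 / ?k" using pos by (simp add: add_pos_nonneg)
    then obtain \<beta> where \<beta>: "\<beta> \<in> S" "\<beta> < Inf S + (Inf S)\<^sup>2 / ?k"
      using one cInf_less_iff[OF _ bdd] by blast
    have le: "Inf S \<le> \<beta>" using \<beta>(1) bdd by (rule cInf_lower)
    have "(Inf S)\<^sup>2 / ?k \<le> \<beta>\<^sup>2 / ?k" using pos le by (intro divide_right_mono power_mono) auto
    then have less: "\<beta> - \<beta>\<^sup>2 / ?k < Inf S" using \<beta>(2) by simp
    have b: "0 < \<beta>" "\<beta> \<le> 1" using \<beta>(1) pos le by (auto simp: S_def)
    have "\<beta>\<^sup>2 \<le> \<beta> * 1" unfolding power2_eq_square using b by (intro mult_left_mono) auto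
    moreover have "\<beta>\<^sup>2 / ?k \<le> \<beta>\<^sup>2" using mult_left_mono[of 1 ?k "\<beta>\<^sup>2"] by (simp add: divide_le_eq)
    moreover have "0 \<le> \<beta>\<^sup>2 / ?k" by simp
    moreover have "?P (\<beta> - \<beta>\<^sup>2 / (32 * (r + 1)))"
      using \<beta>(1) r b by (intro matching_defect_decrease) (auto simp: S_def)
    moreover have "real (32 * (r + 1)) = ?k" by simp
    ultimately have "0 \<le> \<beta> - \<beta>\<^sup>2 / ?k" "\<beta> - \<beta>\<^sup>2 / ?k \<le> 1" "?P (\<beta> - \<beta>\<^sup>2 / ?k)"
      using b by (linarith, linarith, metis)
    then have "\<beta> - \<beta>\<^sup>2 / ?k \<in> S" by (simp add: S_def)
    then show False using cInf_lower[OF _ bdd] less by fastforce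
  qed
  then obtain \<beta> where "\<beta> \<in> S" "\<beta> < \<epsilon>"
    using \<epsilon> one cInf_less_iff[OF _ bdd] by (metis empty_iff)
  then show ?thesis using matching_defect_mono[of r \<beta> \<epsilon>] by (auto simp: S_def)
qed

text \<open>An edge is valued by \<open>a * card (e i) - c i\<close>, its saving against paying
  \<open>a\<close> for each of its vertices. As all degrees are 1, the savings weighted by
  \<open>w\<close> add up to exactly \<open>a * card X\<close> minus the fractional cost. Truncating
  them at 0 and dividing by \<open>a * r\<close> gives gains in \<open>{0..1}\<close>, which keeps
  \<open>\<delta>\<close> independent of the costs.\<close>

lemma fractional_perfect_matching_rounding:
  fixes a \<epsilon> :: real
  assumes r: "r \<ge> 1" and a: "a > 0" and \<epsilon>: "\<epsilon> > 0"
  shows "\<exists>\<delta>>0. \<forall>(X :: 'x set) (I :: 'i set) e w (c :: 'i \<Rightarrow> real).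
     hypergraph_fractional_matching X I e w r \<delta> \<longrightarrow> (\<forall>x\<in>X. (\<Sum>i | i \<in> I \<and> x \<in> e i. w i) = 1) \<longrightarrow>
     (\<forall>i\<in>I. 0 \<le> c i) \<longrightarrow>
     (\<exists>M\<subseteq>I. disjoint_family_on e M \<and>
        (\<Sum>i\<in>M. c i) + a * card (X - (\<Union>i\<in>M. e i)) \<le> (\<Sum>i\<in>I. w i * c i) + \<epsilon> * card X)"
proof -
  have "matching_defect TYPE('x) TYPE('i) r (\<epsilon> / (a * r))"
    using assms by (intro matching_defect_pos) auto
  then obtain \<delta> where \<delta>: "\<delta> > 0" and round: "\<forall>(X :: 'x set) (I :: 'i set) e w g.
     hypergraph_fractional_matching X I e w r \<delta> \<longrightarrow> (\<forall>i\<in>I. 0 \<le> g i \<and> g i \<le> 1) \<longrightarrow>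
     (\<exists>M\<subseteq>I. disjoint_family_on e M \<and> (\<Sum>i\<in>M. g i) \<ge> (\<Sum>i\<in>I. w i * g i) - \<epsilon> / (a * r) * card X)"
    unfolding matching_defect_def by (elim exE conjE)
  show ?thesis
  proof (intro exI[of _ \<delta>] conjI allI impI \<delta>)
    fix X :: "'x set" and I :: "'i set" and e :: "'i \<Rightarrow> 'x set" and w c :: "'i \<Rightarrow> real"
    assume H: "hypergraph_fractional_matching X I e w r \<delta>"
      and deg: "\<forall>x\<in>X. (\<Sum>i | i \<in> I \<and> x \<in> e i. w i) = 1" and c: "\<forall>i\<in>I. 0 \<le> c i"
    interpret hypergraph_fractional_matching X I e w r \<delta> by fact
    let ?h = "\<lambda>i. a * card (e i) - c i"
    define g where "g i = max 0 (?h i) / (a * r)" for i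
    have ar: "a * r > 0" using a r by simp
    have "g i \<le> 1" if "i \<in> I" for i
    proof -
      have "a * card (e i) \<le> a * r" using edge_card[OF that] a by simp
      then have "max 0 (?h i) \<le> a * r" using c that ar by auto
      then show ?thesis using ar by (simp add: g_def)
    qed
    then have g01: "\<forall>i\<in>I. 0 \<le> g i \<and> g i \<le> 1" using ar by (simp add: g_def)
    obtain M0 where M0: "M0 \<subseteq> I" "disjoint_family_on e M0"
      "(\<Sum>i\<in>M0. g i) \<ge> (\<Sum>i\<in>I. w i * g i) - \<epsilon> / (a * r) * card X"
      using round[rule_format, OF H] g01 by blast
    \<comment> \<open>Edges without positive saving have gain 0. Dropping them keeps the total gain
      and makes it proportional to the true saving.\<close>
    define M where "M = {i \<in> M0. ?h i > 0}"
    have M: "M \<subseteq> I" "disjoint_family_on e M"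
      using M0 unfolding M_def disjoint_family_on_def by blast+
    have finM0: "finite M0" and finM: "finite M"
      using M0(1) M(1) finite_indices by (auto intro: finite_subset)
    have finE: "finite (e i)" if "i \<in> I" for i
      using edge_subset[OF that] finite_vertices by (rule finite_subset)
    have "(a * r) * (\<Sum>i\<in>M0. g i) = (\<Sum>i\<in>M0. max 0 (?h i))"
      unfolding sum_distrib_left using ar by (intro sum.cong) (auto simp: g_def)
    also have "\<dots> = (\<Sum>i\<in>M. ?h i)"
      using finM0 by (intro sum.mono_neutral_cong_right) (auto simp: M_def)
    also have "\<dots> = a * card (\<Union>i\<in>M. e i) - (\<Sum>i\<in>M. c i)"
      using M finM finE
      by (subst card_UN_disjoint) (auto simp: sum_subtractf sum_distrib_left disjoint_family_on_def)
    finally have gain: "(a * r) * (\<Sum>i\<in>M0. g i) = a * card (\<Union>i\<in>M. e i) - (\<Sum>i\<in>M. c i)" .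
    have "a * card X - (\<Sum>i\<in>I. w i * c i) = (\<Sum>i\<in>I. w i * ?h i)"
    proof -
      have "real (card X) = (\<Sum>x\<in>X. \<Sum>i\<in>I. if x \<in> e i then w i else 0)"
        using deg finite_indices by (simp flip: sum.inter_filter)
      also have "\<dots> = (\<Sum>i\<in>I. \<Sum>x\<in>X. if x \<in> e i then w i else 0)" by (rule sum.swap)
      also have "\<dots> = (\<Sum>i\<in>I. w i * card (e i))"
      proof (rule sum.cong[OF refl])
        fix i assume "i \<in> I"
        then have "{x \<in> X. x \<in> e i} = e i" using edge_subset by blast
        then show "(\<Sum>x\<in>X. if x \<in> e i then w i else 0) = w i * card (e i)"
          using finite_vertices by (simp flip: sum.inter_filter)
      qed
      finally show ?thesis by (simp add: sum_distrib_left right_diff_distrib sum_subtractf mult_ac)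
    qed
    also have "\<dots> \<le> (\<Sum>i\<in>I. w i * max 0 (?h i))"
      using weight_nonneg by (intro sum_mono mult_left_mono) auto
    also have "\<dots> = (a * r) * (\<Sum>i\<in>I. w i * g i)"
      unfolding sum_distrib_left using ar by (intro sum.cong) (auto simp: g_def)
    also have "\<dots> \<le> (a * r) * ((\<Sum>i\<in>M0. g i) + \<epsilon> / (a * r) * card X)"
      using M0(3) ar by (intro mult_left_mono) auto
    also have "\<dots> = a * card (\<Union>i\<in>M. e i) - (\<Sum>i\<in>M. c i) + \<epsilon> * card X"
      using r a gain by (simp add: distrib_left)
    finally have fin: "a * card X - (\<Sum>i\<in>I. w i * c i) \<le> a * card (\<Union>i\<in>M. e i) - (\<Sum>i\<in>M. c i) + \<epsilon> *
        card X" .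
    have sub: "(\<Union>i\<in>M. e i) \<subseteq> X" using M(1) edge_subset by blast
    have "real (card (X - (\<Union>i\<in>M. e i))) = real (card X) - real (card (\<Union>i\<in>M. e i))"
      using sub finite_vertices by (simp add: card_Diff_subset finite_subset card_mono of_nat_diff)
    then have "(\<Sum>i\<in>M. c i) + a * card (X - (\<Union>i\<in>M. e i)) \<le> (\<Sum>i\<in>I. w i * c i) + \<epsilon> * card X"
      using fin by (simp add: right_diff_distrib)
    then show "\<exists>M\<subseteq>I. disjoint_family_on e M \<and>
        (\<Sum>i\<in>M. c i) + a * card (X - (\<Union>i\<in>M. e i)) \<le> (\<Sum>i\<in>I. w i * c i) + \<epsilon> * card X"
      using M by blast
  qed
qed

text \<open>A fractional cover becomes a fractional perfect matching when each edge is replaced by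
  its random subset that keeps a vertex \<open>x\<close> with probability one over the degree of \<open>x\<close>.\<close>

lemma fractional_cover_rounding:
  fixes a \<epsilon> :: real
  assumes r: "r \<ge> 1" and a: "a > 0" and \<epsilon>: "\<epsilon> > 0"
  shows "\<exists>\<delta>>0. \<forall>(X :: 'x set) (I :: 'i set) e w (c :: 'i \<Rightarrow> real). finite X \<longrightarrow> finite I \<longrightarrow>
     (\<forall>i\<in>I. e i \<subseteq> X \<and> card (e i) \<le> r \<and> 0 \<le> w i \<and> 0 \<le> c i) \<longrightarrow>
     (\<forall>x\<in>X. (\<Sum>i | i \<in> I \<and> x \<in> e i. w i) \<ge> 1) \<longrightarrow>
     (\<forall>x\<in>X. \<forall>y\<in>X. x \<noteq> y \<longrightarrow> (\<Sum>i | i \<in> I \<and> x \<in> e i \<and> y \<in> e i. w i) \<le> \<delta>) \<longrightarrow>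
     (\<exists>M\<subseteq>I. (\<Sum>i\<in>M. c i) + a * card (X - (\<Union>i\<in>M. e i)) \<le> (\<Sum>i\<in>I. w i * c i) + \<epsilon> * card X)"
proof -
  obtain \<delta> where \<delta>: "\<delta> > 0" and round: "\<forall>(X :: 'x set) (I :: ('i \<times> 'x set) set) e w (c :: 'i \<times> 'x
      set \<Rightarrow> real).
     hypergraph_fractional_matching X I e w r \<delta> \<longrightarrow> (\<forall>x\<in>X. (\<Sum>i | i \<in> I \<and> x \<in> e i. w i) = 1) \<longrightarrow>
     (\<forall>i\<in>I. 0 \<le> c i) \<longrightarrow>
     (\<exists>M\<subseteq>I. disjoint_family_on e M \<and>
        (\<Sum>i\<in>M. c i) + a * card (X - (\<Union>i\<in>M. e i)) \<le> (\<Sum>i\<in>I. w i * c i) + \<epsilon> * card X)"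
    using fractional_perfect_matching_rounding[OF assms] by (elim exE conjE)
  show ?thesis
  proof (intro exI[of _ \<delta>] conjI allI impI \<delta>)
    fix X :: "'x set" and I :: "'i set" and e :: "'i \<Rightarrow> 'x set" and w c :: "'i \<Rightarrow> real"
    assume finX: "finite X" and finI: "finite I"
      and I: "\<forall>i\<in>I. e i \<subseteq> X \<and> card (e i) \<le> r \<and> 0 \<le> w i \<and> 0 \<le> c i"
      and deg: "\<forall>x\<in>X. (\<Sum>i | i \<in> I \<and> x \<in> e i. w i) \<ge> 1"
      and codeg: "\<forall>x\<in>X. \<forall>y\<in>X. x \<noteq> y \<longrightarrow> (\<Sum>i | i \<in> I \<and> x \<in> e i \<and> y \<in> e i. w i) \<le> \<delta>"
    define D where "D x = (\<Sum>i | i \<in> I \<and> x \<in> e i. w i)" for x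
    define p where "p x = 1 / D x" for x
    \<comment> \<open>\<open>q i A\<close> is the probability that the random subset of
      \<open>e i\<close> equals \<open>A\<close> when every \<open>x\<close> is kept independently
      with probability \<open>p x\<close>. The empty subset is left out of \<open>J\<close> because
      edges have to be nonempty; it contributes to no degree.\<close>
    define q where "q i A = (\<Prod>x\<in>A. p x) * (\<Prod>x\<in>e i - A. 1 - p x)" for i A
    define J where "J = (SIGMA i:I. Pow (e i) - {{}})"
    define w' where "w' = (\<lambda>(i, A). w i * q i A)"
    have finE: "finite (e i)" if "i \<in> I" for i
      using I that finX by (auto intro: finite_subset)
    have finJ: "finite J" unfolding J_def using finI finE by (intro finite_SigmaI) auto
    have D: "D x \<ge> 1" if "x \<in> X" for x using deg that by (simp add: D_def)
    have p01: "0 \<le> p x" "p x \<le> 1" if "x \<in> X" for x using D[OF that] by (auto simp: p_def)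
    have q0: "q i A \<ge> 0" if "i \<in> I" "A \<subseteq> e i" for i A
    proof -
      have "A \<subseteq> X" "e i - A \<subseteq> X" using I that by auto
      then show ?thesis unfolding q_def using p01 by (intro mult_nonneg_nonneg prod_nonneg) auto
    qed
    have total: "(\<Sum>A\<in>Pow (e i). q i A) = 1" if "i \<in> I" for i
      using subset_expectation_avoid[of "e i" "{}" p] finE[OF that]
      by (simp add: subset_expectation_def q_def)
    have at: "(\<Sum>A | A \<subseteq> e i \<and> x \<in> A. q i A) = p x" if "i \<in> I" "x \<in> e i" for i x
    proof -
      have "(\<Sum>A | A \<subseteq> e i \<and> x \<in> A. q i A) =
          subset_expectation p (e i) (\<lambda>R. of_bool (x \<in> R \<and> R \<inter> {} = {}))"
        unfolding subset_expectation_def q_def using finE[OF that(1)]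
        by (intro sum.mono_neutral_cong_left) auto
      also have "\<dots> = p x"
        using finE[OF that(1)] that(2) by (subst subset_expectation_pick) auto
      finally show ?thesis .
    qed
    have sumJ: "(\<Sum>j | j \<in> J \<and> Q j. w' j) = (\<Sum>i\<in>I. w i * (\<Sum>A | A \<subseteq> e i \<and> A \<noteq> {} \<and> Q (i, A). q i A))"
        for Q
    proof -
      have "{j. j \<in> J \<and> Q j} = (SIGMA i:I. {A. A \<subseteq> e i \<and> A \<noteq> {} \<and> Q (i, A)})"
        by (auto simp: J_def)
      then show ?thesis using finI finE by (simp add: sum.Sigma w'_def sum_distrib_left)
    qed
    have deg': "(\<Sum>j | j \<in> J \<and> x \<in> snd j. w' j) = 1" if x: "x \<in> X" for x
    proof -
      have "(\<Sum>j | j \<in> J \<and> x \<in> snd j. w' j) = (\<Sum>i\<in>I. if x \<in> e i then w i * p x else 0)"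
        unfolding sumJ
      proof (rule sum.cong[OF refl])
        fix i assume i: "i \<in> I"
        have eq: "{A. A \<subseteq> e i \<and> A \<noteq> {} \<and> x \<in> snd (i, A)} = {A. A \<subseteq> e i \<and> x \<in> A}" by auto
        show "w i * (\<Sum>A | A \<subseteq> e i \<and> A \<noteq> {} \<and> x \<in> snd (i, A). q i A) = (if x \<in> e i then w i *
            p x else 0)"
        proof (cases "x \<in> e i")
          case True then show ?thesis unfolding eq at[OF i True] by simp
        next
          case False
          then have empty: "{A. A \<subseteq> e i \<and> x \<in> A} = {}" by blast
          show ?thesis unfolding eq empty using False by simp
        qed
      qed
      also have "\<dots> = D x * p x"
        unfolding D_def sum_distrib_right using finI by (simp flip: sum.inter_filter)
      also have "\<dots> = 1" using D[OF x] by (simp add: p_def)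
      finally show ?thesis .
    qed
    have "hypergraph_fractional_matching X J snd w' r \<delta>"
    proof
      fix j assume j: "j \<in> J"
      then obtain i A where A: "j = (i, A)" "i \<in> I" "A \<subseteq> e i" "A \<noteq> {}" by (auto simp: J_def)
      then have "e i \<subseteq> X" using I by blast
      then show "snd j \<subseteq> X" "snd j \<noteq> {}" using A by auto
      show "card (snd j) \<le> r" using A I finE card_mono[of "e i" A] by force
      show "w' j \<ge> 0" using j I q0 by (auto simp: J_def w'_def)
    next
      fix x y assume xy: "x \<in> X" "y \<in> X" "x \<noteq> y"
      have "(\<Sum>j | j \<in> J \<and> x \<in> snd j \<and> y \<in> snd j. w' j) \<le> (\<Sum>i\<in>I. if x \<in> e i \<and>
          y \<in> e i then w i else 0)"
        unfolding sumJ
      proof (rule sum_mono)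
        fix i assume i: "i \<in> I"
        let ?S = "{A. A \<subseteq> e i \<and> A \<noteq> {} \<and> x \<in> snd (i, A) \<and> y \<in> snd (i, A)}"
        show "w i * (\<Sum>A\<in>?S. q i A) \<le> (if x \<in> e i \<and> y \<in> e i then w i else 0)"
        proof (cases "x \<in> e i \<and> y \<in> e i")
          case True
          have "(\<Sum>A\<in>?S. q i A) \<le> (\<Sum>A\<in>Pow (e i). q i A)"
            using finE[OF i] q0[OF i] by (intro sum_mono2) auto
          then show ?thesis using True total[OF i] I i by (simp add: mult_left_le)
        next
          case False
          then have "?S = {}" by auto
          then show ?thesis using False by (simp only: sum.empty) simp
        qed
      qed
      also have "\<dots> = (\<Sum>i | i \<in> I \<and> x \<in> e i \<and> y \<in> e i. w i)"
        using finI by (simp flip: sum.inter_filter)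
      also have "\<dots> \<le> \<delta>" using codeg xy by blast
      finally show "(\<Sum>j | j \<in> J \<and> x \<in> snd j \<and> y \<in> snd j. w' j) \<le> \<delta>" .
    qed (use finX finJ deg' in auto)
    moreover have "\<forall>j\<in>J. 0 \<le> c (fst j)" using I by (auto simp: J_def)
    ultimately obtain M where M: "M \<subseteq> J" and le:
      "(\<Sum>j\<in>M. c (fst j)) + a * card (X - (\<Union>j\<in>M. snd j)) \<le> (\<Sum>j\<in>J. w' j * c (fst j)) + \<epsilon> * card X"
      using round[rule_format, of X J snd w' "\<lambda>j. c (fst j)"] deg' by blast
    have finM: "finite M" using M finJ by (rule finite_subset)
    \<comment> \<open>Replacing the chosen subsets by the full edges covers at least as much, and
      several subsets of one edge merge into a single edge, so neither the cost nor the uncovered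
      part grows.\<close>
    have "(\<Sum>i\<in>fst ` M. c i) \<le> (\<Sum>j\<in>M. c (fst j))"
      using sum_image_le[of M c fst] M finM I by (force simp: J_def)
    moreover have "a * card (X - (\<Union>i\<in>fst ` M. e i)) \<le> a * card (X - (\<Union>j\<in>M. snd j))"
    proof -
      have "X - (\<Union>i\<in>fst ` M. e i) \<subseteq> X - (\<Union>j\<in>M. snd j)" using M by (force simp: J_def)
      then show ?thesis using a finX by (intro mult_left_mono) (auto intro!: card_mono)
    qed
    moreover have "(\<Sum>j\<in>J. w' j * c (fst j)) \<le> (\<Sum>i\<in>I. w i * c i)"
    proof -
      have "(\<Sum>j\<in>J. w' j * c (fst j)) = (\<Sum>i\<in>I. \<Sum>A\<in>Pow (e i) - {{}}. w i * q i A * c i)"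
        unfolding J_def using finI finE by (subst sum.Sigma) (auto simp: w'_def intro!: sum.cong)
      also have "\<dots> = (\<Sum>i\<in>I. (w i * c i) * (\<Sum>A\<in>Pow (e i) - {{}}. q i A))"
        by (simp add: sum_distrib_left mult_ac)
      also have "\<dots> \<le> (\<Sum>i\<in>I. (w i * c i) * (\<Sum>A\<in>Pow (e i). q i A))"
        using I q0 finE by (intro sum_mono mult_left_mono sum_mono2) auto
      also have "\<dots> = (\<Sum>i\<in>I. w i * c i)" using total by (intro sum.cong) auto
      finally show ?thesis .
    qed
    ultimately have "(\<Sum>i\<in>fst ` M. c i) + a * card (X - (\<Union>i\<in>fst ` M. e i)) \<le> (\<Sum>i\<in>I. w i * c i) + \<epsilon> *
        card X"
      using le by linarith
    moreover have "fst ` M \<subseteq> I" using M by (auto simp: J_def)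
    ultimately show "\<exists>M\<subseteq>I. (\<Sum>i\<in>M. c i) + a * card (X - (\<Union>i\<in>M. e i)) \<le> (\<Sum>i\<in>I. w i * c i) + \<epsilon> *
        card X"
      by blast
  qed
qed

section \<open>Fractional systems of cliques and blow-ups\<close>

text \<open>Induced subgraphs keep the edge set \<open>E\<close> of the whole graph, since only
  pairs inside \<open>S\<close> matter for \<open>cliques S E\<close>. This identity turns them into
  graphs in the sense of \<open>fin_graph\<close> where results about those are wanted.\<close>

lemma cliques_Int_nsets: "cliques S (E \<inter> nsets S 2) = cliques S E"
  by (auto simp: cliques_def subset_iff)

lemma finite_cliques': "finite S \<Longrightarrow> finite (cliques S E)"
  by (rule finite_subset[of _ "Pow S"]) (auto simp: cliques_def)

lemma clique_finite: "finite S \<Longrightarrow> K \<in> cliques S E \<Longrightarrow> finite K"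
  by (auto simp: cliques_def intro: finite_subset)

lemma clique_card_ge_one: "finite S \<Longrightarrow> K \<in> cliques S E \<Longrightarrow> card K \<ge> 1"
  using clique_finite by (auto simp: cliques_def Suc_le_eq card_gt_0_iff)

lemma subset_clique: "K \<in> cliques S E \<Longrightarrow> T \<subseteq> K \<Longrightarrow> T \<noteq> {} \<Longrightarrow> T \<in> cliques S E"
  by (auto simp: cliques_def)

lemma cliques_of_size_subset: "finite V \<Longrightarrow> cliques_of_size t V E \<subseteq> nsets V t"
  by (auto simp: cliques_of_size_def cliques_def nsets_def intro: finite_subset)

lemma card_nsets_eq: "finite V \<Longrightarrow> card (nsets V t) = card V choose t"
proof -
  assume "finite V"
  then have "nsets V t = {B. B \<subseteq> V \<and> card B = t}" by (auto simp: nsets_def intro: finite_subset)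
  then show ?thesis using n_subsets[OF \<open>finite V\<close>] by simp
qed

lemma card_cliques_of_size_le: "finite V \<Longrightarrow> card (cliques_of_size t V E) \<le> card V choose t"
  using card_mono[OF finite_imp_finite_nsets cliques_of_size_subset] card_nsets_eq by metis

lemma card_nsets_superset:
  assumes "finite W" "T \<subseteq> W" "card T \<le> m"
  shows "card {S \<in> nsets W m. T \<subseteq> S} = (card W - card T) choose (m - card T)"
proof -
  have finT: "finite T" using assms finite_subset by blast
  have "bij_betw (\<lambda>S. S \<union> T) (nsets (W - T) (m - card T)) {S \<in> nsets W m. T \<subseteq> S}"
  proof (rule bij_betw_byWitness[where f' = "\<lambda>S. S - T"])
    show "(\<lambda>S. S \<union> T) ` nsets (W - T) (m - card T) \<subseteq> {S \<in> nsets W m. T \<subseteq> S}"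
    proof clarify
      fix S assume "S \<in> nsets (W - T) (m - card T)"
      then have S: "S \<subseteq> W - T" "finite S" "card S = m - card T" by (auto simp: nsets_def)
      then have "card (S \<union> T) = card S + card T" using finT by (intro card_Un_disjoint) auto
      then show "S \<union> T \<in> nsets W m \<and> T \<subseteq> S \<union> T" using S assms finT by (auto simp: nsets_def)
    qed
    show "(\<lambda>S. S - T) ` {S \<in> nsets W m. T \<subseteq> S} \<subseteq> nsets (W - T) (m - card T)"
      using finT by (auto simp: nsets_def card_Diff_subset)
  qed (auto simp: nsets_def)
  then have "card {S \<in> nsets W m. T \<subseteq> S} = card (nsets (W - T) (m - card T))"
    using bij_betw_same_card by metis
  also have "\<dots> = (card W - card T) choose (m - card T)"
    using assms finT by (simp add: card_nsets_eq card_Diff_subset)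
  finally show ?thesis .
qed

text \<open>The set \<open>Q\<close> of admissible total weights is \<open>{1..}\<close> for covers and \<open>{1}\<close> for
  decompositions.\<close>

definition frac_system :: "real set \<Rightarrow> nat \<Rightarrow> 'a set \<Rightarrow> 'a set set \<Rightarrow> ('a set \<Rightarrow> real) \<Rightarrow> bool" where
  "frac_system Q t V E f \<longleftrightarrow> (\<forall>K \<in> cliques V E. f K \<ge> 0) \<and>
     (\<forall>T \<in> cliques_of_size t V E. cover_weight V E f T \<in> Q)"

definition frac_value :: "real set \<Rightarrow> nat \<Rightarrow> 'a set \<Rightarrow> 'a set set \<Rightarrow> (nat \<Rightarrow> real) \<Rightarrow> real" where
  "frac_value Q t V E c = Inf {cost V E c f | f. frac_system Q t V E f}"

lemma frac_system_cover: "frac_system {1..} t V E f = frac_clique_cover t V E f"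
  by (simp add: frac_system_def frac_clique_cover_def)

lemma frac_system_decomposition: "frac_system {1} t V E f = frac_clique_decomposition t V E f"
  by (simp add: frac_system_def frac_clique_decomposition_def)

lemma frac_cov_eq: "frac_cov t V E c = frac_value {1..} t V E c"
  by (simp add: frac_cov_def frac_value_def frac_system_cover)

lemma frac_dec_eq: "frac_dec t V E c = frac_value {1} t V E c"
  by (simp add: frac_dec_def frac_value_def frac_system_decomposition)

lemma cost_Int_nsets: "cost S (E \<inter> nsets S 2) c f = cost S E c f"
  by (simp add: cost_def cliques_Int_nsets)

lemma frac_system_Int_nsets: "frac_system Q t S (E \<inter> nsets S 2) f = frac_system Q t S E f"
  by (simp add: frac_system_def cover_weight_def cliques_of_size_def cliques_Int_nsets)

lemma frac_value_Int_nsets: "frac_value Q t S (E \<inter> nsets S 2) c = frac_value Q t S E c"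
  by (simp add: frac_value_def cost_Int_nsets frac_system_Int_nsets)

lemma frac_value_attained:
  assumes Q: "Q \<in> {{1..}, {1}}" and S: "finite S" and c: "\<forall>i\<ge>1. 0 \<le> c i" and t: "t \<ge> 1"
  obtains f where "frac_system Q t S E f" "cost S E c f = frac_value Q t S E c"
proof -
  have G: "fin_graph S (E \<inter> nsets S 2)" using S by (simp add: fin_graph_def)
  have "\<exists>f. frac_system Q t S (E \<inter> nsets S 2) f \<and>
      cost S (E \<inter> nsets S 2) c f = frac_value Q t S (E \<inter> nsets S 2) c"
    using Q frac_cov_attained[OF G c] frac_dec_attained[OF G c t]
    by (auto simp: frac_cov_eq frac_dec_eq frac_system_cover frac_system_decomposition)
  then show thesis
    using that by (auto simp: frac_system_Int_nsets cost_Int_nsets frac_value_Int_nsets)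
qed

lemma cost_nonneg:
  assumes "finite V" "\<forall>i\<ge>1. 0 \<le> c i" "\<forall>K \<in> cliques V E. f K \<ge> 0"
  shows "cost V E c f \<ge> 0"
  unfolding cost_def using assms clique_card_ge_one[OF assms(1)]
  by (intro sum_nonneg mult_nonneg_nonneg) blast+

lemma frac_value_le:
  assumes "finite V" "\<forall>i\<ge>1. 0 \<le> c i" "frac_system Q t V E f"
  shows "frac_value Q t V E c \<le> cost V E c f"
  unfolding frac_value_def
proof (rule cInf_lower)
  show "bdd_below {cost V E c f | f. frac_system Q t V E f}"
    using cost_nonneg[OF assms(1,2)] by (intro bdd_belowI[of _ 0]) (auto simp: frac_system_def)
qed (use assms in auto)

lemma frac_value_nonneg:
  assumes "Q \<in> {{1..}, {1}}" "finite S" "\<forall>i\<ge>1. 0 \<le> c i" "t \<ge> 1"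
  shows "frac_value Q t S E c \<ge> 0"
  using frac_value_attained[OF assms, of E] cost_nonneg[OF assms(2,3)]
  by (metis frac_system_def)

text \<open>Taking every \<open>t\<close>-clique by itself is a decomposition, which gives a bound
  in terms of \<open>c t\<close> alone.\<close>

lemma frac_value_le_choose:
  assumes Q: "Q \<in> {{1..}, {1}}" and S: "finite S" and c: "\<forall>i\<ge>1. 0 \<le> c i" and t: "t \<ge> 1"
  shows "frac_value Q t S E c \<le> c t * (card S choose t)"
proof -
  define f where "f K = (if card K = t then 1 else (0::real))" for K :: "'a set"
  have "fin_graph S (E \<inter> nsets S 2)" using S by (simp add: fin_graph_def)
  then have "clique_decomposition t S (E \<inter> nsets S 2) f"
    unfolding f_def by (rule all_t_cliques_decompose)
  then have "frac_system Q t S (E \<inter> nsets S 2) f"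
    using Q decomposition_imp_frac by (auto simp: frac_system_cover frac_system_decomposition)
  then have "frac_value Q t S E c \<le> cost S E c f"
    using S c by (intro frac_value_le) (simp_all add: frac_system_Int_nsets)
  also have "\<dots> = (\<Sum>K\<in>cliques_of_size t S E. c t)"
    unfolding cost_def f_def using finite_cliques'[OF S]
    by (intro sum.mono_neutral_cong_right) (auto simp: cliques_of_size_def)
  also have "\<dots> \<le> c t * (card S choose t)"
    using card_cliques_of_size_le[OF S] c t by (simp add: mult.commute mult_left_mono)
  finally show ?thesis .
qed

text \<open>Closure under averages lets a single argument treat covers and decompositions together,
  both in sampling and in blow-ups.\<close>

lemma average_in_target:
  assumes "Q \<in> {{1..}, {1::real}}" "\<And>a. a \<in> A \<Longrightarrow> h a \<in> Q" "card A > 0"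
  shows "(\<Sum>a\<in>A. h a) / card A \<in> Q"
proof (cases "Q = {1}")
  case True
  then have "(\<Sum>a\<in>A. h a) = (\<Sum>a\<in>A. 1)" using assms(2) by (intro sum.cong) auto
  then show ?thesis using True assms(3) by simp
next
  case False
  then have "(\<Sum>a\<in>A. h a) \<ge> (\<Sum>a\<in>A. 1)" using assms(1,2) by (intro sum_mono) auto
  then show ?thesis using False assms(1,3) by (simp add: le_divide_eq)
qed

lemma sum_induced_cliques:
  fixes h :: "'a set \<Rightarrow> 'a set \<Rightarrow> real"
  assumes "finite W" "A \<subseteq> Pow W"
  shows "(\<Sum>S\<in>A. \<Sum>K | K \<in> cliques S E \<and> P K. h S K) =
    (\<Sum>K | K \<in> cliques W E \<and> P K. \<Sum>S | S \<in> A \<and> K \<subseteq> S. h S K)"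
proof -
  have finA: "finite A" using assms by (auto intro: finite_subset)
  have "(\<Sum>S\<in>A. \<Sum>K | K \<in> cliques S E \<and> P K. h S K) =
     (\<Sum>S\<in>A. \<Sum>K | K \<in> {K. K \<in> cliques W E \<and> P K} \<and> K \<subseteq> S. h S K)"
    using assms(2) by (intro sum.cong refl) (auto simp: cliques_def)
  also have "\<dots> = (\<Sum>K | K \<in> cliques W E \<and> P K. \<Sum>S | S \<in> A \<and> K \<subseteq> S. h S K)"
    using finA finite_cliques'[OF assms(1)] by (intro sum.swap_restrict) auto
  finally show ?thesis .
qed

text \<open>Only the \<open>m\<close>-subsets that contain \<open>T\<close> contribute, and their
  number is the same for every \<open>T\<close>; so the quotient is an average of numbers in
  \<open>Q\<close>.\<close>

lemma average_cover_weight: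
  assumes Q: "Q \<in> {{1..}, {1}}" and W: "finite W" and t: "t \<le> m" "m \<le> card W"
    and f: "\<And>S. S \<in> nsets W m \<Longrightarrow> frac_system Q t S E (f S)"
    and T: "T \<in> cliques_of_size t W E"
  shows "(\<Sum>S\<in>nsets W m. cover_weight S E (f S) T) / ((card W - t) choose (m - t)) \<in> Q"
proof -
  let ?b = "(card W - t) choose (m - t)"
  have T': "T \<subseteq> W" "card T = t" using T by (auto simp: cliques_of_size_def cliques_def)
  have card: "card {S \<in> nsets W m. T \<subseteq> S} = ?b"
    using card_nsets_superset[OF W T'(1)] T' t by simp
  have "(\<Sum>S\<in>nsets W m. cover_weight S E (f S) T) =
      (\<Sum>S\<in>{S \<in> nsets W m. T \<subseteq> S}. cover_weight S E (f S) T)"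
    unfolding cover_weight_def using finite_imp_finite_nsets[OF W]
    by (intro sum.mono_neutral_right) (auto simp: cliques_def intro!: sum.neutral)
  moreover have "(\<Sum>S\<in>{S \<in> nsets W m. T \<subseteq> S}. cover_weight S E (f S) T) / card {S \<in> nsets W m. T \<subseteq>
      S} \<in> Q"
  proof (rule average_in_target[OF Q])
    fix S assume S: "S \<in> {S \<in> nsets W m. T \<subseteq> S}"
    then have "T \<in> cliques_of_size t S E" using T by (auto simp: cliques_of_size_def cliques_def)
    then show "cover_weight S E (f S) T \<in> Q" using f S by (auto simp: frac_system_def)
  qed (use card t in simp)
  ultimately show ?thesis by (simp only: card)
qed

text \<open>Superposing optimal systems of all \<open>m\<close>-subsets, divided by the number of
  \<open>m\<close>-subsets that contain a fixed \<open>t\<close>-set, produces a system of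
  \<open>W\<close>.\<close>

lemma frac_value_averaging:
  assumes Q: "Q \<in> {{1..}, {1}}" and W: "finite W" and c: "\<forall>i\<ge>1. 0 \<le> c i"
    and t: "1 \<le> t" "t \<le> m" "m \<le> card W"
  shows "((card W - t) choose (m - t)) * frac_value Q t W E c \<le>
      (\<Sum>S\<in>nsets W m. frac_value Q t S E c)"
proof -
  let ?b = "(card W - t) choose (m - t)"
  have b: "?b > 0" using t by simp
  have "\<forall>S\<in>nsets W m. \<exists>f. frac_system Q t S E f \<and> cost S E c f = frac_value Q t S E c"
    using frac_value_attained[OF Q _ c t(1)] by (metis (no_types, lifting) mem_Collect_eq nsets_def)
  then obtain f where f: "\<And>S. S \<in> nsets W m \<Longrightarrow> frac_system Q t S E (f S)"
    "\<And>S. S \<in> nsets W m \<Longrightarrow> cost S E c (f S) = frac_value Q t S E c"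
    by metis
  define F where "F K = (\<Sum>S | S \<in> nsets W m \<and> K \<subseteq> S. f S K) / ?b" for K
  have sub: "nsets W m \<subseteq> Pow W" by (auto simp: nsets_def)
  have "frac_system Q t W E F"
    unfolding frac_system_def
  proof (intro conjI ballI)
    fix K assume "K \<in> cliques W E"
    then show "F K \<ge> 0" unfolding F_def using f(1)
      by (intro divide_nonneg_nonneg sum_nonneg) (auto simp: frac_system_def cliques_def)
  next
    fix T assume T: "T \<in> cliques_of_size t W E"
    have "cover_weight W E F T = (\<Sum>K | K \<in> cliques W E \<and> T \<subseteq> K. \<Sum>S | S \<in> nsets W m \<and> K \<subseteq>
        S. f S K) / ?b"
      by (simp add: cover_weight_def F_def sum_divide_distrib)
    also have "(\<Sum>K | K \<in> cliques W E \<and> T \<subseteq> K. \<Sum>S | S \<in> nsets W m \<and> K \<subseteq> S. f S K) =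
       (\<Sum>S\<in>nsets W m. \<Sum>K | K \<in> cliques S E \<and> T \<subseteq> K. f S K)"
      using sum_induced_cliques[OF W sub] by simp
    also have "(\<Sum>S\<in>nsets W m. \<Sum>K | K \<in> cliques S E \<and> T \<subseteq> K. f S K) / ?b \<in> Q"
      using average_cover_weight[OF Q W t(2,3), of E f, OF f(1) T] by (simp add: cover_weight_def)
    finally show "cover_weight W E F T \<in> Q" .
  qed
  then have "frac_value Q t W E c \<le> cost W E c F" using W c by (intro frac_value_le)
  also have "\<dots> = (\<Sum>K | K \<in> cliques W E \<and> True. \<Sum>S | S \<in> nsets W m \<and> K \<subseteq> S. c (card K) * f S K) / ?b"
    by (simp add: cost_def F_def sum_divide_distrib sum_distrib_left)
  also have "\<dots> = (\<Sum>S\<in>nsets W m. \<Sum>K | K \<in> cliques S E \<and> True. c (card K) * f S K) / ?b"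
    using sum_induced_cliques[OF W sub, where P = "\<lambda>_. True"] by simp
  also have "\<dots> = (\<Sum>S\<in>nsets W m. frac_value Q t S E c) / ?b"
    using f(2) by (simp add: cost_def)
  finally show ?thesis using b by (simp add: le_divide_eq mult.commute)
qed

section \<open>Blow-ups\<close>

lemma disjoint_parts_exist:
  assumes "finite S" "finite V" "q * card S \<le> card V"
  shows "\<exists>P. (\<forall>s\<in>S. P s \<subseteq> V \<and> card (P s) = q) \<and> disjoint_family_on P S"
  using assms(1,3)
proof (induction rule: finite_induct)
  case empty then show ?case by (simp add: disjoint_family_on_def)
next
  case (insert s S)
  then obtain P where P: "\<forall>s\<in>S. P s \<subseteq> V \<and> card (P s) = q" "disjoint_family_on P S" by auto
  let ?U = "\<Union>s\<in>S. P s"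
  have U: "?U \<subseteq> V" using P(1) by auto
  have "card ?U \<le> (\<Sum>s\<in>S. card (P s))" using insert(1) by (rule card_UN_le)
  also have "\<dots> = q * card S" using P(1) by simp
  finally have "q \<le> card (V - ?U)"
    using insert.prems insert(1,2) U assms(2) by (simp add: card_Diff_subset finite_subset)
  then obtain T where T: "T \<subseteq> V - ?U" "card T = q" by (meson obtain_subset_with_card_n)
  have "disjoint_family_on (P(s := T)) (insert s S)"
    using P(2) T(1) insert(2) by (fastforce simp: disjoint_family_on_def)
  moreover have "\<forall>s'\<in>insert s S. (P(s := T)) s' \<subseteq> V \<and> card ((P(s := T)) s') = q"
    using P(1) T by auto
  ultimately show ?case by blast
qed

text \<open>The vertices of \<open>V\<close> outside all parts become isolated. Thus the blow-up has
  vertex set \<open>V\<close> itself, even if \<open>card V\<close> is not a multiple of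
  \<open>card S\<close>.\<close>

locale blow_up =
  fixes S V :: "'a set" and E :: "'a set set" and P :: "'a \<Rightarrow> 'a set" and q :: nat
  assumes finite_S: "finite S" and finite_V: "finite V"
    and parts: "s \<in> S \<Longrightarrow> P s \<subseteq> V" "s \<in> S \<Longrightarrow> card (P s) = q"
    and disjoint: "disjoint_family_on P S"
begin

definition edges :: "'a set set" where
  "edges = {{u, v} | u v. \<exists>x\<in>S. \<exists>y\<in>S. x \<noteq> y \<and> {x, y} \<in> E \<and> u \<in> P x \<and> v \<in> P y}"

definition base :: "'a \<Rightarrow> 'a" where "base u = (THE s. s \<in> S \<and> u \<in> P s)"

lemma base_eq: "s \<in> S \<Longrightarrow> u \<in> P s \<Longrightarrow> base u = s"
  unfolding base_def using disjoint by (intro the_equality) (auto simp: disjoint_family_on_def)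

lemma edges_iff:
  "{u, v} \<in> edges \<longleftrightarrow> (\<exists>x\<in>S. \<exists>y\<in>S. x \<noteq> y \<and> {x, y} \<in> E \<and> u \<in> P x \<and> v \<in> P y)"
  (is "_ \<longleftrightarrow> ?R u v")
proof
  assume "{u, v} \<in> edges"
  then obtain u' v' where "{u, v} = {u', v'}" "?R u' v'" unfolding edges_def by blast
  then show "?R u v" unfolding doubleton_eq_iff by (metis insert_commute)
qed (auto simp: edges_def)

lemma edges_subset: "edges \<subseteq> nsets V 2"
proof
  fix a assume "a \<in> edges"
  then obtain u v x y where a: "a = {u, v}" and uv: "x \<in> S" "y \<in> S" "x \<noteq> y" "u \<in> P x" "v \<in> P y"
    unfolding edges_def by blast
  then have "u \<noteq> v" using base_eq by metis
  then show "a \<in> nsets V 2" using a uv parts by auto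
qed

text \<open>Outside the parts \<open>base\<close> is unspecified. Only one-vertex cliques can lie
  there, see \<open>clique_lifted\<close>, and these contain no \<open>t\<close>-clique when
  \<open>t \<ge> 2\<close>.\<close>

definition lifted :: "'a set \<Rightarrow> bool" where "lifted K \<longleftrightarrow> K \<subseteq> (\<Union>s\<in>S. P s)"

lemma base_in: "lifted K \<Longrightarrow> u \<in> K \<Longrightarrow> base u \<in> S \<and> u \<in> P (base u)"
  unfolding lifted_def using base_eq by fastforce

lemma clique_lifted:
  assumes "K \<in> cliques V edges" "card K \<ge> 2"
  shows "lifted K"
  unfolding lifted_def
proof
  fix u assume u: "u \<in> K"
  have "\<not> K \<subseteq> {u}" using assms(2) card_mono[of "{u}" K] by auto
  then obtain v where "v \<in> K" "v \<noteq> u" by auto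
  then have "{u, v} \<in> edges" using assms(1) u by (auto simp: cliques_def)
  then show "u \<in> (\<Union>s\<in>S. P s)" unfolding edges_iff by blast
qed

lemma clique_edge:
  assumes "K \<in> cliques V edges" "u \<in> K" "v \<in> K" "u \<noteq> v"
  shows "base u \<noteq> base v" "{base u, base v} \<in> E"
proof -
  have "{u, v} \<in> edges" using assms by (auto simp: cliques_def)
  then obtain x y where "x \<in> S" "y \<in> S" "x \<noteq> y" "{x, y} \<in> E" "u \<in> P x" "v \<in> P y"
    unfolding edges_iff by blast
  then show "base u \<noteq> base v" "{base u, base v} \<in> E" using base_eq by metis+
qed

lemma inj_base: "K \<in> cliques V edges \<Longrightarrow> inj_on base K"
  using clique_edge(1) by (meson inj_onI)

lemma base_clique:
  assumes "K \<in> cliques V edges" "lifted K"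
  shows "base ` K \<in> cliques S E"
proof -
  have "{base u, base v} \<in> E" if "u \<in> K" "v \<in> K" "base u \<noteq> base v" for u v
    using clique_edge(2)[OF assms(1) that(1,2)] that(3) by metis
  moreover have "K \<noteq> {}" using assms(1) by (simp add: cliques_def)
  ultimately show ?thesis using base_in[OF assms(2)] by (auto simp: cliques_def)
qed

definition lifts :: "'a set \<Rightarrow> 'a set set" where
  "lifts T = {T' \<in> cliques V edges. lifted T' \<and> base ` T' = T}"

text \<open>The lifts of \<open>T\<close> are the transversals of its parts: every choice of one
  vertex from each part is a clique, and \<open>base\<close> recovers the choice.\<close>

lemma card_lifts:
  assumes T: "T \<in> cliques S E" shows "card (lifts T) = q ^ card T"
proof -
  have TS: "T \<subseteq> S" "T \<noteq> {}" using T by (auto simp: cliques_def)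
  have finT: "finite T" using TS finite_S finite_subset by blast
  have base_f: "base (f s) = s" if "f \<in> PiE T P" "s \<in> T" for f s
    using that TS by (intro base_eq) auto
  have "bij_betw (\<lambda>f. f ` T) (PiE T P) (lifts T)"
  proof (rule bij_betwI')
    fix f g assume fg: "f \<in> PiE T P" "g \<in> PiE T P"
    show "f ` T = g ` T \<longleftrightarrow> f = g"
    proof
      assume eq: "f ` T = g ` T"
      show "f = g"
      proof (rule PiE_ext[OF fg])
        fix s assume s: "s \<in> T"
        then obtain s' where s': "s' \<in> T" "f s = g s'" using eq by blast
        then have "s = s'" using base_f[OF fg(1) s] base_f[OF fg(2) s'(1)] by simp
        then show "f s = g s" using s'(2) by simp
      qed
    qed simp
  next
    fix f assume f: "f \<in> PiE T P"
    have "{f s, f s'} \<in> edges" if "s \<in> T" "s' \<in> T" "f s \<noteq> f s'" for s s'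
    proof -
      have "s \<noteq> s'" using that by auto
      then have "{s, s'} \<in> E" using T that by (auto simp: cliques_def)
      then show ?thesis unfolding edges_iff using f that TS \<open>s \<noteq> s'\<close> by blast
    qed
    moreover have "f ` T \<subseteq> V" using f TS parts(1) by blast
    ultimately have "f ` T \<in> cliques V edges" using TS(2) by (auto simp: cliques_def)
    moreover have "base ` f ` T = T" using base_f[OF f] by force
    moreover have "lifted (f ` T)" using f TS unfolding lifted_def by blast
    ultimately show "f ` T \<in> lifts T" by (simp add: lifts_def)
  next
    fix T' assume "T' \<in> lifts T"
    then have T': "T' \<in> cliques V edges" "lifted T'" "base ` T' = T" by (auto simp: lifts_def)
    define f where "f = restrict (inv_into T' base) T"
    have "f s \<in> P s" if "s \<in> T" for s
    proof -
      have "f s \<in> T'" "base (f s) = s"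
        using that T'(3) by (auto simp: f_def inv_into_into f_inv_into_f)
      then show ?thesis using base_in[OF T'(2)] by metis
    qed
    then have "f \<in> PiE T P" by (auto simp: f_def)
    moreover have "T' = f ` T"
      using T'(3) inj_base[OF T'(1)] by (auto simp: f_def image_image)
    ultimately show "\<exists>f\<in>PiE T P. T' = f ` T" by blast
  qed
  then have "card (lifts T) = card (PiE T P)" by (simp add: bij_betw_same_card)
  also have "\<dots> = (\<Prod>s\<in>T. card (P s))" using finT by (rule card_PiE)
  also have "\<dots> = (\<Prod>s\<in>T. q)" using TS parts(2) by (intro prod.cong) auto
  finally show ?thesis by simp
qed

text \<open>A system \<open>F\<close> of the blow-up is pushed down along \<open>base\<close>: the
  weights of all cliques with the same image are added up and divided by \<open>q ^ t\<close>. The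
  cover weight of \<open>T\<close> becomes the average over its \<open>q ^ t\<close> lifts. Because
  \<open>base\<close> is injective on cliques, sizes are preserved, and so costs are under control
  for an arbitrary sequence \<open>c\<close>.\<close>

lemma frac_value_blow_up:
  assumes Q: "Q \<in> {{1..}, {1}}" and c: "\<forall>i\<ge>1. 0 \<le> c i" and t: "2 \<le> t" and q: "q > 0"
  shows "real q ^ t * frac_value Q t S E c \<le> frac_value Q t V edges c"
proof -
  obtain F where F: "frac_system Q t V edges F" "cost V edges c F = frac_value Q t V edges c"
    using frac_value_attained[OF Q finite_V c, of t edges] t by auto
  have F0: "F K \<ge> 0" if "K \<in> cliques V edges" for K using F(1) that by (simp add: frac_system_def)
  define A where "A = {K \<in> cliques V edges. lifted K}"
  have finA: "finite A" and finS: "finite (cliques S E)"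
    using finite_cliques'[OF finite_V] finite_cliques'[OF finite_S] by (auto simp: A_def)
  define f where "f K = (\<Sum>K' | K' \<in> A \<and> base ` K' = K. F K') / real q ^ t" for K
  have qt: "real q ^ t > 0" using q by simp
  have "frac_system Q t S E f"
    unfolding frac_system_def
  proof (intro conjI ballI)
    fix K assume "K \<in> cliques S E"
    show "f K \<ge> 0"
      unfolding f_def using F0 by (intro divide_nonneg_nonneg sum_nonneg) (auto simp: A_def)
  next
    fix T assume "T \<in> cliques_of_size t S E"
    then have T: "T \<in> cliques S E" "card T = t" by (auto simp: cliques_of_size_def)
    let ?A = "{K' \<in> A. T \<subseteq> base ` K'}" and ?r = "\<lambda>K'. {u \<in> K'. base u \<in> T}"
    have "cover_weight S E f T = (\<Sum>K | K \<in> cliques S E \<and> T \<subseteq> K. \<Sum>K' | K' \<in> ?A \<and> base ` K' =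
        K. F K') / real q ^ t"
      unfolding cover_weight_def f_def sum_divide_distrib
        by (intro sum.cong refl arg_cong2[where f = "(/)"]) auto
    also have "(\<Sum>K | K \<in> cliques S E \<and> T \<subseteq> K. \<Sum>K' | K' \<in> ?A \<and> base ` K' = K. F K') = (\<Sum>K'\<in>?A. F K')"
    proof (rule sum.group)
      show "finite ?A" using finA by simp
      show "finite {K. K \<in> cliques S E \<and> T \<subseteq> K}" using finS by simp
    qed (use base_clique in \<open>auto simp: A_def\<close>)
    \<comment> \<open>A clique whose image contains \<open>T\<close> contains exactly one lift of
      \<open>T\<close>, namely its vertices over \<open>T\<close>. Grouping by this lift counts
      every clique once.\<close>
    also have "\<dots> = (\<Sum>T'\<in>lifts T. \<Sum>K' | K' \<in> ?A \<and> ?r K' = T'. F K')"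
    proof (rule sum.group[symmetric])
      show "finite ?A" using finA by simp
      show "finite (lifts T)" using finite_cliques'[OF finite_V] by (simp add: lifts_def)
      show "?r ` ?A \<subseteq> lifts T"
      proof clarify
        fix K' assume K': "K' \<in> A" "T \<subseteq> base ` K'"
        then have "base ` ?r K' = T" by auto
        moreover have "T \<noteq> {}" using T(1) by (auto simp: cliques_def)
        ultimately have nonempty: "?r K' \<noteq> {}" by blast
        have "K' \<in> cliques V edges" using K'(1) by (simp add: A_def)
        then have "?r K' \<in> cliques V edges" by (rule subset_clique[OF _ _ nonempty]) blast
        moreover have "lifted (?r K')" using K' by (auto simp: A_def lifted_def)
        ultimately show "?r K' \<in> lifts T" using \<open>base ` ?r K' = T\<close> by (simp add: lifts_def)
      qed
    qed
    also have "\<dots> = (\<Sum>T'\<in>lifts T. cover_weight V edges F T')"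
      unfolding cover_weight_def
    proof (intro sum.cong refl)
      fix T' assume "T' \<in> lifts T"
      then have T': "T' \<in> cliques V edges" "lifted T'" "base ` T' = T" by (auto simp: lifts_def)
      have cT': "card T' = t" using T T' card_image[OF inj_base[OF T'(1)]] by simp
      have sub: "T' \<subseteq> K'" if "?r K' = T'" for K' using that by blast
      have ext: "K' \<in> ?A \<and> ?r K' = T'" if K': "K' \<in> cliques V edges" "T' \<subseteq> K'" for K'
      proof -
        have "card K' \<ge> 2"
          using cT' t card_mono[OF clique_finite[OF finite_V K'(1)] K'(2)] by simp
        then have "lifted K'" using K'(1) by (rule clique_lifted[rotated])
        moreover have "?r K' = T'"
        proof (intro equalityI subsetI)
          fix u assume u: "u \<in> ?r K'"
          then obtain u' where "u' \<in> T'" "base u = base u'" using T'(3) by auto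
          then show "u \<in> T'" using u K' inj_onD[OF inj_base[OF K'(1)], of u u'] by auto
        qed (use T' K' in auto)
        ultimately show ?thesis using K' T'(3) by (auto simp: A_def)
      qed
      show "{K'. K' \<in> ?A \<and> ?r K' = T'} = {K \<in> cliques V edges. T' \<subseteq> K}"
      proof (intro equalityI subsetI CollectI)
        fix K' assume "K' \<in> {K'. K' \<in> ?A \<and> ?r K' = T'}"
        then show "K' \<in> cliques V edges \<and> T' \<subseteq> K'" using sub by (simp add: A_def)
      next
        fix K' assume "K' \<in> {K \<in> cliques V edges. T' \<subseteq> K}"
        then show "K' \<in> ?A \<and> ?r K' = T'" using ext by simp
      qed
    qed
    also have "\<dots> / real q ^ t \<in> Q"
    proof -
      have card: "real (card (lifts T)) = real q ^ t" using card_lifts[OF T(1)] T(2) by simp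
      show ?thesis unfolding card[symmetric]
      proof (rule average_in_target[OF Q])
        fix T' assume "T' \<in> lifts T"
        then have T': "T' \<in> cliques V edges" "base ` T' = T" by (auto simp: lifts_def)
        then have "T' \<in> cliques_of_size t V edges"
          using T card_image[OF inj_base[OF T'(1)]] by (simp add: cliques_of_size_def)
        then show "cover_weight V edges F T' \<in> Q" using F(1) by (simp add: frac_system_def)
      qed (use card qt in linarith)
    qed
    finally show "cover_weight S E f T \<in> Q" .
  qed
  then have "frac_value Q t S E c \<le> cost S E c f" using finite_S c by (intro frac_value_le)
  also have "\<dots> = (\<Sum>K\<in>cliques S E. \<Sum>K' | K' \<in> A \<and> base ` K' = K. c (card K') * F K') / real q ^ t"
    unfolding cost_def f_def sum_divide_distrib sum_distrib_left times_divide_eq_right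
    by (intro sum.cong refl) (auto simp: A_def card_image inj_base)
  also have "(\<Sum>K\<in>cliques S E. \<Sum>K' | K' \<in> A \<and> base ` K' = K. c (card K') * F K') =
      (\<Sum>K'\<in>A. c (card K') * F K')"
    using finA finS base_clique by (intro sum.group) (auto simp: A_def)
  also have "\<dots> / real q ^ t \<le> cost V edges c F / real q ^ t"
    unfolding cost_def using finite_cliques'[OF finite_V] F0 c clique_card_ge_one[OF finite_V]
    by (intro divide_right_mono sum_mono2) (auto simp: A_def)
  finally show ?thesis using F(2) qt by (simp add: le_divide_eq mult.commute)
qed

end

section \<open>Averages over induced subgraphs\<close>

definition mean :: "'a set \<Rightarrow> nat \<Rightarrow> ('a set \<Rightarrow> real) \<Rightarrow> real" where
  "mean V m X = (\<Sum>S\<in>nsets V m. X S) / (card V choose m)"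

lemma mean_mono:
  assumes "\<And>S. S \<in> nsets V m \<Longrightarrow> X S \<le> Y S" shows "mean V m X \<le> mean V m Y"
  unfolding mean_def using assms by (intro divide_right_mono sum_mono) auto

lemma mean_const: "finite V \<Longrightarrow> m \<le> card V \<Longrightarrow> mean V m (\<lambda>_. a) = a"
  by (simp add: mean_def card_nsets_eq)

lemma mean_add: "mean V m (\<lambda>S. X S + Y S) = mean V m X + mean V m Y"
  by (simp add: mean_def sum.distrib add_divide_distrib)

lemma mean_diff: "mean V m (\<lambda>S. X S - Y S) = mean V m X - mean V m Y"
  by (simp add: mean_def sum_subtractf diff_divide_distrib)

lemma ex_le_mean:
  assumes "finite V" "m \<le> card V" shows "\<exists>S\<in>nsets V m. X S \<le> mean V m X"
proof (rule ccontr)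
  assume "\<not> ?thesis"
  then have less: "X S > mean V m X" if "S \<in> nsets V m" for S using that by (meson not_le)
  have card: "card (nsets V m) = (card V choose m)" "(card V choose m) > 0"
    using assms by (simp_all add: card_nsets_eq)
  have "(\<Sum>S\<in>nsets V m. mean V m X) < (\<Sum>S\<in>nsets V m. X S)"
  proof (rule sum_strict_mono)
    show "finite (nsets V m)" using assms(1) by (rule finite_imp_finite_nsets)
    show "nsets V m \<noteq> {}" using card by (metis card.empty less_irrefl)
  qed (rule less)
  then show False using card by (simp add: mean_def)
qed

section \<open>Nested samples and their variance\<close>

lemma sum_nsets_nested:
  fixes X :: "'a set \<Rightarrow> real"
  assumes "finite V" "m \<le> M"
  shows "(\<Sum>S'\<in>nsets V M. \<Sum>S\<in>nsets S' m. X S) = (\<Sum>S\<in>nsets V m. ((card V - m) choose (M - m)) * X S)"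
proof -
  have "(\<Sum>S'\<in>nsets V M. \<Sum>S\<in>nsets S' m. X S) = (\<Sum>S'\<in>nsets V M. \<Sum>S | S \<in> nsets V m \<and> S \<subseteq> S'. X S)"
    by (intro sum.cong refl) (auto simp: nsets_def)
  also have "\<dots> = (\<Sum>S\<in>nsets V m. \<Sum>S' | S' \<in> nsets V M \<and> S \<subseteq> S'. X S)"
    using assms(1) by (intro sum.swap_restrict finite_imp_finite_nsets)
  also have "\<dots> = (\<Sum>S\<in>nsets V m. ((card V - m) choose (M - m)) * X S)"
  proof (intro sum.cong refl)
    fix S assume "S \<in> nsets V m"
    then have "S \<subseteq> V" "card S = m" by (auto simp: nsets_def)
    then show "(\<Sum>S' | S' \<in> nsets V M \<and> S \<subseteq> S'. X S) = ((card V - m) choose (M - m)) * X S"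
      using card_nsets_superset[OF assms(1), of S M] assms(2) by simp
  qed
  finally show ?thesis .
qed

text \<open>A uniform \<open>m\<close>-subset of a uniform \<open>M\<close>-subset of
  \<open>V\<close> is a uniform \<open>m\<close>-subset of \<open>V\<close>.\<close>

lemma mean_mean:
  assumes "finite V" "m \<le> M" "M \<le> card V"
  shows "mean V M (\<lambda>S'. mean S' m X) = mean V m X"
proof -
  have "mean V M (\<lambda>S'. mean S' m X) = (\<Sum>S'\<in>nsets V M. (\<Sum>S\<in>nsets S' m. X S) / (M choose m)) /
      (card V choose M)"
    unfolding mean_def by (intro arg_cong2[where f = "(/)"] sum.cong refl) (auto simp: nsets_def)
  also have "\<dots> = ((card V - m) choose (M - m)) * (\<Sum>S\<in>nsets V m. X S) / ((card V choose M) *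
      (M choose m))"
    by (simp add: sum_nsets_nested[OF assms(1,2)] flip: sum_divide_distrib sum_distrib_left)
  also have "real ((card V choose M) * (M choose m)) = real ((card V choose m) * ((card V -
      m) choose (M - m)))"
    using choose_mult[OF assms(2,3)] by simp
  also have "((card V - m) choose (M - m)) * (\<Sum>S\<in>nsets V m. X S) / \<dots> = mean V m X"
    using assms(2,3) by (simp add: mean_def)
  finally show ?thesis .
qed

text \<open>Expanding the square gives pairs \<open>S1\<close>, \<open>S2\<close> weighted by the
  number of \<open>M\<close>-sets that contain both. All disjoint pairs have the same weight
  \<open>b0\<close>, and a constant weight contributes nothing because \<open>\<phi>\<close> sums to
  0. This leaves the intersecting pairs, of which an \<open>M\<close>-set contains at most
  \<open>M * ((M - 1) choose (m - 1))\<^sup>2\<close>, counted through a common element.\<close>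

lemma sum_square_nested_le:
  fixes \<phi> :: "'a set \<Rightarrow> real"
  assumes V: "finite V" and m: "1 \<le> m" "2 * m \<le> M" "M \<le> card V"
    and \<phi>: "\<And>S. S \<in> nsets V m \<Longrightarrow> \<bar>\<phi> S\<bar> \<le> C" "(\<Sum>S\<in>nsets V m. \<phi> S) = 0"
  shows "(\<Sum>S'\<in>nsets V M. (\<Sum>S\<in>nsets S' m. \<phi> S)\<^sup>2) \<le>
     C\<^sup>2 * (card (nsets V M) * (M * (real ((M - 1) choose (m - 1)))\<^sup>2))"
proof -
  let ?N = "nsets V m" and ?b = "\<lambda>U. real (card {S' \<in> nsets V M. U \<subseteq> S'})"
  define b0 where "b0 = real ((card V - 2 * m) choose (M - 2 * m))"
  have finN: "finite ?N" "finite (nsets V M)" using V by (auto intro: finite_imp_finite_nsets)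
  have inner: "(\<Sum>S\<in>nsets S' m. f S) = (\<Sum>S\<in>?N. of_bool (S \<subseteq> S') * f S)"
    if "S' \<in> nsets V M" for S' and f :: "'a set \<Rightarrow> real"
  proof -
    have "nsets S' m \<subseteq> ?N" using that by (auto simp: nsets_def)
    moreover have "S \<in> nsets S' m" if "S \<in> ?N" "S \<subseteq> S'" for S using that by (auto simp: nsets_def)
    moreover have "S \<subseteq> S'" if "S \<in> nsets S' m" for S using that by (auto simp: nsets_def)
    ultimately show ?thesis using finN by (intro sum.mono_neutral_cong_left) auto
  qed
  have pairs: "(\<Sum>S'\<in>nsets V M. \<Sum>S1\<in>?N. \<Sum>S2\<in>?N. of_bool (S1 \<union> S2 \<subseteq> S') * h S1 S2) =
      (\<Sum>S1\<in>?N. \<Sum>S2\<in>?N. ?b (S1 \<union> S2) * h S1 S2)" for h :: "'a set \<Rightarrow> 'a set \<Rightarrow> real"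
  proof -
    have "(\<Sum>S'\<in>nsets V M. of_bool (U \<subseteq> S')) = ?b U" for U
      using finN by (simp add: of_bool_def sum.If_cases Int_def)
    then have "(\<Sum>S1\<in>?N. \<Sum>S2\<in>?N. ?b (S1 \<union> S2) * h S1 S2) =
       (\<Sum>S1\<in>?N. \<Sum>S2\<in>?N. \<Sum>S'\<in>nsets V M. of_bool (S1 \<union> S2 \<subseteq> S') * h S1 S2)"
      by (simp only: flip: sum_distrib_right)
    also have "\<dots> = (\<Sum>S1\<in>?N. \<Sum>S'\<in>nsets V M. \<Sum>S2\<in>?N. of_bool (S1 \<union> S2 \<subseteq> S') * h S1 S2)"
      by (intro sum.cong refl sum.swap)
    also have "\<dots> = (\<Sum>S'\<in>nsets V M. \<Sum>S1\<in>?N. \<Sum>S2\<in>?N. of_bool (S1 \<union> S2 \<subseteq> S') * h S1 S2)"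
      by (rule sum.swap)
    finally show ?thesis by simp
  qed
  have "(\<Sum>S'\<in>nsets V M. (\<Sum>S\<in>nsets S' m. \<phi> S)\<^sup>2) =
      (\<Sum>S'\<in>nsets V M. \<Sum>S1\<in>?N. \<Sum>S2\<in>?N. of_bool (S1 \<union> S2 \<subseteq> S') * (\<phi> S1 * \<phi> S2))"
  proof (intro sum.cong refl)
    fix S' assume "S' \<in> nsets V M"
    from inner[OF this, of \<phi>] show "(\<Sum>S\<in>nsets S' m. \<phi> S)\<^sup>2 = (\<Sum>S1\<in>?N. \<Sum>S2\<in>?N. of_bool (S1 \<union> S2 \<subseteq>
        S') * (\<phi> S1 * \<phi> S2))"
      by (simp only: power2_eq_square sum_product) (intro sum.cong refl, auto)
  qed
  also have "\<dots> = (\<Sum>S1\<in>?N. \<Sum>S2\<in>?N. ?b (S1 \<union> S2) * (\<phi> S1 * \<phi> S2))" by (rule pairs)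
  also have "\<dots> = (\<Sum>S1\<in>?N. \<Sum>S2\<in>?N. (?b (S1 \<union> S2) - b0) * (\<phi> S1 * \<phi> S2))"
  proof -
    have "(\<Sum>S1\<in>?N. \<Sum>S2\<in>?N. b0 * (\<phi> S1 * \<phi> S2)) = b0 * ((\<Sum>S\<in>?N. \<phi> S) * (\<Sum>S\<in>?N. \<phi> S))"
      unfolding sum_product by (simp add: sum_distrib_left)
    then show ?thesis using \<phi>(2) by (simp add: left_diff_distrib sum_subtractf)
  qed
  also have "\<dots> \<le> (\<Sum>S1\<in>?N. \<Sum>S2\<in>?N. ?b (S1 \<union> S2) * (C\<^sup>2 * of_bool (S1 \<inter> S2 \<noteq> {})))"
  proof (intro sum_mono)
    fix S1 S2 assume S: "S1 \<in> ?N" "S2 \<in> ?N"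
    then have S': "S1 \<subseteq> V" "S2 \<subseteq> V" "finite S1" "finite S2" "card S1 = m" "card S2 = m"
      by (auto simp: nsets_def)
    show "(?b (S1 \<union> S2) - b0) * (\<phi> S1 * \<phi> S2) \<le> ?b (S1 \<union> S2) * (C\<^sup>2 * of_bool (S1 \<inter> S2 \<noteq> {}))"
    proof (cases "S1 \<inter> S2 = {}")
      case True
      then have "card (S1 \<union> S2) = 2 * m" using S' by (simp add: card_Un_disjoint)
      then have "?b (S1 \<union> S2) = b0"
        using card_nsets_superset[OF V, of "S1 \<union> S2" M] S' m by (simp add: b0_def)
      then show ?thesis using True by simp
    next
      case False
      have "card (S1 \<union> S2) \<le> 2 * m" using card_Un_le[of S1 S2] S' by simp
      \<comment> \<open>Enlarging the union to \<open>2 * m\<close> vertices shows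
        \<open>b0 \<le> ?b (S1 \<union> S2)\<close>. So the corrected weight is nonnegative, and the
        bound on \<open>\<phi> S1 * \<phi> S2\<close> may be inserted.\<close>
      then obtain U where U: "S1 \<union> S2 \<subseteq> U" "U \<subseteq> V" "card U = 2 * m"
        using exists_subset_between[of "S1 \<union> S2" "2 * m" V] S' V m by auto
      have "b0 = ?b U" using card_nsets_superset[OF V U(2), of M] U(3) m by (simp add: b0_def)
      also have "\<dots> \<le> ?b (S1 \<union> S2)" using finN U(1) by (intro of_nat_mono card_mono) auto
      finally have b: "0 \<le> ?b (S1 \<union> S2) - b0" "?b (S1 \<union> S2) - b0 \<le> ?b (S1 \<union> S2)"
        by (auto simp: b0_def)
      have "\<phi> S1 * \<phi> S2 \<le> \<bar>\<phi> S1\<bar> * \<bar>\<phi> S2\<bar>" by (metis abs_ge_self abs_mult)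
      also have "\<dots> \<le> C * C" using \<phi>(1)[OF S(1)] \<phi>(1)[OF S(2)] by (intro mult_mono) auto
      finally have "\<phi> S1 * \<phi> S2 \<le> C\<^sup>2" by (simp add: power2_eq_square)
      then have "(?b (S1 \<union> S2) - b0) * (\<phi> S1 * \<phi> S2) \<le> (?b (S1 \<union> S2) - b0) * C\<^sup>2"
        using b by (intro mult_left_mono)
      also have "\<dots> \<le> ?b (S1 \<union> S2) * C\<^sup>2" using b by (intro mult_right_mono) auto
      finally show ?thesis using False by simp
    qed
  qed
  also have "\<dots> = (\<Sum>S'\<in>nsets V M. \<Sum>S1\<in>?N. \<Sum>S2\<in>?N. of_bool (S1 \<union> S2 \<subseteq> S') * (C\<^sup>2 *
      of_bool (S1 \<inter> S2 \<noteq> {})))"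
    by (rule pairs[symmetric])
  also have "\<dots> \<le> (\<Sum>S'\<in>nsets V M. C\<^sup>2 * (M * (real ((M - 1) choose (m - 1)))\<^sup>2))"
  proof (rule sum_mono)
    fix S' assume S': "S' \<in> nsets V M"
    then have fin: "finite S'" "card S' = M" by (auto simp: nsets_def)
    have "(\<Sum>S1\<in>?N. \<Sum>S2\<in>?N. of_bool (S1 \<union> S2 \<subseteq> S') * (C\<^sup>2 * of_bool (S1 \<inter> S2 \<noteq> {}))) \<le>
       (\<Sum>S1\<in>?N. \<Sum>S2\<in>?N. C\<^sup>2 * (\<Sum>x\<in>S'. (of_bool (S1 \<subseteq> S') * of_bool (x \<in> S1)) * (of_bool (S2 \<subseteq> S') *
           of_bool (x \<in> S2))))"
    proof (intro sum_mono)
      fix S1 S2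
      let ?s = "\<lambda>x. (of_bool (S1 \<subseteq> S') * of_bool (x \<in> S1)) * (of_bool (S2 \<subseteq> S') *
          of_bool (x \<in> S2)) :: real"
      have "of_bool (S1 \<union> S2 \<subseteq> S' \<and> S1 \<inter> S2 \<noteq> {}) \<le> (\<Sum>x\<in>S'. ?s x)"
      proof (cases "S1 \<union> S2 \<subseteq> S' \<and> S1 \<inter> S2 \<noteq> {}")
        case True
        then obtain x where x: "x \<in> S1" "x \<in> S2" "x \<in> S'" by blast
        have "of_bool (S1 \<union> S2 \<subseteq> S' \<and> S1 \<inter> S2 \<noteq> {}) = ?s x" using True x by auto
        also have "\<dots> \<le> (\<Sum>x\<in>S'. ?s x)" using x fin by (intro member_le_sum) auto
        finally show ?thesis .
      next
        case False
        then show ?thesis by (simp only: of_bool_eq) (intro sum_nonneg, simp)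
      qed
      then have "C\<^sup>2 * of_bool (S1 \<union> S2 \<subseteq> S' \<and> S1 \<inter> S2 \<noteq> {}) \<le> C\<^sup>2 * (\<Sum>x\<in>S'. ?s x)"
        by (intro mult_left_mono) auto
      then show "of_bool (S1 \<union> S2 \<subseteq> S') * (C\<^sup>2 * of_bool (S1 \<inter> S2 \<noteq> {})) \<le> C\<^sup>2 * (\<Sum>x\<in>S'. ?s x)"
        by (simp only: of_bool_conj mult_ac)
    qed
    also have "\<dots> = C\<^sup>2 * (\<Sum>x\<in>S'. (\<Sum>S\<in>?N. of_bool (S \<subseteq> S') * of_bool (x \<in> S))\<^sup>2)"
    proof -
      have "(\<Sum>S1\<in>?N. \<Sum>S2\<in>?N. \<Sum>x\<in>S'. g x S1 * g x S2) = (\<Sum>x\<in>S'. (\<Sum>S\<in>?N. g x S)\<^sup>2)"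
        for g :: "'a \<Rightarrow> 'a set \<Rightarrow> real"
      proof -
        have "(\<Sum>S1\<in>?N. \<Sum>S2\<in>?N. \<Sum>x\<in>S'. g x S1 * g x S2) = (\<Sum>S1\<in>?N. \<Sum>x\<in>S'. \<Sum>S2\<in>?N. g x S1 * g x S2)"
          by (intro sum.cong refl sum.swap)
        also have "\<dots> = (\<Sum>x\<in>S'. \<Sum>S1\<in>?N. \<Sum>S2\<in>?N. g x S1 * g x S2)" by (rule sum.swap)
        finally show ?thesis by (simp only: power2_eq_square sum_product)
      qed
      then show ?thesis by (simp only: flip: sum_distrib_left)
    qed
    also have "(\<Sum>x\<in>S'. (\<Sum>S\<in>?N. of_bool (S \<subseteq> S') * of_bool (x \<in> S))\<^sup>2) =
      (\<Sum>x\<in>S'. (real ((M - 1) choose (m - 1)))\<^sup>2)"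
    proof (intro sum.cong refl)
      fix x assume x: "x \<in> S'"
      have "(\<Sum>S\<in>?N. of_bool (S \<subseteq> S') * of_bool (x \<in> S)) = (\<Sum>S\<in>nsets S' m. of_bool (x \<in> S) :: real)"
        using inner[OF S', of "\<lambda>S. of_bool (x \<in> S)"] by simp
      also have "\<dots> = card {S \<in> nsets S' m. {x} \<subseteq> S}"
        using finite_imp_finite_nsets[OF fin(1)] by (simp add: of_bool_def sum.If_cases Int_def)
      also have "\<dots> = (M - 1) choose (m - 1)"
        using card_nsets_superset[OF fin(1), of "{x}" m] x fin(2) m by simp
      finally show "(\<Sum>S\<in>?N. of_bool (S \<subseteq> S') * of_bool (x \<in> S))\<^sup>2 = (real ((M - 1) choose (m -
          1)))\<^sup>2"
        by simp
    qed
    finally show "(\<Sum>S1\<in>?N. \<Sum>S2\<in>?N. of_bool (S1 \<union> S2 \<subseteq> S') * (C\<^sup>2 * of_bool (S1 \<inter> S2 \<noteq> {}))) \<le>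
        C\<^sup>2 * (M * (real ((M - 1) choose (m - 1)))\<^sup>2)" using fin by simp
  qed
  finally show ?thesis by (simp add: mult_ac)
qed

text \<open>Two independent random \<open>m\<close>-subsets of an \<open>M\<close>-set meet with
  probability at most \<open>(real m)\<^sup>2 / M\<close>, and only meeting pairs contribute to the
  variance.\<close>

lemma mean_variance:
  fixes X :: "'a set \<Rightarrow> real"
  assumes V: "finite V" and m: "1 \<le> m" "2 * m \<le> M" "M \<le> card V"
    and X: "\<And>S. S \<in> nsets V m \<Longrightarrow> 0 \<le> X S \<and> X S \<le> C"
  shows "mean V M (\<lambda>S'. (mean S' m X - mean V m X)\<^sup>2) \<le> C\<^sup>2 * ((real m)\<^sup>2 / M)"
proof -
  define \<phi> where "\<phi> S = X S - mean V m X" for S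
  have mM: "m \<le> M" "m \<le> card V" using m by auto
  have "mean V m (\<lambda>_. 0) \<le> mean V m X" "mean V m X \<le> mean V m (\<lambda>_. C)"
    using X by (auto intro!: mean_mono)
  then have \<mu>: "0 \<le> mean V m X" "mean V m X \<le> C" using mean_const[OF V mM(2)] by auto
  have \<phi>C: "\<bar>\<phi> S\<bar> \<le> C" if "S \<in> nsets V m" for S
    using X[OF that] \<mu> by (auto simp: \<phi>_def)
  have "mean V m \<phi> = 0" unfolding \<phi>_def mean_diff mean_const[OF V mM(2)] by simp
  then have \<phi>0: "(\<Sum>S\<in>nsets V m. \<phi> S) = 0" using mM by (simp add: mean_def)
  have b: "real (M choose m) > 0" "real (card V choose M) > 0" using m mM by simp_all
  have "mean S' m X - mean V m X = (\<Sum>S\<in>nsets S' m. \<phi> S) / (M choose m)" if "S' \<in> nsets V M" for S'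
  proof -
    have S': "finite S'" "card S' = M" using that by (auto simp: nsets_def)
    then have "mean S' m \<phi> = mean S' m X - mean V m X"
      unfolding \<phi>_def mean_diff using mean_const[of S' m] mM by simp
    then show ?thesis using S' by (simp add: mean_def)
  qed
  then have "mean V M (\<lambda>S'. (mean S' m X - mean V m X)\<^sup>2) =
      (\<Sum>S'\<in>nsets V M. ((\<Sum>S\<in>nsets S' m. \<phi> S) / (M choose m))\<^sup>2) / (card V choose M)"
    unfolding mean_def[of V M] by (intro arg_cong2[where f = "(/)"] sum.cong refl) simp_all
  also have "\<dots> = (\<Sum>S'\<in>nsets V M. (\<Sum>S\<in>nsets S' m. \<phi> S)\<^sup>2) / ((real (M choose m))\<^sup>2 *
      (card V choose M))"
    by (simp add: power_divide flip: sum_divide_distrib)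
  also have "\<dots> \<le> C\<^sup>2 * (card (nsets V M) * (M * (real ((M - 1) choose (m - 1)))\<^sup>2)) /
      ((real (M choose m))\<^sup>2 * (card V choose M))"
    using sum_square_nested_le[OF V m, of \<phi> C] \<phi>C \<phi>0 by (intro divide_right_mono) auto
  also have "\<dots> = C\<^sup>2 * (M * (real ((M - 1) choose (m - 1)))\<^sup>2 / (real (M choose m))\<^sup>2)"
    using b by (simp add: card_nsets_eq[OF V])
  also have "M * (real ((M - 1) choose (m - 1)))\<^sup>2 / (real (M choose m))\<^sup>2 = (real m)\<^sup>2 / M"
  proof -
    have M: "real M > 0" using m by simp
    have "m * (M choose m) = M * ((M - 1) choose (m - 1))"
      using m by (intro times_binomial_minus1_eq) auto
    then have "real m * real (M choose m) = real M * real ((M - 1) choose (m - 1))"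
      by (metis of_nat_mult)
    then have eq: "real ((M - 1) choose (m - 1)) = real m * real (M choose m) / real M"
      using M by (simp add: field_simps)
    show ?thesis unfolding eq using M b by (simp add: field_simps power2_eq_square)
  qed
  finally show ?thesis .
qed

text \<open>The denominator counts all \<open>t\<close>-sets, cliques or not. This makes samples of
  equal size comparable and keeps the value between 0 and \<open>c t\<close> when
  \<open>t \<le> card S\<close>.\<close>

definition clique_density :: "real set \<Rightarrow> nat \<Rightarrow> (nat \<Rightarrow> real) \<Rightarrow> 'a set set \<Rightarrow> 'a set \<Rightarrow> real" where
  "clique_density Q t c E S = frac_value Q t S E c / (card S choose t)"

lemma density_bounds:
  assumes "Q \<in> {{1..}, {1}}" "finite S" "\<forall>i\<ge>1. 0 \<le> c i" "1 \<le> t" "t \<le> card S"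
  shows "0 \<le> clique_density Q t c E S" "clique_density Q t c E S \<le> c t"
  using frac_value_nonneg[OF assms(1-4)] frac_value_le_choose[OF assms(1-4)] assms(5)
  by (auto simp: clique_density_def divide_le_eq)

lemma mean_density_bounds:
  assumes Q: "Q \<in> {{1..}, {1}}" and V: "finite V" and c: "\<forall>i\<ge>1. 0 \<le> c i"
    and t: "1 \<le> t" "t \<le> m" "m \<le> card V"
  shows "0 \<le> mean V m (clique_density Q t c E)" "mean V m (clique_density Q t c E) \<le> c t"
proof -
  have "0 \<le> clique_density Q t c E S \<and> clique_density Q t c E S \<le> c t" if "S \<in> nsets V m" for S
    using density_bounds[OF Q _ c t(1)] that t(2) by (auto simp: nsets_def)
  then have "mean V m (\<lambda>_. 0) \<le> mean V m (clique_density Q t c E)"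
    "mean V m (clique_density Q t c E) \<le> mean V m (\<lambda>_. c t)"
    by (auto intro!: mean_mono)
  then show "0 \<le> mean V m (clique_density Q t c E)" "mean V m (clique_density Q t c E) \<le> c t"
    using mean_const[OF V t(3)] by auto
qed

lemma density_le_mean:
  assumes Q: "Q \<in> {{1..}, {1}}" and W: "finite W" and c: "\<forall>i\<ge>1. 0 \<le> c i"
    and t: "1 \<le> t" "t \<le> m" "m \<le> card W"
  shows "clique_density Q t c E W \<le> mean W m (clique_density Q t c E)"
proof -
  let ?N = "card W"
  have b: "real ((?N - t) choose (m - t)) > 0" "real (?N choose t) > 0" "real (m choose t) > 0"
      "real (?N choose m) > 0"
    using t by simp_all
  have mult: "real (?N choose m) * real (m choose t) = real (?N choose t) * real ((?N -
      t) choose (m - t))"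
    using choose_mult[OF t(2,3)] by (metis of_nat_mult)
  have "mean W m (clique_density Q t c E) = (\<Sum>S\<in>nsets W m. frac_value Q t S E c / (m choose t)) /
      (?N choose m)"
    unfolding mean_def clique_density_def
      by (intro arg_cong2[where f = "(/)"] sum.cong refl) (auto simp: nsets_def)
  also have "\<dots> = (\<Sum>S\<in>nsets W m. frac_value Q t S E c) / (real (?N choose m) * real (m choose t))"
    by (simp add: mult.commute flip: sum_divide_distrib)
  also have "\<dots> \<ge> (real ((?N - t) choose (m - t)) * frac_value Q t W E c) / (real (?N choose m) *
      real (m choose t))"
    using frac_value_averaging[OF Q W c t, of E] by (intro divide_right_mono) auto
  also have "(real ((?N - t) choose (m - t)) * frac_value Q t W E c) / (real (?N choose m) *
      real (m choose t)) = clique_density Q t c E W"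
    unfolding mult clique_density_def using b by simp
  finally show ?thesis .
qed

lemma mean_density_decreasing:
  assumes Q: "Q \<in> {{1..}, {1}}" and V: "finite V" and c: "\<forall>i\<ge>1. 0 \<le> c i"
    and t: "1 \<le> t" "t \<le> m" "m \<le> M" "M \<le> card V"
  shows "mean V M (clique_density Q t c E) \<le> mean V m (clique_density Q t c E)"
proof -
  have "mean V M (clique_density Q t c E) \<le> mean V M (\<lambda>S'. mean S' m (clique_density Q t c E))"
    using t by (intro mean_mono density_le_mean[OF Q _ c]) (auto simp: nsets_def)
  then show ?thesis using mean_mean[OF V t(3,4)] by simp
qed

text \<open>Densities at scale \<open>M\<close> need not be concentrated by themselves, since \<open>c\<close> is not
  assumed to be monotone; but they lie below the averages of densities at scale \<open>m\<close>, which are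
  concentrated, and by no more than \<open>\<eta>\<close> in the mean.\<close>

lemma good_sample:
  fixes \<eta> :: real
  assumes V: "finite V" and c: "\<forall>i\<ge>1. 0 \<le> c i"
    and t: "1 \<le> t" "t \<le> m" "2 * m \<le> M" "M \<le> card V"
    and gap: "\<And>Q. Q \<in> {{1..}, {1}} \<Longrightarrow> mean V m (clique_density Q t c E) -
        mean V M (clique_density Q t c E) \<le> \<eta>"
    and var: "(c t)\<^sup>2 * ((real m)\<^sup>2 / M) \<le> \<eta>"
  obtains S where "S \<in> nsets V M"
    "\<And>Q. Q \<in> {{1..}, {1}} \<Longrightarrow> clique_density Q t c E S \<ge> mean V m (clique_density Q t c E) -
        sqrt (4 * \<eta>) - 4 * \<eta>"
proof -
  let ?d = "\<lambda>Q. clique_density Q t c E"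
  \<comment> \<open>Both summands are nonnegative for \<open>S \<in> nsets V M\<close>, the second
    one because a density is at most the average of the densities of smaller samples. Hence one
    \<open>S\<close> at which \<open>?Z {1..} S + ?Z {1} S\<close> does not exceed its mean controls
    deviation and gap for both parameters at once; each of these four terms has mean at most
    \<open>\<eta>\<close>.\<close>
  let ?Z = "\<lambda>Q S. (mean S m (?d Q) - mean V m (?d Q))\<^sup>2 + (mean S m (?d Q) - ?d Q S)"
  have t1: "t \<le> M" "m \<le> M" using t by auto
  have Z0: "0 \<le> mean S m (?d Q) - ?d Q S" if "S \<in> nsets V M" "Q \<in> {{1..}, {1}}" for Q S
    using density_le_mean[OF that(2) _ c, of S t m E] t t1 that(1) by (auto simp: nsets_def)
  have ZQ: "mean V M (?Z Q) \<le> 2 * \<eta>" if Q: "Q \<in> {{1..}, {1}}" for Q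
  proof -
    have "mean V M (\<lambda>S. (mean S m (?d Q) - mean V m (?d Q))\<^sup>2) \<le> (c t)\<^sup>2 * ((real m)\<^sup>2 / M)"
      using t by (intro mean_variance V) (auto simp: nsets_def intro!: density_bounds[OF Q _ c])
    moreover have "mean V M (\<lambda>S. mean S m (?d Q) - ?d Q S) \<le> \<eta>"
      unfolding mean_diff mean_mean[OF V t1(2) t(4)] using gap[OF Q] .
    ultimately show ?thesis unfolding mean_add using var by linarith
  qed
  obtain S where S: "S \<in> nsets V M" "?Z {1..} S + ?Z {1} S \<le> mean V M (\<lambda>S. ?Z {1..} S + ?Z {1} S)"
    using ex_le_mean[OF V t(4), of "\<lambda>S. ?Z {1..} S + ?Z {1} S"] by blast
  have "mean V M (\<lambda>S. ?Z {1..} S + ?Z {1} S) \<le> 4 * \<eta>"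
    unfolding mean_add[of V M "?Z {1..}" "?Z {1}"] using ZQ[of "{1..}"] ZQ[of "{1}"] by simp
  then have sum: "?Z {1..} S + ?Z {1} S \<le> 4 * \<eta>" using S(2) by linarith
  have "?d Q S \<ge> mean V m (?d Q) - sqrt (4 * \<eta>) - 4 * \<eta>" if Q: "Q \<in> {{1..}, {1}}" for Q
  proof -
    have Z: "?Z Q' S \<ge> 0" if "Q' \<in> {{1..}, {1}}" for Q'
      using Z0[OF S(1) that] by simp
    have le: "?Z Q S \<le> 4 * \<eta>" using Q sum Z[of "{1..}"] Z[of "{1}"] by auto
    then have "(mean S m (?d Q) - mean V m (?d Q))\<^sup>2 \<le> 4 * \<eta>" using Z0[OF S(1) Q] by linarith
    then have "\<bar>mean S m (?d Q) - mean V m (?d Q)\<bar> \<le> sqrt (4 * \<eta>)"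
      by (rule real_le_rsqrt[of "\<bar>_\<bar>", simplified])
    moreover have "mean S m (?d Q) - ?d Q S \<le> 4 * \<eta>"
      using le zero_le_power2[of "mean S m (?d Q) - mean V m (?d Q)"] by linarith
    ultimately show ?thesis by linarith
  qed
  then show thesis using that S(1) by blast
qed

section \<open>Rounding sampled systems\<close>

text \<open>A clique is listed separately for each sample \<open>S\<close> that it comes from.
  Cliques with fewer than \<open>t\<close> vertices contain no \<open>t\<close>-clique and would
  give empty edges.\<close>

definition sample_indices :: "nat \<Rightarrow> nat \<Rightarrow> 'a set \<Rightarrow> 'a set set \<Rightarrow> ('a set \<times> 'a set) set" where
  "sample_indices t m V E = (SIGMA S:nsets V m. {K \<in> cliques S E. t \<le> card K})"

lemma sample_indicesD:
  assumes "finite V" "i \<in> sample_indices t m V E" "1 \<le> t"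
  shows "snd i \<in> cliques V E" "t \<le> card (snd i)" "nsets (snd i) t \<subseteq> cliques_of_size t V E"
    "nsets (snd i) t \<noteq> {}" "card (nsets (snd i) t) \<le> (m choose t)"
proof -
  obtain S K where i: "i = (S, K)" "S \<subseteq> V" "finite S" "card S = m" "K \<in> cliques S E" "t \<le> card K"
    using assms(2) by (auto simp: sample_indices_def nsets_def)
  have K: "K \<subseteq> S" "finite K" using i(5) clique_finite[OF i(3,5)] by (simp_all add: cliques_def)
  show KV: "snd i \<in> cliques V E" using i by (auto simp: cliques_def)
  show "t \<le> card (snd i)" using i by simp
  show "nsets (snd i) t \<subseteq> cliques_of_size t V E"
  proof
    fix T assume "T \<in> nsets (snd i) t"
    then have "T \<subseteq> snd i" "card T = t" "T \<noteq> {}" using assms(3) by (auto simp: nsets_def)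
    then show "T \<in> cliques_of_size t V E"
      using subset_clique[OF KV] by (simp add: cliques_of_size_def)
  qed
  have "card (nsets K t) = (card K choose t)" using K by (simp add: card_nsets_eq)
  moreover have "(card K choose t) > 0" using i by simp
  moreover have "(card K choose t) \<le> (m choose t)"
    using binomial_right_mono[OF card_mono[OF i(3) K(1)]] i(4) by simp
  ultimately show "card (nsets (snd i) t) \<le> (m choose t)" using i(1) by simp
  have "card (nsets K t) > 0" using \<open>card (nsets K t) = _\<close> \<open>(card K choose t) > 0\<close> by simp
  then show "nsets (snd i) t \<noteq> {}" using i(1) by (metis card.empty less_irrefl snd_conv)
qed

lemma finite_sample_indices: "finite V \<Longrightarrow> finite (sample_indices t m V E)"
  unfolding sample_indices_def
  by (intro finite_SigmaI finite_imp_finite_nsets) (auto simp: nsets_def finite_cliques')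

lemma sum_sample_indices:
  fixes h :: "'a set \<Rightarrow> 'a set \<Rightarrow> real"
  assumes "finite V"
  shows "(\<Sum>i | i \<in> sample_indices t m V E \<and> P i. h (fst i) (snd i)) =
    (\<Sum>S\<in>nsets V m. \<Sum>K | K \<in> cliques S E \<and> t \<le> card K \<and> P (S, K). h S K)"
proof -
  have "{i. i \<in> sample_indices t m V E \<and> P i} =
      (SIGMA S:nsets V m. {K. K \<in> cliques S E \<and> t \<le> card K \<and> P (S, K)})"
    by (auto simp: sample_indices_def)
  moreover have "\<forall>S\<in>nsets V m. finite {K. K \<in> cliques S E \<and> t \<le> card K \<and> P (S, K)}"
    by (auto simp: nsets_def finite_cliques')
  ultimately show ?thesis
    using finite_imp_finite_nsets[OF assms] by (simp add: sum.Sigma case_prod_unfold)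
qed

text \<open>The codegree bound is the point. Two different \<open>t\<close>-cliques in a common
  sample force one further vertex into it, and only a fraction \<open>(m - t) / (card V - t)\<close>
  of the samples that contain the first clique contain this vertex. Within a sample the weight of
  the cliques with at least \<open>t\<close> vertices is at most their cost, because
  \<open>c i \<ge> 1\<close> for \<open>i \<ge> t\<close>, and an optimal system of the sample costs
  at most \<open>c t * (m choose t)\<close>.\<close>

lemma sampled_fractional_system:
  fixes c :: "nat \<Rightarrow> real"
  assumes Q: "Q \<in> {{1..}, {1}}" and V: "finite V"
    and c: "\<forall>i\<ge>1. 0 \<le> c i" "\<forall>i\<ge>t. 1 \<le> c i" and t: "1 \<le> t" "t < m" "m \<le> card V"
  obtains w where
    "\<And>i. i \<in> sample_indices t m V E \<Longrightarrow> w i \<ge> (0::real)"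
    "\<And>T. T \<in> cliques_of_size t V E \<Longrightarrow>
       (\<Sum>i | i \<in> sample_indices t m V E \<and> T \<in> nsets (snd i) t. w i) \<in> Q"
    "\<And>T T'. T \<in> cliques_of_size t V E \<Longrightarrow> T' \<in> cliques_of_size t V E \<Longrightarrow> T \<noteq> T' \<Longrightarrow>
       (\<Sum>i | i \<in> sample_indices t m V E \<and> T \<in> nsets (snd i) t \<and> T' \<in> nsets (snd i) t. w i)
       \<le> c t * (m choose t) * (m - t) / (card V - t)"
    "(\<Sum>i\<in>sample_indices t m V E. w i * c (card (snd i))) \<le>
       mean V m (clique_density Q t c E) * (card V choose t)"
proof -
  let ?n = "card V" and ?I = "sample_indices t m V E"
  let ?b = "real ((?n - t) choose (m - t))"
  have b: "?b > 0" using t by simp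
  have "\<forall>S\<in>nsets V m. \<exists>f. frac_system Q t S E f \<and> cost S E c f = frac_value Q t S E c"
    using frac_value_attained[OF Q _ c(1) t(1)]
      by (metis (no_types, lifting) mem_Collect_eq nsets_def)
  then obtain f where f: "\<And>S. S \<in> nsets V m \<Longrightarrow> frac_system Q t S E (f S)"
    "\<And>S. S \<in> nsets V m \<Longrightarrow> cost S E c (f S) = frac_value Q t S E c"
    by metis
  have f0: "f S K \<ge> 0" if "S \<in> nsets V m" "K \<in> cliques S E" for S K
    using f(1)[OF that(1)] that(2) by (simp add: frac_system_def)
  define w where "w i = f (fst i) (snd i) / ?b" for i
  have cf0: "c (card K) * f S K \<ge> 0" if S: "S \<in> nsets V m" and K: "K \<in> cliques S E" for S K
  proof -
    have "card K \<ge> 1" using clique_card_ge_one[OF _ K] S by (simp add: nsets_def)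
    then show ?thesis using c(1) f0[OF S K] by simp
  qed
  have large_cost: "(\<Sum>K | K \<in> cliques S E \<and> t \<le> card K. c (card K) * f S K) \<le> frac_value Q t S E c"
    if S: "S \<in> nsets V m" for S
  proof -
    have "finite S" using S by (simp add: nsets_def)
    then show ?thesis unfolding f(2)[OF S, symmetric] cost_def
      using cf0[OF S] by (intro sum_mono2 finite_cliques') auto
  qed
  show thesis
  proof (rule that)
    show "w i \<ge> 0" if "i \<in> ?I" for i
      using that f0 b by (auto simp: w_def sample_indices_def)
  next
    fix T assume T: "T \<in> cliques_of_size t V E"
    have T': "card T = t" "finite T"
      using T V by (auto simp: cliques_of_size_def intro: clique_finite)
    have "(\<Sum>i | i \<in> ?I \<and> T \<in> nsets (snd i) t. w i) =
        (\<Sum>S\<in>nsets V m. \<Sum>K | K \<in> cliques S E \<and> t \<le> card K \<and> T \<in> nsets (snd (S, K)) t. f S K) / ?b"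
      using sum_sample_indices[OF V, where P = "\<lambda>i. T \<in> nsets (snd i) t" and h = f]
      by (simp add: w_def flip: sum_divide_distrib)
    also have "(\<Sum>S\<in>nsets V m. \<Sum>K | K \<in> cliques S E \<and> t \<le> card K \<and> T \<in> nsets (snd (S, K)) t. f S K) =
        (\<Sum>S\<in>nsets V m. cover_weight S E (f S) T)"
      unfolding cover_weight_def
    proof (intro sum.cong refl)
      fix S assume "S \<in> nsets V m"
      then have "finite S" by (simp add: nsets_def)
      then have "t \<le> card K \<and> T \<in> nsets K t \<longleftrightarrow> T \<subseteq> K" if "K \<in> cliques S E" for K
        using T' card_mono[OF clique_finite[OF _ that]] by (auto simp: nsets_def)
      then show "{K. K \<in> cliques S E \<and> t \<le> card K \<and> T \<in> nsets (snd (S, K)) t} =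
          {K \<in> cliques S E. T \<subseteq> K}"
        by auto
    qed
    also have "\<dots> / ?b \<in> Q" using t by (intro average_cover_weight[OF Q V _ _ f(1) T]) auto
    finally show "(\<Sum>i | i \<in> ?I \<and> T \<in> nsets (snd i) t. w i) \<in> Q" .
  next
    fix T T' assume T: "T \<in> cliques_of_size t V E" "T' \<in> cliques_of_size t V E" "T \<noteq> T'"
    have fin: "T \<subseteq> V" "T' \<subseteq> V" "finite T" "finite T'" "card T = t" "card T' = t"
      using T V by (auto simp: cliques_of_size_def cliques_def intro: finite_subset)
    have "\<not> T' \<subseteq> T" using fin T(3) card_subset_eq by metis
    then obtain v where v: "v \<in> T'" "v \<notin> T" by blast
    let ?D = "c t * (m choose t)" and ?A = "{S \<in> nsets V m. insert v T \<subseteq> S}"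
    have "(\<Sum>i | i \<in> ?I \<and> T \<in> nsets (snd i) t \<and> T' \<in> nsets (snd i) t. w i) =
        (\<Sum>S\<in>nsets V m. \<Sum>K | K \<in> cliques S E \<and> t \<le> card K \<and> T \<in> nsets (snd (S, K)) t \<and>
            T' \<in> nsets (snd (S, K)) t. f S K) / ?b"
      using sum_sample_indices[OF V, where h = f
          and P = "\<lambda>i. T \<in> nsets (snd i) t \<and> T' \<in> nsets (snd i) t"]
      by (simp add: w_def flip: sum_divide_distrib)
    also have "\<dots> \<le> (\<Sum>S\<in>nsets V m. if S \<in> ?A then ?D else 0) / ?b"
    proof (intro divide_right_mono sum_mono)
      fix S assume S: "S \<in> nsets V m"
      let ?K = "{K. K \<in> cliques S E \<and> t \<le> card K \<and> T \<in> nsets (snd (S, K)) t \<and> T' \<in> nsets (snd (S,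
          K)) t}"
      have finS: "finite S" "card S = m" using S by (auto simp: nsets_def)
      show "(\<Sum>K\<in>?K. f S K) \<le> (if S \<in> ?A then ?D else 0)"
      proof (cases "S \<in> ?A")
        case True
        have "(\<Sum>K\<in>?K. f S K) \<le> (\<Sum>K\<in>?K. c (card K) * f S K)"
        proof (rule sum_mono)
          fix K assume "K \<in> ?K"
          then have "1 * f S K \<le> c (card K) * f S K"
            using c(2) f0[OF S] by (intro mult_right_mono) auto
          then show "f S K \<le> c (card K) * f S K" by simp
        qed
        also have "\<dots> \<le> (\<Sum>K | K \<in> cliques S E \<and> t \<le> card K. c (card K) * f S K)"
          using finite_cliques'[OF finS(1), of E] cf0[OF S] by (intro sum_mono2) auto
        also have "\<dots> \<le> frac_value Q t S E c" by (rule large_cost[OF S])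
        also have "\<dots> \<le> ?D" using frac_value_le_choose[OF Q finS(1) c(1) t(1)] finS(2) by simp
        finally show ?thesis using True by simp
      next
        case False
        have "?K = {}"
        proof (rule ccontr)
          assume "?K \<noteq> {}"
          then obtain K where "K \<in> cliques S E" "T \<subseteq> K" "T' \<subseteq> K" by (auto simp: nsets_def)
          then have "insert v T \<subseteq> S" using v by (auto simp: cliques_def)
          then show False using False S by simp
        qed
        then show ?thesis using False by (simp only: sum.empty if_False)
      qed
    qed (use b in simp)
    also have "\<dots> = ?D * card ?A / ?b"
      using finite_imp_finite_nsets[OF V] by (simp add: sum.If_cases Int_def)
    also have "card ?A = (?n - t - 1) choose (m - t - 1)"
      using card_nsets_superset[OF V, of "insert v T" m] fin v t by auto
    also have "?D * real ((?n - t - 1) choose (m - t - 1)) / ?b = ?D * (m - t) / (?n - t)"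
    proof -
      have ratio: "A / B = x / y" if "x * B = y * A" "y > 0" "B > 0" for x y A B :: real
        using that by (simp add: frac_eq_eq mult.commute)
      have "(m - t) * ((?n - t) choose (m - t)) = (?n - t) * ((?n - t - 1) choose (m - t - 1))"
        using t by (intro times_binomial_minus1_eq) auto
      then have "real (m - t) * ?b = real (?n - t) * real ((?n - t - 1) choose (m - t - 1))"
        by (metis of_nat_mult)
      moreover have "real (?n - t) > 0" using t by simp
      ultimately have "real ((?n - t - 1) choose (m - t - 1)) / ?b = real (m - t) / real (?n - t)"
        using b ratio by blast
      then show ?thesis by (simp only: times_divide_eq_right[symmetric])
    qed
    finally show "(\<Sum>i | i \<in> ?I \<and> T \<in> nsets (snd i) t \<and> T' \<in> nsets (snd i) t. w i) \<le> ?D * (m - t) /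
        (?n - t)" .
  next
    have "(\<Sum>i\<in>?I. w i * c (card (snd i))) = (\<Sum>i | i \<in> ?I \<and> True. c (card (snd i)) *
        f (fst i) (snd i)) / ?b"
      by (simp add: w_def sum_divide_distrib mult.commute)
    also have "\<dots> = (\<Sum>S\<in>nsets V m. \<Sum>K | K \<in> cliques S E \<and> t \<le> card K \<and> True. c (card K) * f S K) /
        ?b"
      using sum_sample_indices[OF V, where P = "\<lambda>_. True" and h = "\<lambda>S K. c (card K) * f S K"]
        by simp
    also have "\<dots> \<le> (\<Sum>S\<in>nsets V m. frac_value Q t S E c) / ?b"
      using large_cost b by (intro divide_right_mono sum_mono) auto
    also have "\<dots> = mean V m (clique_density Q t c E) * (?n choose t)"
    proof -
      have "real (?n choose m) * real (m choose t) = real (?n choose t) * ?b"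
        using choose_mult[of t m ?n] t by (metis less_imp_le of_nat_mult)
      moreover have "real (m choose t) > 0" "real (?n choose m) > 0" using t by simp_all
      moreover have "mean V m (clique_density Q t c E) = (\<Sum>S\<in>nsets V m. frac_value Q t S E c /
          (m choose t)) / (?n choose m)"
        unfolding mean_def clique_density_def
          by (intro arg_cong2[where f = "(/)"] sum.cong refl) (auto simp: nsets_def)
      ultimately show ?thesis using b by (simp add: field_simps flip: sum_divide_distrib)
    qed
    finally show "(\<Sum>i\<in>?I. w i * c (card (snd i))) \<le> mean V m (clique_density Q t c E) *
        (?n choose t)" .
  qed
qed

section \<open>Completing selected cliques to an integral system\<close>

definition rounded_system :: "nat \<Rightarrow> 'a set \<Rightarrow> 'a set set \<Rightarrow> ('a set \<times> 'a set) set \<Rightarrow> 'a set \<Rightarrow> real"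
    where
  "rounded_system t V E M K =
     of_bool (K \<in> snd ` M \<or> K \<in> cliques_of_size t V E - (\<Union>i\<in>M. nsets (snd i) t))"

lemma cost_rounded_system:
  fixes c :: "nat \<Rightarrow> real"
  assumes V: "finite V" and c: "\<forall>i\<ge>1. 0 \<le> c i" and t: "1 \<le> t" and M: "M \<subseteq> sample_indices t m V E"
  shows "cost V E c (rounded_system t V E M) \<le>
    (\<Sum>i\<in>M. c (card (snd i))) + c t * card (cliques_of_size t V E - (\<Union>i\<in>M. nsets (snd i) t))"
proof -
  let ?U = "cliques_of_size t V E - (\<Union>i\<in>M. nsets (snd i) t)"
  have finM: "finite M" using M finite_sample_indices[OF V] by (rule finite_subset)
  have U: "?U \<subseteq> cliques V E" "finite ?U"
    using finite_cliques'[OF V] by (auto simp: cliques_of_size_def intro: finite_subset)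
  have cK: "c (card K) \<ge> 0" if "K \<in> cliques V E" for K
    using c clique_card_ge_one[OF V that] by blast
  have sndM: "snd ` M \<subseteq> cliques V E" using sample_indicesD(1)[OF V _ t] M by blast
  have "cost V E c (rounded_system t V E M) = (\<Sum>K\<in>snd ` M \<union> ?U. c (card K))"
    unfolding cost_def rounded_system_def using finite_cliques'[OF V] sndM U(1)
    by (intro sum.mono_neutral_cong_right) auto
  also have "\<dots> \<le> (\<Sum>K\<in>snd ` M. c (card K)) + (\<Sum>K\<in>?U. c (card K))"
    using finM U sndM cK by (subst sum_Un) (auto intro!: sum_nonneg)
  also have "(\<Sum>K\<in>?U. c (card K)) = c t * card ?U"
    by (simp add: cliques_of_size_def)
  also have "(\<Sum>K\<in>snd ` M. c (card K)) \<le> (\<Sum>i\<in>M. c (card (snd i)))"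
    using sum_image_le[OF finM, of "\<lambda>K. c (card K)" snd] sndM cK by (auto simp: image_subset_iff)
  finally show ?thesis by simp
qed

lemma rounded_system_cover:
  assumes V: "finite V" and t: "1 \<le> t" and M: "M \<subseteq> sample_indices t m V E"
  shows "clique_cover t V E (rounded_system t V E M)"
  unfolding clique_cover_def
proof (intro conjI ballI)
  fix T assume T: "T \<in> cliques_of_size t V E"
  have "\<exists>K. K \<in> cliques V E \<and> T \<subseteq> K \<and> rounded_system t V E M K = 1"
  proof (cases "T \<in> (\<Union>i\<in>M. nsets (snd i) t)")
    case True
    then obtain i where i: "i \<in> M" "T \<in> nsets (snd i) t" by blast
    then have "snd i \<in> cliques V E" using M sample_indicesD(1)[OF V _ t] by blast
    then show ?thesis using i
      by (intro exI[of _ "snd i"]) (simp add: rounded_system_def nsets_def)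
  next
    case False
    then show ?thesis
      using T by (intro exI[of _ T]) (auto simp: rounded_system_def cliques_of_size_def)
  qed
  then obtain K where K: "K \<in> cliques V E" "T \<subseteq> K" "rounded_system t V E M K = 1" by blast
  have "rounded_system t V E M K \<le> cover_weight V E (rounded_system t V E M) T"
    unfolding cover_weight_def using K finite_cliques'[OF V]
    by (intro member_le_sum) (auto simp: rounded_system_def)
  then show "1 \<le> cover_weight V E (rounded_system t V E M) T" using K(3) by simp
qed (auto simp: rounded_system_def)

text \<open>If some \<open>i \<in> M\<close> covers \<open>T\<close>, disjointness excludes every
  other selected clique over \<open>T\<close>, and the only \<open>t\<close>-clique that contains
  \<open>T\<close> is \<open>T\<close> itself, which is then not left over. If none does,
  \<open>T\<close> is left over and stands alone.\<close>

lemma rounded_system_decomposition: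
  assumes V: "finite V" and t: "1 \<le> t" and M: "M \<subseteq> sample_indices t m V E"
    and disj: "disjoint_family_on (\<lambda>i. nsets (snd i) t) M"
  shows "clique_decomposition t V E (rounded_system t V E M)"
  unfolding clique_decomposition_def
proof (intro conjI ballI)
  fix T assume T: "T \<in> cliques_of_size t V E"
  have cT: "card T = t" "finite T"
    using T V by (auto simp: cliques_of_size_def intro: clique_finite)
  have eq: "K = T" if "K \<in> cliques_of_size t V E" "T \<subseteq> K" for K
    using that cT card_subset_eq[of K T] clique_finite[OF V] by (auto simp: cliques_of_size_def)
  have "\<exists>K0. K0 \<in> cliques V E \<and> T \<subseteq> K0 \<and>
      (\<forall>K\<in>cliques V E. T \<subseteq> K \<longrightarrow> rounded_system t V E M K = of_bool (K = K0))"
  proof (cases "T \<in> (\<Union>i\<in>M. nsets (snd i) t)")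
    case True
    then obtain i where i: "i \<in> M" "T \<in> nsets (snd i) t" by blast
    have "snd j = snd i" if "j \<in> M" "T \<subseteq> snd j" for j
    proof -
      have "T \<in> nsets (snd j) t" using that cT by (simp add: nsets_def)
      then have "j = i" using disj i that(1) unfolding disjoint_family_on_def by blast
      then show ?thesis by simp
    qed
    moreover have "K \<notin> cliques_of_size t V E - (\<Union>i\<in>M. nsets (snd i) t)" if "T \<subseteq> K" for K
      using eq[OF _ that] True by blast
    ultimately have "K \<in> snd ` M \<or> K \<in> cliques_of_size t V E - (\<Union>i\<in>M. nsets (snd i) t) \<longleftrightarrow> K = snd i"
      if "T \<subseteq> K" for K
      using that i(1) by blast
    then have "rounded_system t V E M K = of_bool (K = snd i)" if "T \<subseteq> K" for K
      using that by (simp only: rounded_system_def)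
    moreover have "snd i \<in> cliques V E" using i(1) M sample_indicesD(1)[OF V _ t] by blast
    moreover have "T \<subseteq> snd i" using i(2) by (simp add: nsets_def)
    ultimately show ?thesis by (intro exI[of _ "snd i"]) simp
  next
    case False
    then have "\<not> T \<subseteq> snd j" if "j \<in> M" for j using that cT by (auto simp: nsets_def)
    then have "K \<in> snd ` M \<or> K \<in> cliques_of_size t V E - (\<Union>i\<in>M. nsets (snd i) t) \<longleftrightarrow> K = T"
      if "T \<subseteq> K" for K
      using that eq False T by blast
    then have "rounded_system t V E M K = of_bool (K = T)" if "T \<subseteq> K" for K
      using that by (simp only: rounded_system_def)
    then show ?thesis using T by (intro exI[of _ T]) (simp add: cliques_of_size_def)
  qed
  then obtain K0 where K0: "K0 \<in> cliques V E" "T \<subseteq> K0"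
    "\<forall>K\<in>cliques V E. T \<subseteq> K \<longrightarrow> rounded_system t V E M K = of_bool (K = K0)" by blast
  have "cover_weight V E (rounded_system t V E M) T = (\<Sum>K \<in> {K \<in> cliques V E. T \<subseteq> K}. if K =
      K0 then 1 else 0)"
    unfolding cover_weight_def using K0(3) by (intro sum.cong) auto
  also have "\<dots> = 1" using K0 finite_cliques'[OF V] by (subst sum.delta) auto
  finally show "cover_weight V E (rounded_system t V E M) T = 1" .
qed (auto simp: rounded_system_def)

lemma binary_nonneg:
  assumes "\<forall>K\<in>A. f K \<in> {0, 1::real}" shows "\<forall>K\<in>A. f K \<ge> 0"
proof
  fix K assume "K \<in> A"
  then have "f K = 0 \<or> f K = 1" using assms by blast
  then show "f K \<ge> 0" by auto
qed

lemma cov_le: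
  fixes c :: "nat \<Rightarrow> real"
  assumes "finite V" "\<forall>i\<ge>1. 0 \<le> c i" "clique_cover t V E f" shows "cov t V E c \<le> cost V E c f"
  unfolding cov_def
proof (rule cInf_lower)
  show "bdd_below {cost V E c f | f. clique_cover t V E f}"
  proof (rule bdd_belowI[of _ 0])
    fix x assume "x \<in> {cost V E c f | f. clique_cover t V E f}"
    then obtain f where "x = cost V E c f" "\<forall>K\<in>cliques V E. f K \<in> {0, 1}"
      unfolding clique_cover_def by blast
    then show "0 \<le> x" using cost_nonneg[OF assms(1,2) binary_nonneg] by simp
  qed
qed (use assms in auto)

lemma dec_le:
  fixes c :: "nat \<Rightarrow> real"
  assumes "finite V" "\<forall>i\<ge>1. 0 \<le> c i" "clique_decomposition t V E f" shows "dec t V E c \<le>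
      cost V E c f"
  unfolding dec_def
proof (rule cInf_lower)
  show "bdd_below {cost V E c f | f. clique_decomposition t V E f}"
  proof (rule bdd_belowI[of _ 0])
    fix x assume "x \<in> {cost V E c f | f. clique_decomposition t V E f}"
    then obtain f where "x = cost V E c f" "\<forall>K\<in>cliques V E. f K \<in> {0, 1}"
      unfolding clique_decomposition_def by blast
    then show "0 \<le> x" using cost_nonneg[OF assms(1,2) binary_nonneg] by simp
  qed
qed (use assms in auto)

text \<open>The \<open>t\<close>-cliques are the vertices of the hypergraph and the sampled cliques
  its edges, with at most \<open>m choose t\<close> vertices each; a \<open>t\<close>-clique left
  uncovered is bought separately at the price \<open>a\<close>. The bound \<open>n1\<close> can be
  chosen before \<open>c\<close> because the rounding thresholds depend on the costs only through
  \<open>a\<close>.\<close>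

lemma integral_rounding:
  fixes a \<epsilon> :: real
  assumes a: "a > 0" and \<epsilon>: "\<epsilon> > 0" and t: "1 \<le> t" "t < m"
  shows "\<exists>n1. \<forall>c. (\<forall>i\<ge>1. 0 \<le> c i) \<longrightarrow> (\<forall>i\<ge>t. 1 \<le> c i) \<longrightarrow> c t = a \<longrightarrow>
    (\<forall>(V :: 'a set) E. finite V \<longrightarrow> n1 \<le> card V \<longrightarrow>
      cov t V E c \<le> (mean V m (clique_density {1..} t c E) + \<epsilon>) * (card V choose t) \<and>
      dec t V E c \<le> (mean V m (clique_density {1} t c E) + \<epsilon>) * (card V choose t))"
proof -
  let ?r = "m choose t"
  have r: "?r \<ge> 1" using t by (simp add: Suc_le_eq)
  obtain \<delta>1 where \<delta>1: "\<delta>1 > 0" and cover: "\<forall>(X :: 'a set set) (I :: ('a set \<times> 'a set) set) e w c.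
      finite X \<longrightarrow> finite I \<longrightarrow>
     (\<forall>i\<in>I. e i \<subseteq> X \<and> card (e i) \<le> ?r \<and> 0 \<le> w i \<and> 0 \<le> c i) \<longrightarrow>
     (\<forall>x\<in>X. (\<Sum>i | i \<in> I \<and> x \<in> e i. w i) \<ge> 1) \<longrightarrow>
     (\<forall>x\<in>X. \<forall>y\<in>X. x \<noteq> y \<longrightarrow> (\<Sum>i | i \<in> I \<and> x \<in> e i \<and> y \<in> e i. w i) \<le> \<delta>1) \<longrightarrow>
     (\<exists>M\<subseteq>I. (\<Sum>i\<in>M. c i) + a * card (X - (\<Union>i\<in>M. e i)) \<le> (\<Sum>i\<in>I. w i * c i) + \<epsilon> * card X)"
    using fractional_cover_rounding[OF r a \<epsilon>] by (elim exE conjE)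
  obtain \<delta>2 where \<delta>2: "\<delta>2 > 0" and decomposition: "\<forall>(X :: 'a set set) (I :: ('a set \<times> 'a set) set)
      e w c.
     hypergraph_fractional_matching X I e w ?r \<delta>2 \<longrightarrow> (\<forall>x\<in>X. (\<Sum>i | i \<in> I \<and> x \<in> e i. w i) = 1) \<longrightarrow>
     (\<forall>i\<in>I. 0 \<le> c i) \<longrightarrow>
     (\<exists>M\<subseteq>I. disjoint_family_on e M \<and>
        (\<Sum>i\<in>M. c i) + a * card (X - (\<Union>i\<in>M. e i)) \<le> (\<Sum>i\<in>I. w i * c i) + \<epsilon> * card X)"
    using fractional_perfect_matching_rounding[OF r a \<epsilon>] by (elim exE conjE)
  define \<delta> where "\<delta> = min \<delta>1 \<delta>2"
  have \<delta>: "\<delta> > 0" using \<delta>1 \<delta>2 by (simp add: \<delta>_def)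
  \<comment> \<open>For \<open>n \<ge> n1\<close> the codegree bound
    \<open>a * ?r * (m - t) / (n - t)\<close> of the sampled system is at most
    \<open>\<delta>\<close>, and samples of size \<open>m\<close> exist.\<close>
  define n1 where "n1 = max m (t + nat \<lceil>a * ?r * (m - t) / \<delta>\<rceil> + 1)"
  show ?thesis
  proof (intro exI[of _ n1] allI impI)
    fix c :: "nat \<Rightarrow> real" and V :: "'a set" and E
    assume c: "\<forall>i\<ge>1. 0 \<le> c i" "\<forall>i\<ge>t. 1 \<le> c i" "c t = a" and V: "finite V" and n: "n1 \<le> card V"
    let ?n = "card V" and ?X = "cliques_of_size t V E" and ?I = "sample_indices t m V E"
    let ?e = "\<lambda>i :: 'a set \<times> 'a set. nsets (snd i) t"
    have mn: "m \<le> ?n" "t < ?n" using n t by (auto simp: n1_def)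
    have small: "c t * ?r * (m - t) / (?n - t) \<le> \<delta>"
    proof -
      have "a * ?r * (m - t) / \<delta> \<le> real (?n - t)"
        using n real_nat_ceiling_ge[of "a * ?r * (m - t) / \<delta>"] unfolding n1_def by linarith
      then have "a * ?r * (m - t) \<le> real (?n - t) * \<delta>" using \<delta> by (simp add: divide_le_eq)
      then show ?thesis using mn c(3) by (simp add: divide_le_eq mult.commute)
    qed
    have finX: "finite ?X"
      using cliques_of_size_subset[OF V] finite_imp_finite_nsets[OF V] by (rule finite_subset)
    have finI: "finite ?I" using V by (rule finite_sample_indices)
    have cardX: "\<epsilon> * card ?X \<le> \<epsilon> * (?n choose t)"
      using card_cliques_of_size_le[OF V] \<epsilon> by simp
    have I: "?e i \<subseteq> ?X \<and> ?e i \<noteq> {} \<and> card (?e i) \<le> ?r \<and> 0 \<le> c (card (snd i))" if "i \<in> ?I" for i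
      using sample_indicesD[OF V that t(1)] c(1) t(1) by auto
    show "cov t V E c \<le> (mean V m (clique_density {1..} t c E) + \<epsilon>) * (?n choose t) \<and>
      dec t V E c \<le> (mean V m (clique_density {1} t c E) + \<epsilon>) * (?n choose t)"
    proof
      obtain w where w: "\<And>i. i \<in> ?I \<Longrightarrow> w i \<ge> (0::real)"
        "\<And>T. T \<in> ?X \<Longrightarrow> (\<Sum>i | i \<in> ?I \<and> T \<in> ?e i. w i) \<in> {1..}"
        "\<And>T T'. T \<in> ?X \<Longrightarrow> T' \<in> ?X \<Longrightarrow> T \<noteq> T' \<Longrightarrow>
           (\<Sum>i | i \<in> ?I \<and> T \<in> ?e i \<and> T' \<in> ?e i. w i) \<le> c t * ?r * (m - t) / (?n - t)"
        "(\<Sum>i\<in>?I. w i * c (card (snd i))) \<le> mean V m (clique_density {1..} t c E) * (?n choose t)"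
        using sampled_fractional_system[of "{1..}" V c t m E] V c t mn by auto
      have "\<exists>M\<subseteq>?I. (\<Sum>i\<in>M. c (card (snd i))) + a * card (?X - (\<Union>i\<in>M. ?e i)) \<le>
          (\<Sum>i\<in>?I. w i * c (card (snd i))) + \<epsilon> * card ?X"
      proof (rule cover[rule_format])
        fix T T' assume "T \<in> ?X" "T' \<in> ?X" "T \<noteq> T'"
        then have "(\<Sum>i | i \<in> ?I \<and> T \<in> ?e i \<and> T' \<in> ?e i. w i) \<le> \<delta>" using w(3) small by fastforce
        then show "(\<Sum>i | i \<in> ?I \<and> T \<in> ?e i \<and> T' \<in> ?e i. w i) \<le> \<delta>1" by (simp add: \<delta>_def)
      next
        fix T assume "T \<in> ?X"
        from w(2)[OF this] show "1 \<le> (\<Sum>i | i \<in> ?I \<and> T \<in> ?e i. w i)" by simp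
      qed (use finX finI I w(1) in auto)
      then obtain M where M: "M \<subseteq> ?I" "(\<Sum>i\<in>M. c (card (snd i))) + a * card (?X - (\<Union>i\<in>M. ?e i)) \<le>
          (\<Sum>i\<in>?I. w i * c (card (snd i))) + \<epsilon> * card ?X" by blast
      have "cov t V E c \<le> cost V E c (rounded_system t V E M)"
        using V c(1) rounded_system_cover[OF V t(1) M(1)] by (rule cov_le)
      also have "\<dots> \<le> (\<Sum>i\<in>?I. w i * c (card (snd i))) + \<epsilon> * card ?X"
        using cost_rounded_system[OF V c(1) t(1) M(1)] M(2) unfolding c(3) by linarith
      finally show "cov t V E c \<le> (mean V m (clique_density {1..} t c E) + \<epsilon>) * (?n choose t)"
        using w(4) cardX by (simp add: distrib_right)
    next
      obtain w where w: "\<And>i. i \<in> ?I \<Longrightarrow> w i \<ge> (0::real)"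
        "\<And>T. T \<in> ?X \<Longrightarrow> (\<Sum>i | i \<in> ?I \<and> T \<in> ?e i. w i) \<in> {1}"
        "\<And>T T'. T \<in> ?X \<Longrightarrow> T' \<in> ?X \<Longrightarrow> T \<noteq> T' \<Longrightarrow>
           (\<Sum>i | i \<in> ?I \<and> T \<in> ?e i \<and> T' \<in> ?e i. w i) \<le> c t * ?r * (m - t) / (?n - t)"
        "(\<Sum>i\<in>?I. w i * c (card (snd i))) \<le> mean V m (clique_density {1} t c E) * (?n choose t)"
        using sampled_fractional_system[of "{1}" V c t m E] V c t mn by auto
      have deg: "(\<Sum>i | i \<in> ?I \<and> T \<in> ?e i. w i) = 1" if "T \<in> ?X" for T using w(2)[OF that] by simp
      have "hypergraph_fractional_matching ?X ?I ?e w ?r \<delta>2"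
      proof
        fix T T' assume "T \<in> ?X" "T' \<in> ?X" "T \<noteq> T'"
        then have "(\<Sum>i | i \<in> ?I \<and> T \<in> ?e i \<and> T' \<in> ?e i. w i) \<le> \<delta>" using w(3) small by fastforce
        then show "(\<Sum>i | i \<in> ?I \<and> T \<in> ?e i \<and> T' \<in> ?e i. w i) \<le> \<delta>2" by (simp add: \<delta>_def)
      qed (use finX finI I w(1) deg in auto)
      then have "\<exists>M\<subseteq>?I. disjoint_family_on ?e M \<and>
          (\<Sum>i\<in>M. c (card (snd i))) + a * card (?X - (\<Union>i\<in>M. ?e i)) \<le>
          (\<Sum>i\<in>?I. w i * c (card (snd i))) + \<epsilon> * card ?X"
        by (rule decomposition[rule_format]) (use deg I in auto)
      then obtain M where M: "M \<subseteq> ?I" "disjoint_family_on ?e M"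
        "(\<Sum>i\<in>M. c (card (snd i))) + a * card (?X - (\<Union>i\<in>M. ?e i)) \<le>
          (\<Sum>i\<in>?I. w i * c (card (snd i))) + \<epsilon> * card ?X" by blast
      have "dec t V E c \<le> cost V E c (rounded_system t V E M)"
        using V c(1) rounded_system_decomposition[OF V t(1) M(1,2)] by (rule dec_le)
      also have "\<dots> \<le> (\<Sum>i\<in>?I. w i * c (card (snd i))) + \<epsilon> * card ?X"
        using cost_rounded_system[OF V c(1) t(1) M(1)] M(3) unfolding c(3) by linarith
      finally show "dec t V E c \<le> (mean V m (clique_density {1} t c E) + \<epsilon>) * (?n choose t)"
        using w(4) cardX by (simp add: distrib_right)
    qed
  qed
qed

section \<open>Choice of the majorant\<close>

lemma binomial_le_pow_div_fact: "real (n choose t) \<le> real n ^ t / fact t"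
proof -
  have "real ((n choose t) * fact t) \<le> real (n ^ t)"
    using binomial_fact_pow[of n t] by (simp only: of_nat_le_iff)
  then show ?thesis by (simp add: le_divide_eq)
qed

lemma binomial_ge_pow_div_fact:
  assumes "t \<le> M" shows "(real M - real t) ^ t / fact t \<le> real (M choose t)"
proof -
  have "(real M - real t) ^ t = (\<Prod>i\<in>{0..<t}. real M - real t)" by simp
  also have "\<dots> \<le> (\<Prod>i\<in>{0..<t}. real M - real i)"
    using assms by (intro prod_mono) auto
  finally show ?thesis
    unfolding binomial_gbinomial gbinomial_prod_rev by (intro divide_right_mono) auto
qed

text \<open>The loss has two sources. Fewer than \<open>M\<close> vertices are left over by the
  division, a relative error of \<open>t * M / n\<close>, and \<open>M choose t\<close> falls short
  of \<open>M ^ t / fact t\<close> by a relative error of \<open>t\<^sup>2 / M\<close>. Bernoulli's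
  inequality gives both.\<close>

lemma choose_blow_up_gap:
  assumes t: "1 \<le> t" "t \<le> M" and n: "M \<le> n"
  shows "real (n choose t) \<le> real (n div M) ^ t * real (M choose t) + (real t * real M / real n +
      (real t)\<^sup>2 / real M) * real n ^ t"
proof -
  have pos: "real M > 0" "real n > 0" using t n by simp_all
  let ?x = "1 - real M / n" and ?y = "1 - real t / M"
  have x: "0 \<le> ?x" "?x \<le> 1" and y: "0 \<le> ?y" "?y \<le> 1" using t n pos by (simp_all add: divide_le_eq)
  have "n mod M < M" using t by simp
  then have "n < M * (n div M) + M" using mult_div_mod_eq[of M n] by linarith
  then have "real n \<le> real M * real (n div M) + real M"
    by (metis less_imp_le of_nat_add of_nat_le_iff of_nat_mult)
  then have "real n * ?x \<le> M * real (n div M)"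
    using pos by (simp add: right_diff_distrib)
  then have "(real n * ?x) ^ t \<le> (M * real (n div M)) ^ t"
    using x pos by (intro power_mono) auto
  moreover have "(real M - t) = M * ?y" using pos by (simp add: right_diff_distrib)
  then have "(M * ?y) ^ t / fact t \<le> real (M choose t)"
    using binomial_ge_pow_div_fact[OF t(2)] by simp
  then have "real (n div M) ^ t * ((M * ?y) ^ t / fact t) \<le> real (n div M) ^ t * real (M choose t)"
    by (intro mult_left_mono) auto
  moreover have "(real n * ?x) ^ t * ?y ^ t / fact t \<le> (M * real (n div M)) ^ t * ?y ^ t / fact t"
    using calculation(1) y by (intro divide_right_mono mult_right_mono) auto
  ultimately have lower: "real n ^ t * (?x ^ t * ?y ^ t) / fact t \<le> real (n div M) ^ t *
      real (M choose t)"
    by (simp add: power_mult_distrib mult_ac)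
  have "1 - t * (M / n) \<le> ?x ^ t" using Bernoulli_inequality[of "- (real M / n)" t] x by simp
  moreover have "1 - t * (t / M) \<le> ?y ^ t"
    using Bernoulli_inequality[of "- (real t / M)" t] y by simp
  moreover have "?x ^ t + ?y ^ t - 1 \<le> ?x ^ t * ?y ^ t"
  proof -
    have "0 \<le> (1 - ?x ^ t) * (1 - ?y ^ t)"
      using x y by (intro mult_nonneg_nonneg) (auto simp: power_le_one)
    then show ?thesis by (simp add: algebra_simps)
  qed
  ultimately have "1 - ?x ^ t * ?y ^ t \<le> real t * real M / real n + (real t)\<^sup>2 / real M"
    by (simp add: power2_eq_square)
  moreover have "0 \<le> 1 - ?x ^ t * ?y ^ t"
    using x y by (simp add: mult_le_one power_le_one)
  then have "(1 - ?x ^ t * ?y ^ t) / fact t \<le> 1 - ?x ^ t * ?y ^ t"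
    by (simp add: divide_le_eq mult_left_le_one_le mult_le_cancel_left1)
  ultimately have "(1 - ?x ^ t * ?y ^ t) / fact t \<le> real t * real M / real n + (real t)\<^sup>2 / real M"
    by linarith
  then have "(1 - ?x ^ t * ?y ^ t) / fact t * real n ^ t \<le> (real t * real M / real n + (real t)\<^sup>2 /
      real M) * real n ^ t"
    by (intro mult_right_mono) auto
  moreover have "real n ^ t / fact t = real n ^ t * (?x ^ t * ?y ^ t) / fact t + (1 - ?x ^ t *
      ?y ^ t) / fact t * real n ^ t"
    by (simp add: field_simps)
  ultimately show ?thesis using lower binomial_le_pow_div_fact[of n t] by linarith
qed

text \<open>With no sampled clique selected, \<open>rounded_system\<close> consists of all
  \<open>t\<close>-cliques.\<close>

lemma integral_le_choose:
  fixes c :: "nat \<Rightarrow> real"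
  assumes V: "finite V" and c: "\<forall>i\<ge>1. 0 \<le> c i" and t: "1 \<le> t"
  shows "cov t V E c \<le> c t * (card V choose t)" "dec t V E c \<le> c t * (card V choose t)"
proof -
  have cost: "cost V E c (rounded_system t V E {}) \<le> c t * (card V choose t)"
  proof -
    have "cost V E c (rounded_system t V E {}) \<le> c t * card (cliques_of_size t V E)"
      using cost_rounded_system[OF V c t, of "{}"] by simp
    also have "\<dots> \<le> c t * (card V choose t)"
      using card_cliques_of_size_le[OF V] c t by (intro mult_left_mono) auto
    finally show ?thesis .
  qed
  have "clique_cover t V E (rounded_system t V E {})"
    using rounded_system_cover[OF V t] by simp
  then show "cov t V E c \<le> c t * (card V choose t)" using cov_le[OF V c] cost by force
  have "clique_decomposition t V E (rounded_system t V E {})"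
    using rounded_system_decomposition[OF V t] by (simp add: disjoint_family_on_def)
  then show "dec t V E c \<le> c t * (card V choose t)" using dec_le[OF V c] cost by force
qed

text \<open>Scales grow quadratically, so that averages over \<open>m\<close>-subsets are concentrated at the
  next scale.\<close>

fun sample_scale :: "nat \<Rightarrow> nat \<Rightarrow> nat \<Rightarrow> nat" where
  "sample_scale m0 L 0 = m0"
| "sample_scale m0 L (Suc j) = L * (sample_scale m0 L j)\<^sup>2"

lemma sample_scale_step:
  assumes "1 \<le> m0" "2 \<le> L"
  shows "1 \<le> sample_scale m0 L j \<and> 2 * sample_scale m0 L j \<le> sample_scale m0 L (Suc j)"
proof (induction j)
  case 0
  show ?case using assms by (simp add: power2_eq_square mult_le_mono)
next
  case (Suc j)
  then have "1 \<le> sample_scale m0 L (Suc j)" by linarith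
  moreover from this have "2 * sample_scale m0 L (Suc j) \<le> L * (sample_scale m0 L (Suc j) *
      sample_scale m0 L (Suc j))"
    using assms(2) by (intro mult_le_mono) auto
  ultimately show ?case
    by (simp only: sample_scale.simps(2)[of _ _ "Suc j"] power2_eq_square simp_thms)
qed

lemma sample_scale_mono:
  assumes "1 \<le> m0" "2 \<le> L" "i \<le> j" shows "sample_scale m0 L i \<le> sample_scale m0 L j"
proof (rule lift_Suc_mono_le[OF _ assms(3)])
  show "sample_scale m0 L n \<le> sample_scale m0 L (Suc n)" for n
    using sample_scale_step[OF assms(1,2), of n] by linarith
qed

text \<open>Pigeonhole on a telescoping sum.\<close>

lemma small_step_exists:
  fixes D :: "nat \<Rightarrow> real" and \<eta> :: real
  assumes "D 0 - D J \<le> J * \<eta>" "J > 0" shows "\<exists>j<J. D j - D (Suc j) \<le> \<eta>"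
proof (rule ccontr)
  assume "\<not> ?thesis"
  then have "(\<Sum>j<J. \<eta>) < (\<Sum>j<J. D j - D (Suc j))"
    using assms(2) by (intro sum_strict_mono) (auto simp: not_le lessThan_empty_iff)
  then show False using assms(1) by (simp add: sum_lessThan_telescope')
qed

lemma fractional_majorant:
  fixes \<rho> a :: real
  assumes \<rho>: "\<rho> > 0" and a: "a > 0" and t: "2 \<le> t"
  shows "\<exists>n0. \<forall>c. (\<forall>i\<ge>1. 0 \<le> c i) \<longrightarrow> (\<forall>i\<ge>t. 1 \<le> c i) \<longrightarrow> c t = a \<longrightarrow>
    (\<forall>(V :: 'a set) E. finite V \<longrightarrow> n0 < card V \<longrightarrow>
      (\<exists>E'. E' \<subseteq> nsets V 2 \<and>
        cov t V E c \<le> frac_cov t V E' c + \<rho> * real (card V) ^ t \<and>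
        dec t V E c \<le> frac_dec t V E' c + \<rho> * real (card V) ^ t))"
proof -
  \<comment> \<open>The error is at most \<open>4 * \<epsilon>\<close> per \<open>n ^ t\<close>: one
    \<open>\<epsilon>\<close> for the rounding, two for passing from the averages to the sample
    \<open>S\<close>, and one for the blow-up.\<close>
  define \<epsilon> where "\<epsilon> = min 1 (\<rho> / 4)"
  have \<epsilon>: "0 < \<epsilon>" "\<epsilon> \<le> 1" "4 * \<epsilon> \<le> \<rho>" using \<rho> by (auto simp: \<epsilon>_def)
  \<comment> \<open>This makes \<open>sqrt (4 * \<eta>)\<close> equal to \<open>\<epsilon>\<close>
    and \<open>4 * \<eta>\<close> equal to \<open>\<epsilon>\<^sup>2\<close>, which is at most
    \<open>\<epsilon>\<close>.\<close>
  define \<eta> where "\<eta> = \<epsilon>\<^sup>2 / 4"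
  have \<eta>: "\<eta> > 0" using \<epsilon> by (simp add: \<eta>_def)
  have "\<epsilon>\<^sup>2 \<le> \<epsilon>" using \<epsilon> by (simp add: power2_eq_square mult_left_le)
  then have \<eta>\<epsilon>: "sqrt (4 * \<eta>) + 4 * \<eta> \<le> 2 * \<epsilon>" using \<epsilon> by (simp add: \<eta>_def)
  \<comment> \<open>\<open>L\<close> brings the variance bound at the next scale,
    \<open>a\<^sup>2 / L\<close>, down to \<open>\<eta>\<close>. \<open>J\<close> steps suffice
    because the two averages together can drop by at most \<open>2 * a\<close>. \<open>m0\<close>
    keeps the blow-up error \<open>a * t\<^sup>2 / M\<close> at most
    \<open>\<epsilon> / 2\<close>.\<close>
  define L where "L = nat \<lceil>a\<^sup>2 / \<eta>\<rceil> + 2"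
  have L: "2 \<le> L" "a\<^sup>2 / \<eta> \<le> L" unfolding L_def by linarith+
  define J where "J = nat \<lceil>2 * a / \<eta>\<rceil> + 1"
  have J: "0 < J" "2 * a / \<eta> \<le> J" unfolding J_def by linarith+
  define m0 where "m0 = t + 1 + nat \<lceil>2 * a * (real t)\<^sup>2 / \<epsilon>\<rceil>"
  have m0: "1 \<le> m0" "t < m0" "2 * a * (real t)\<^sup>2 / \<epsilon> \<le> m0" unfolding m0_def by linarith+
  let ?s = "sample_scale m0 L"
  have s_step: "1 \<le> ?s j" "2 * ?s j \<le> ?s (Suc j)" for j
    using sample_scale_step[OF m0(1) L(1)] by auto
  have s_ge: "m0 \<le> ?s j" for j using sample_scale_mono[OF m0(1) L(1), of 0 j] by simp
  have "\<forall>j. \<exists>n1. \<forall>c. (\<forall>i\<ge>1. 0 \<le> c i) \<longrightarrow> (\<forall>i\<ge>t. 1 \<le> c i) \<longrightarrow> c t = a \<longrightarrow>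
    (\<forall>(V :: 'a set) E. finite V \<longrightarrow> n1 \<le> card V \<longrightarrow>
      cov t V E c \<le> (mean V (?s j) (clique_density {1..} t c E) + \<epsilon>) * (card V choose t) \<and>
      dec t V E c \<le> (mean V (?s j) (clique_density {1} t c E) + \<epsilon>) * (card V choose t))"
    (is "\<forall>j. ?rounds j")
  proof
    fix j
    have "1 \<le> t" "t < ?s j" using t m0(2) s_ge[of j] by linarith+
    from integral_rounding[OF a \<epsilon>(1) this] show "?rounds j" .
  qed
  from choice[OF this] obtain n1 where n1: "\<forall>j c. (\<forall>i\<ge>1. 0 \<le> c i) \<longrightarrow> (\<forall>i\<ge>t. 1 \<le> c i) \<longrightarrow> c t = a \<longrightarrow>
    (\<forall>(V :: 'a set) E. finite V \<longrightarrow> n1 j \<le> card V \<longrightarrow>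
      cov t V E c \<le> (mean V (?s j) (clique_density {1..} t c E) + \<epsilon>) * (card V choose t) \<and>
      dec t V E c \<le> (mean V (?s j) (clique_density {1} t c E) + \<epsilon>) * (card V choose t))"
    by (elim exE)
  \<comment> \<open>Which scale \<open>j\<close> is used depends on the graph and on
    \<open>c\<close>, so \<open>n0\<close> has to serve every \<open>j < J\<close>. The last summand
    keeps the blow-up error \<open>a * t * M / n\<close> at most
    \<open>\<epsilon> / 2\<close>.\<close>
  define n0 where "n0 = Max (n1 ` {..<J}) + ?s J + nat \<lceil>2 * a * t * ?s J / \<epsilon>\<rceil>"
  show ?thesis
  proof (intro exI[of _ n0] allI impI)
    fix c :: "nat \<Rightarrow> real" and V :: "'a set" and E
    assume c: "\<forall>i\<ge>1. 0 \<le> c i" "\<forall>i\<ge>t. 1 \<le> c i" "c t = a" and V: "finite V" and n: "n0 < card V"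
    let ?n = "card V" and ?Qs = "{{1..}, {1}} :: real set set"
    let ?\<mu> = "\<lambda>Q j. mean V (?s j) (clique_density Q t c E)"
    have sJ: "?s J \<le> ?n" "2 * a * t * ?s J / \<epsilon> \<le> ?n"
      using n unfolding n0_def by linarith+
    have s_le: "?s j \<le> ?n" if "j \<le> J" for j
      using sample_scale_mono[OF m0(1) L(1) that] sJ(1) by linarith
    have t_s: "t < ?s j" for j using m0(2) s_ge[of j] by linarith
    have \<mu>: "0 \<le> ?\<mu> Q j" "?\<mu> Q j \<le> a" if "Q \<in> ?Qs" "j \<le> J" for Q j
      using mean_density_bounds[OF that(1) V c(1), of t "?s j" E] t s_le[OF that(2)] t_s[of j] c(3)
        by auto
    \<comment> \<open>Neither average increases from one scale to the next, so a small drop of the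
      sum is a small drop of each, and one \<open>j\<close> serves covers and decompositions
      alike.\<close>
    let ?D = "\<lambda>j. ?\<mu> {1..} j + ?\<mu> {1} j"
    have "?D 0 - ?D J \<le> 2 * a"
      using \<mu>[of "{1..}"] \<mu>[of "{1}"] by (smt (verit) insertCI le0 order_refl)
    also have "2 * a \<le> J * \<eta>" using J(2) \<eta> by (simp add: divide_le_eq)
    finally obtain j where j: "j < J" "?D j - ?D (Suc j) \<le> \<eta>"
      using small_step_exists[of ?D J \<eta>] J(1) by blast
    have decreasing: "?\<mu> Q (Suc j) \<le> ?\<mu> Q j" if "Q \<in> ?Qs" for Q
      using mean_density_decreasing[OF that V c(1), of t "?s j" "?s (Suc j)"
          E] t t_s[of j] s_step[of j] s_le[of "Suc j"] j(1)
      by auto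
    define M where "M = ?s (Suc j)"
    have M: "t < M" "m0 \<le> M" "M \<le> ?s J" "M \<le> ?n"
      using t_s[of "Suc j"] s_ge[of "Suc j"] sample_scale_mono[OF m0(1) L(1), of "Suc j"
          J] s_le[of "Suc j"] j(1)
      unfolding M_def by (simp_all del: sample_scale.simps)
    have gap: "?\<mu> Q j - mean V M (clique_density Q t c E) \<le> \<eta>" if "Q \<in> ?Qs" for Q
      using that j(2) decreasing[of "{1..}"] decreasing[of "{1}"] unfolding M_def by auto
    have var: "(c t)\<^sup>2 * ((real (?s j))\<^sup>2 / M) \<le> \<eta>"
    proof -
      have "real M = L * (real (?s j))\<^sup>2" by (simp add: M_def)
      moreover have "real (?s j) > 0" using s_step(1)[of j] by simp
      ultimately have "(real (?s j))\<^sup>2 / M = 1 / L" using L(1) by (simp add: field_simps)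
      moreover have "a\<^sup>2 / L \<le> \<eta>" using L \<eta> by (simp add: divide_le_eq mult.commute)
      ultimately show ?thesis using c(3) by simp
    qed
    obtain S where S: "S \<in> nsets V M"
      "\<And>Q. Q \<in> ?Qs \<Longrightarrow> clique_density Q t c E S \<ge> ?\<mu> Q j - sqrt (4 * \<eta>) - 4 * \<eta>"
      using good_sample[OF V c(1), of t "?s j" M E \<eta>] gap var t t_s[of j] s_step(2)[of j] M(4)
      unfolding M_def by auto
    have S': "finite S" "card S = M" using S(1) by (auto simp: nsets_def)
    define q where "q = ?n div M"
    have q: "q > 0" using M t by (simp add: q_def div_greater_zero_iff)
    obtain P where P: "\<forall>s\<in>S. P s \<subseteq> V \<and> card (P s) = q" "disjoint_family_on P S"
      using disjoint_parts_exist[OF S'(1) V, of q] S'(2) by (auto simp: q_def)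
    interpret blow_up S V E P q using S'(1) V P by unfold_locales auto
    have main: "I \<le> frac_value Q t V edges c + \<rho> * real ?n ^ t"
      if Q: "Q \<in> ?Qs" and I: "I \<le> (?\<mu> Q j + \<epsilon>) * (?n choose t)" for Q I
    proof -
      let ?d = "clique_density Q t c E S"
      have d: "0 \<le> ?d" "?d \<le> a"
        using density_bounds[OF Q S'(1) c(1), of t E] t M(1) S'(2) c(3) by auto
      have "?d * (real q ^ t * real (M choose t)) = real q ^ t * frac_value Q t S E c"
        using M(1) S'(2) by (simp add: clique_density_def)
      also have "\<dots> \<le> frac_value Q t V edges c" using Q c(1) t q by (rule frac_value_blow_up)
      finally have blow: "?d * (real q ^ t * real (M choose t)) \<le> frac_value Q t V edges c" .
      have "?\<mu> Q j + \<epsilon> \<le> ?d + 3 * \<epsilon>" using S(2)[OF Q] \<eta>\<epsilon> by linarith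
      then have "I \<le> (?d + 3 * \<epsilon>) * (?n choose t)"
        using I mult_right_mono[of "?\<mu> Q j + \<epsilon>" "?d + 3 * \<epsilon>" "real (?n choose t)"] by simp
      moreover have "3 * \<epsilon> * (?n choose t) \<le> 3 * \<epsilon> * real ?n ^ t"
      proof -
        have "real ?n ^ t / fact t \<le> real ?n ^ t / 1" by (intro divide_left_mono) auto
        then have "real (?n choose t) \<le> real ?n ^ t"
          using binomial_le_pow_div_fact[of ?n t] by linarith
        then show ?thesis using \<epsilon> by simp
      qed
      moreover have "?d * (?n choose t) \<le> ?d * (real q ^ t * real (M choose t)) + \<epsilon> * real ?n ^ t"
      proof -
        let ?g = "real t * real M / real ?n + (real t)\<^sup>2 / real M"
        have pos: "real M > 0" "real ?n > 0" using M by simp_all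
        have "a * (real t * real M / real ?n) \<le> \<epsilon> / 2"
        proof -
          have "2 * a * t * M \<le> 2 * a * t * ?s J" using M(3) a by (intro mult_left_mono) auto
          also have "\<dots> \<le> ?n * \<epsilon>" using sJ(2) \<epsilon> by (simp add: divide_le_eq)
          finally show ?thesis using pos by (simp add: field_simps)
        qed
        moreover have "a * ((real t)\<^sup>2 / real M) \<le> \<epsilon> / 2"
        proof -
          have "2 * a * (real t)\<^sup>2 \<le> m0 * \<epsilon>" using m0(3) \<epsilon> by (simp add: divide_le_eq)
          also have "\<dots> \<le> M * \<epsilon>" using M(2) \<epsilon> by simp
          finally show ?thesis using pos by (simp add: field_simps)
        qed
        ultimately have "a * ?g \<le> \<epsilon>" by (simp only: distrib_left)
        moreover have "?d * ?g \<le> a * ?g" using d by (intro mult_right_mono) auto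
        ultimately have "?d * ?g * real ?n ^ t \<le> \<epsilon> * real ?n ^ t" by (intro mult_right_mono) auto
        moreover have "?d * (?n choose t) \<le> ?d * (real q ^ t * real (M choose t) + ?g *
            real ?n ^ t)"
          unfolding q_def
            using choose_blow_up_gap[of t M ?n] t M d(1) by (intro mult_left_mono) auto
        moreover have "?d * (A + ?g * B) = ?d * A + ?d * ?g * B" for A B
          by (simp only: distrib_left[of ?d A] mult.assoc)
        ultimately show ?thesis by simp
      qed
      ultimately have "I \<le> frac_value Q t V edges c + (4 * \<epsilon>) * real ?n ^ t"
        using blow by (simp add: distrib_right)
      moreover have "(4 * \<epsilon>) * real ?n ^ t \<le> \<rho> * real ?n ^ t"
        using \<epsilon>(3) by (intro mult_right_mono) auto
      ultimately show ?thesis by linarith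
    qed
    have "n1 j \<le> ?n"
    proof -
      have "n1 j \<le> Max (n1 ` {..<J})" using j(1) by (intro Max_ge) auto
      then show ?thesis using n unfolding n0_def by linarith
    qed
    then have "cov t V E c \<le> (?\<mu> {1..} j + \<epsilon>) * (?n choose t)" "dec t V E c \<le> (?\<mu> {1} j + \<epsilon>) *
        (?n choose t)"
      using n1[rule_format, of c V j E] c V by auto
    then have "cov t V E c \<le> frac_cov t V edges c + \<rho> * real ?n ^ t \<and>
        dec t V E c \<le> frac_dec t V edges c + \<rho> * real ?n ^ t"
      unfolding frac_cov_eq frac_dec_eq using main[of "{1..}"] main[of "{1}"] by simp
    then show "\<exists>E'. E' \<subseteq> nsets V 2 \<and>
        cov t V E c \<le> frac_cov t V E' c + \<rho> * real ?n ^ t \<and>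
        dec t V E c \<le> frac_dec t V E' c + \<rho> * real ?n ^ t"
      using edges_subset by blast
  qed
qed

section \<open>Uniformity in \<open>t\<close>\<close>

theorem theorem1p9:
  fixes \<rho> ct :: real
  assumes "\<rho> > 0"
  shows "\<exists>n0::nat. \<forall>t\<ge>2. \<forall>c :: nat \<Rightarrow> real.
    (\<forall>i\<ge>1. c i \<ge> 0) \<longrightarrow> (\<forall>i\<ge>t. c i \<ge> 1) \<longrightarrow> c t = ct \<longrightarrow>
    (\<forall>n>n0. \<forall>(V :: 'a set) E. fin_graph V E \<and> card V = n \<longrightarrow>
      (\<exists>(V' :: 'a set) E'. fin_graph V' E' \<and> card V' = n \<and>
        cov t V E c \<le> frac_cov t V' E' c + \<rho> * real n ^ t \<and>
        dec t V E c \<le> frac_dec t V' E' c + \<rho> * real n ^ t))"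
proof (cases "ct > 0")
  case False
  \<comment> \<open>No sequence meets the hypotheses here, as they force
    \<open>c t \<ge> 1\<close>.\<close>
  then show ?thesis by (intro exI[of _ 0] allI impI) (metis less_le_trans order_refl zero_less_one)
next
  case True
  have "\<forall>t. \<exists>n0. 2 \<le> t \<longrightarrow> (\<forall>c. (\<forall>i\<ge>1. 0 \<le> c i) \<longrightarrow> (\<forall>i\<ge>t. 1 \<le> c i) \<longrightarrow> c t = ct \<longrightarrow>
    (\<forall>(V :: 'a set) E. finite V \<longrightarrow> n0 < card V \<longrightarrow>
      (\<exists>E'. E' \<subseteq> nsets V 2 \<and>
        cov t V E c \<le> frac_cov t V E' c + \<rho> * real (card V) ^ t \<and>
        dec t V E c \<le> frac_dec t V E' c + \<rho> * real (card V) ^ t)))"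
    (is "\<forall>t. ?majorant t")
  proof
    fix t show "?majorant t"
    proof (cases "2 \<le> t")
      case True
      from fractional_majorant[OF assms \<open>ct > 0\<close> True] show ?thesis by (elim ex_forward) (rule impI)
    qed simp
  qed
  from choice[OF this] obtain N where N: "\<forall>t. 2 \<le> t \<longrightarrow> (\<forall>c. (\<forall>i\<ge>1. 0 \<le> c i) \<longrightarrow> (\<forall>i\<ge>t. 1 \<le> c i) \<longrightarrow>
      c t = ct \<longrightarrow>
    (\<forall>(V :: 'a set) E. finite V \<longrightarrow> N t < card V \<longrightarrow>
      (\<exists>E'. E' \<subseteq> nsets V 2 \<and>
        cov t V E c \<le> frac_cov t V E' c + \<rho> * real (card V) ^ t \<and>
        dec t V E c \<le> frac_dec t V E' c + \<rho> * real (card V) ^ t)))"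
    by (elim exE)
  \<comment> \<open>\<open>n0\<close> is chosen before \<open>t\<close>. Only the finitely many
    \<open>t \<le> T\<close> get a threshold of their own; beyond \<open>T\<close> the bound
    \<open>ct \<le> \<rho> * fact t\<close> makes the trivial decomposition cheap enough.\<close>
  define T where "T = nat \<lceil>ct / \<rho>\<rceil>"
  define n0 where "n0 = Max (N ` {..T})"
  show ?thesis
  proof (intro exI[of _ n0] allI impI)
    fix t n :: nat and c :: "nat \<Rightarrow> real" and V :: "'a set" and E
    assume t: "2 \<le> t" and c: "\<forall>i\<ge>1. 0 \<le> c i" "\<forall>i\<ge>t. 1 \<le> c i" "c t = ct" and n: "n0 < n"
      and G: "fin_graph V E \<and> card V = n"
    have V: "finite V" using G by (simp add: fin_graph_def)
    have "\<exists>E'. E' \<subseteq> nsets V 2 \<and>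
        cov t V E c \<le> frac_cov t V E' c + \<rho> * real (card V) ^ t \<and>
        dec t V E c \<le> frac_dec t V E' c + \<rho> * real (card V) ^ t"
    proof (cases "t \<le> T")
      case True
      then have "N t \<le> n0" unfolding n0_def by (intro Max_ge) auto
      then have "N t < card V" using n G by simp
      with c show ?thesis by (intro N[rule_format] t V) auto
    next
      case False
      text \<open>For large \<open>t\<close> there are at most \<open>n ^ t / fact t\<close> cliques of size \<open>t\<close>, which is few
        enough to use each of them.\<close>
      have "real_of_int \<lceil>ct / \<rho>\<rceil> \<le> t" using False unfolding T_def by linarith
      then have "ct / \<rho> \<le> t" using le_of_int_ceiling[of "ct / \<rho>"] by linarith
      also have "real t \<le> fact t" using fact_ge_self[of t] by (metis of_nat_fact of_nat_le_iff)
      finally have "ct \<le> \<rho> * fact t" using assms by (simp add: divide_le_eq mult.commute)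
      have "ct * (card V choose t) \<le> ct * (real (card V) ^ t / fact t)"
        using \<open>ct > 0\<close> binomial_le_pow_div_fact by (intro mult_left_mono) auto
      also have "\<dots> \<le> \<rho> * real (card V) ^ t"
        using mult_right_mono[OF \<open>ct \<le> \<rho> * fact t\<close>, of "real (card V) ^ t"]
          by (simp add: divide_le_eq mult_ac)
      finally have small: "ct * (card V choose t) \<le> \<rho> * real (card V) ^ t" .
      have "1 \<le> t" using t by simp
      then have "0 \<le> frac_cov t V E c" "0 \<le> frac_dec t V E c"
        unfolding frac_cov_eq frac_dec_eq using c(1) V by (auto intro!: frac_value_nonneg)
      then have "cov t V E c \<le> frac_cov t V E c + \<rho> * real (card V) ^ t"
        "dec t V E c \<le> frac_dec t V E c + \<rho> * real (card V) ^ t"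
        using integral_le_choose[OF V c(1) \<open>1 \<le> t\<close>, of E] small unfolding c(3) by linarith+
      moreover have "E \<subseteq> nsets V 2" using G by (simp add: fin_graph_def)
      ultimately show ?thesis by blast
    qed
    then show "\<exists>(V' :: 'a set) E'. fin_graph V' E' \<and> card V' = n \<and>
        cov t V E c \<le> frac_cov t V' E' c + \<rho> * real n ^ t \<and>
        dec t V E c \<le> frac_dec t V' E' c + \<rho> * real n ^ t"
      using G V unfolding fin_graph_def by metis
  qed
qed

end
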